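(* Let $\Phi(\underline a,\underline x)$ be a quantifier free formula in the first order theory of real closed valued fields. View the $a_i$'s as parameters and the $x_j$'s as variables. Then one can give a quantifier free formula $\Psi(\underline a)$ such that the two formulae $\exists\underline x\ \Phi(\underline a,\underline x)$ and $\Psi(\underline a)$ are equivalent in the formal theory. (The terms appearing in the formulae $\Phi$ and $\Psi$ are $\mathbb Z$-polynomials in the parameters, and, in the case of $\Phi$, also in the variables.)
   Context: The first order theory of real closed valued fields is based on the language of ordered fields $(0,1,+,-,\times,=,\le)$ to which the binary predicate $x\preceq y$ is added; all constants and variables represent elements of the field. A real closed valued field is a real closed field $\mathbf R$ together with a valuation ring $\mathbf V\subsetneq\mathbf R$ which is convex (if $x,y\ge0$ and $x+y\in\mathbf V$ then $x\in\mathbf V$). With $v$ the valuation, $x\preceq y$ means $v(x)\le v(y)$, i.e. $x=y=0$, or $x\ne0$ and $y/x\in\mathbf V$. *)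

theory Defs
  imports Main
begin

section \<open>First-order language\<close>

text \<open>Terms of the language of ordered rings, i.e. notations for polynomials with integer
  coefficients. Variables are de Bruijn indices.\<close>

datatype tm =
    Var nat
  | Zero
  | One
  | Add tm tm
  | Minus tm
  | Mult tm tm

text \<open>\<open>Val s t\<close> is the atomic formula \<open>s \<preceq> t\<close>. The connectives that are not
  constructors are the usual classical abbreviations.\<close>

datatype fm =
    Fls
  | Eq tm tm
  | Leq tm tm
  | Val tm tm
  | Imp fm fm
  | Forall fm

abbreviation Neg :: "fm \<Rightarrow> fm" where
  "Neg A \<equiv> Imp A Fls"

abbreviation Disj :: "fm \<Rightarrow> fm \<Rightarrow> fm" where
  "Disj A B \<equiv> Imp (Neg A) B"

abbreviation Conj :: "fm \<Rightarrow> fm \<Rightarrow> fm" where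
  "Conj A B \<equiv> Neg (Imp A (Neg B))"

abbreviation Iff :: "fm \<Rightarrow> fm \<Rightarrow> fm" where
  "Iff A B \<equiv> Conj (Imp A B) (Imp B A)"

abbreviation Exists :: "fm \<Rightarrow> fm" where
  "Exists A \<equiv> Neg (Forall (Neg A))"

abbreviation Alls :: "nat \<Rightarrow> fm \<Rightarrow> fm" where
  "Alls n A \<equiv> (Forall ^^ n) A"

text \<open>\<open>Exs n A\<close> binds the variables \<open>0, \<dots>, n - 1\<close> of \<open>A\<close>; the variable
  \<open>n + i\<close> of \<open>A\<close> is the variable \<open>i\<close> of \<open>Exs n A\<close>.\<close>

abbreviation Exs :: "nat \<Rightarrow> fm \<Rightarrow> fm" where
  "Exs n A \<equiv> (Exists ^^ n) A"

primrec qfree :: "fm \<Rightarrow> bool" where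
  "qfree Fls = True"
| "qfree (Eq s t) = True"
| "qfree (Leq s t) = True"
| "qfree (Val s t) = True"
| "qfree (Imp A B) = (qfree A \<and> qfree B)"
| "qfree (Forall A) = False"

primrec fv_tm :: "tm \<Rightarrow> nat set" where
  "fv_tm (Var i) = {i}"
| "fv_tm Zero = {}"
| "fv_tm One = {}"
| "fv_tm (Add s t) = fv_tm s \<union> fv_tm t"
| "fv_tm (Minus t) = fv_tm t"
| "fv_tm (Mult s t) = fv_tm s \<union> fv_tm t"

primrec fv :: "fm \<Rightarrow> nat set" where
  "fv Fls = {}"
| "fv (Eq s t) = fv_tm s \<union> fv_tm t"
| "fv (Leq s t) = fv_tm s \<union> fv_tm t"
| "fv (Val s t) = fv_tm s \<union> fv_tm t"
| "fv (Imp A B) = fv A \<union> fv B"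
| "fv (Forall A) = {i. Suc i \<in> fv A}"

section \<open>Classical first-order logic with equality\<close>

primrec subst_tm :: "(nat \<Rightarrow> tm) \<Rightarrow> tm \<Rightarrow> tm" where
  "subst_tm \<sigma> (Var i) = \<sigma> i"
| "subst_tm \<sigma> Zero = Zero"
| "subst_tm \<sigma> One = One"
| "subst_tm \<sigma> (Add s t) = Add (subst_tm \<sigma> s) (subst_tm \<sigma> t)"
| "subst_tm \<sigma> (Minus t) = Minus (subst_tm \<sigma> t)"
| "subst_tm \<sigma> (Mult s t) = Mult (subst_tm \<sigma> s) (subst_tm \<sigma> t)"

abbreviation shift :: "nat \<Rightarrow> tm" where
  "shift i \<equiv> Var (Suc i)"

abbreviation under :: "(nat \<Rightarrow> tm) \<Rightarrow> nat \<Rightarrow> tm" where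
  "under \<sigma> \<equiv> case_nat (Var 0) (\<lambda>i. subst_tm shift (\<sigma> i))"

primrec subst :: "(nat \<Rightarrow> tm) \<Rightarrow> fm \<Rightarrow> fm" where
  "subst \<sigma> Fls = Fls"
| "subst \<sigma> (Eq s t) = Eq (subst_tm \<sigma> s) (subst_tm \<sigma> t)"
| "subst \<sigma> (Leq s t) = Leq (subst_tm \<sigma> s) (subst_tm \<sigma> t)"
| "subst \<sigma> (Val s t) = Val (subst_tm \<sigma> s) (subst_tm \<sigma> t)"
| "subst \<sigma> (Imp A B) = Imp (subst \<sigma> A) (subst \<sigma> B)"
| "subst \<sigma> (Forall A) = Forall (subst (under \<sigma>) A)"

text \<open>Instantiation of the variable \<open>0\<close>; the other variables are decremented.\<close>

abbreviation inst :: "tm \<Rightarrow> fm \<Rightarrow> fm" where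
  "inst t \<equiv> subst (case_nat t Var)"

text \<open>Natural deduction. In the rule \<open>AllI\<close> shifting the assumptions makes the variable
  \<open>0\<close> an eigenvariable; the elements of \<open>T\<close> are not shifted, as they are meant to be
  sentences.\<close>

inductive derivable :: "fm set \<Rightarrow> fm list \<Rightarrow> fm \<Rightarrow> bool" for T :: "fm set" where
  Axiom: "A \<in> T \<Longrightarrow> derivable T \<Gamma> A"
| Assum: "A \<in> set \<Gamma> \<Longrightarrow> derivable T \<Gamma> A"
| ImpI: "derivable T (A # \<Gamma>) B \<Longrightarrow> derivable T \<Gamma> (Imp A B)"
| ImpE: "derivable T \<Gamma> (Imp A B) \<Longrightarrow> derivable T \<Gamma> A \<Longrightarrow> derivable T \<Gamma> B"
| Contr: "derivable T (Neg A # \<Gamma>) Fls \<Longrightarrow> derivable T \<Gamma> A"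
| AllI: "derivable T (map (subst shift) \<Gamma>) A \<Longrightarrow> derivable T \<Gamma> (Forall A)"
| AllE: "derivable T \<Gamma> (Forall A) \<Longrightarrow> derivable T \<Gamma> (inst t A)"
| EqI: "derivable T \<Gamma> (Eq t t)"
| EqE: "derivable T \<Gamma> (Eq s t) \<Longrightarrow> derivable T \<Gamma> (inst s A) \<Longrightarrow> derivable T \<Gamma> (inst t A)"

abbreviation entails :: "fm set \<Rightarrow> fm \<Rightarrow> bool" (infix "\<turnstile>" 50) where
  "T \<turnstile> A \<equiv> derivable T [] A"

section \<open>Real closed valued fields\<close>

definition ordered_field_axioms :: "fm set" where
  "ordered_field_axioms = (let x = Var 0; y = Var 1; z = Var 2 in
    {Alls 3 (Eq (Add (Add x y) z) (Add x (Add y z))),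
     Alls 2 (Eq (Add x y) (Add y x)),
     Alls 1 (Eq (Add x Zero) x),
     Alls 1 (Eq (Add x (Minus x)) Zero),
     Alls 3 (Eq (Mult (Mult x y) z) (Mult x (Mult y z))),
     Alls 2 (Eq (Mult x y) (Mult y x)),
     Alls 1 (Eq (Mult x One) x),
     Alls 3 (Eq (Mult x (Add y z)) (Add (Mult x y) (Mult x z))),
     Neg (Eq Zero One),
     Alls 1 (Imp (Neg (Eq x Zero)) (Exists (Eq (Mult (Var 1) (Var 0)) One))),
     Alls 1 (Leq x x),
     Alls 2 (Imp (Leq x y) (Imp (Leq y x) (Eq x y))),
     Alls 3 (Imp (Leq x y) (Imp (Leq y z) (Leq x z))),
     Alls 2 (Disj (Leq x y) (Leq y x)),
     Alls 3 (Imp (Leq x y) (Leq (Add x z) (Add y z))),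
     Alls 2 (Imp (Leq Zero x) (Imp (Leq Zero y) (Leq Zero (Mult x y))))})"

primrec pow_tm :: "tm \<Rightarrow> nat \<Rightarrow> tm" where
  "pow_tm t 0 = One"
| "pow_tm t (Suc k) = Mult t (pow_tm t k)"

text \<open>\<open>poly_tm k\<close> is the generic polynomial of formal degree \<open>k - 1\<close> in the variable
  \<open>0\<close>, the coefficient of degree \<open>i\<close> being the variable \<open>i + 1\<close>.\<close>

primrec poly_tm :: "nat \<Rightarrow> tm" where
  "poly_tm 0 = Zero"
| "poly_tm (Suc k) = Add (poly_tm k) (Mult (Var (Suc k)) (pow_tm (Var 0) k))"

text \<open>Nonnegative elements are squares, and polynomials of odd degree \<open>2 * n + 1\<close>
  have a root.\<close>

definition real_closed_axioms :: "fm set" where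
  "real_closed_axioms =
    {Alls 1 (Imp (Leq Zero (Var 0)) (Exists (Eq (Mult (Var 0) (Var 0)) (Var 1))))} \<union>
    {Alls (2 * n + 2) (Imp (Neg (Eq (Var (2 * n + 1)) Zero)) (Exists (Eq (poly_tm (2 * n + 2)) Zero)))
      | n. True}"

text \<open>\<open>InV t\<close> says that \<open>t\<close> lies in the valuation ring. The axioms say, in this order:
  the valuation ring is a subring, contains \<open>x\<close> or its inverse for every nonzero \<open>x\<close>,
  is a proper subset and is convex; \<open>x \<preceq> y\<close> holds iff \<open>x = y = 0\<close>, or \<open>x \<noteq> 0\<close> and
  \<open>y / x\<close> (which is \<open>Var 0\<close> below the existential quantifier) lies in the valuation ring.\<close>

abbreviation InV :: "tm \<Rightarrow> fm" where
  "InV t \<equiv> Val One t"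

definition valuation_axioms :: "fm set" where
  "valuation_axioms = (let x = Var 0; y = Var 1 in
    {InV One,
     Alls 1 (Imp (InV x) (InV (Minus x))),
     Alls 2 (Imp (InV x) (Imp (InV y) (InV (Add x y)))),
     Alls 2 (Imp (InV x) (Imp (InV y) (InV (Mult x y)))),
     Alls 2 (Imp (Eq (Mult x y) One) (Disj (InV x) (InV y))),
     Exists (Neg (InV x)),
     Alls 2 (Imp (Leq Zero x) (Imp (Leq Zero y) (Imp (InV (Add x y)) (InV x)))),
     Alls 2 (Iff (Val x y)
       (Disj (Conj (Eq x Zero) (Eq y Zero))
           (Conj (Neg (Eq x Zero))
                (Exists (Conj (Eq (Mult (Var 0) (Var 1)) (Var 2)) (InV (Var 0)))))))})"

definition RCVF :: "fm set" where
  "RCVF = ordered_field_axioms \<union> real_closed_axioms \<union> valuation_axioms"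

end

theory Submission
  imports Defs "HOL-Algebra.Algebraic_Closure_Type" "HOL-Library.Countable"
begin

text \<open>By completeness it suffices to eliminate one existential quantifier, uniformly in all models.

  In a real closed field a formula without valuation keeps its truth value between adjacent roots
  of its polynomials, so an existential quantifier reduces to quantifiers over roots of
  polynomials. These are eliminated by induction on the degree: modulo \<open>p = 0\<close> all other
  polynomials have smaller degree than \<open>p\<close>, and a root of \<open>p\<close> which is not a root of one of
  them is detected by a change of sign of \<open>p\<close> between two adjacent roots of polynomials of
  smaller degree.

  The valuation ring \<open>V\<close> is convex, so \<open>s \<preceq> t\<close> holds iff \<open>t\<^sup>2 \<le> u s\<^sup>2\<close> for all large
  \<open>u \<in> V\<close>, and fails iff \<open>t\<^sup>2 > w s\<^sup>2\<close> for all small positive \<open>w \<notin> V\<close>. With \<open>u\<close> and \<open>w\<close> as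
  new parameters the quantifier is eliminated as in a real closed field. Afterwards \<open>w\<close> and
  \<open>u\<close> are removed: near the cut defined by \<open>V\<close> a polynomial has the sign and the valuation of
  its dominant monomial, and which one dominates is decided by the valuations of the coefficients.\<close>

section \<open>Finite symmetric expressions in the roots of a polynomial\<close>

text \<open>The axioms provide only square roots and roots in odd degree, so sign arguments first
  need an intermediate value theorem. It is obtained algebraically: adjoining a square root of -1
  yields a root of every nonconstant polynomial over the field, hence such polynomials split off
  linear or positive quadratic factors. Two parameters, one on each side of the cut, are forced by
  negation. Valuation atoms are replaced according to their polarity, so that the approximating
  formula implies the original one for all admissible u and w; with u alone a negated atom would be
  weakened. For a fixed x the two formulas agree near the cut. Together these facts carry the
  existential quantifier through the limit, although a witness may depend on u and w. The order of
  removal matters. Outside V the valuation of a monomial in w depends on w, so w goes first, while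
  no valuation occurs. This introduces valuations of polynomials in u, but u is eventually a unit of
  V and does not affect them.\<close>

lemma newton_identity:
  fixes xs :: "'b::field_char_0 list"
  shows "fps_deriv (\<Prod>x\<leftarrow>xs. fps_of_poly [:1, -x:]) =
    - ((\<Prod>x\<leftarrow>xs. fps_of_poly [:1, -x:]) * Abs_fps (\<lambda>k. \<Sum>x\<leftarrow>xs. x ^ Suc k))"
proof (induction xs)
  case Nil
  then show ?case by (simp add: fps_eq_iff)
next
  case (Cons a xs)
  define F where "F = (\<Prod>x\<leftarrow>xs. fps_of_poly [:1, -x:])"
  define S where "S = Abs_fps (\<lambda>k. \<Sum>x\<leftarrow>xs. x ^ Suc k)"
  \<comment> \<open>Logarithmic derivative: a factor 1 - a T contributes -a / (1 - a T), and
    \<open>A\<close> is the geometric series of a / (1 - a T). The constant term 1 of the factors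
    makes these quotients power series.\<close>
  define A where "A = Abs_fps (\<lambda>k. a ^ Suc k)"
  have e: "fps_of_poly [:1, -a:] = 1 - fps_const a * fps_X"
    by (simp add: fps_of_poly_pCons)
  have sA: "Abs_fps (\<lambda>k. \<Sum>x\<leftarrow>a # xs. x ^ Suc k) = A + S"
    by (simp add: A_def S_def fps_eq_iff)
  have aA: "(1 - fps_const a * fps_X) * A = fps_const a"
  proof (rule fps_ext)
    fix n
    show "((1 - fps_const a * fps_X) * A) $ n = fps_const a $ n"
      by (cases n) (simp_all add: A_def left_diff_distrib mult.assoc)
  qed
  define L where "L = 1 - fps_const a * fps_X"
  have dL: "fps_deriv L = - fps_const a" by (simp add: L_def)
  have "fps_deriv (L * F) = L * - (F * S) + - fps_const a * F"
    using Cons.IH unfolding F_def[symmetric] S_def[symmetric] fps_deriv_mult dL by simp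
  also have "\<dots> = - (L * F * (A + S))"
    using aA unfolding L_def[symmetric] by (metis (no_types) add.commute distrib_left minus_add_distrib minus_mult_left minus_mult_right mult.assoc mult.commute)
  finally show ?case unfolding sA by (simp add: F_def L_def e)
qed

lemma fps_power_sums_rec:
  fixes xs :: "'b::field_char_0 list"
  defines "F \<equiv> (\<Prod>x\<leftarrow>xs. [:1, -x:])" and "S \<equiv> \<lambda>k. \<Sum>x\<leftarrow>xs. x ^ Suc k"
  shows "coeff F 0 = 1" "of_nat (Suc k) * coeff F (Suc k) = - (\<Sum>i\<le>k. coeff F i * S (k - i))"
proof -
  show "coeff F 0 = 1" unfolding F_def by (induction xs) (auto simp: coeff_mult)
  have "fps_deriv (fps_of_poly F) $ k = (- (fps_of_poly F * Abs_fps S)) $ k"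
    using newton_identity[of xs] by (simp add: F_def S_def fps_of_poly_prod_list o_def)
  then show "of_nat (Suc k) * coeff F (Suc k) = - (\<Sum>i\<le>k. coeff F i * S (k - i))"
    by (simp add: fps_mult_nth atLeast0AtMost)
qed

section \<open>Products of pairs of list entries\<close>

primrec pair_products :: "'c::times list \<Rightarrow> 'c list" where
  "pair_products [] = []"
| "pair_products (x # xs) = map (\<lambda>y. x * y) xs @ pair_products xs"

lemma pair_products_power: "map (\<lambda>z. z ^ k) (pair_products xs) = pair_products (map (\<lambda>z. z ^ k) xs)"
  for xs :: "'b::comm_ring_1 list"
  by (induction xs) (auto simp: power_mult_distrib)

text \<open>Applied to the k-th powers of the entries, it turns power sums of pairwise products into
  power sums of the entries.\<close>

lemma sum_list_pair_products:
  "2 * sum_list (pair_products xs) = (sum_list xs)\<^sup>2 - (\<Sum>x\<leftarrow>xs. x\<^sup>2)" for xs :: "'b::comm_ring_1 list"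
  by (induction xs) (auto simp: algebra_simps power2_eq_square sum_list_const_mult)

text \<open>There are n (n - 1) / 2 pairs; the equation avoids division and subtraction. For even n
  > 0 this number has one factor 2 less than n, which drives the induction in
  \<open>root_in_CC\<close>.\<close>

lemma length_pair_products: "2 * length (pair_products xs) + length xs = (length xs)\<^sup>2"
  by (induction xs) (auto simp: power2_eq_square)

lemma set_pair_products:
  "z \<in> set (pair_products xs) \<Longrightarrow> \<exists>i j. i < j \<and> j < length xs \<and> z = xs ! i * xs ! j"
proof (induction xs)
  case Nil
  then show ?case by simp
next
  case (Cons x xs)
  show ?case
  proof (cases "z \<in> set (pair_products xs)")
    case True
    then obtain i j where "i < j" "j < length xs" "z = xs ! i * xs ! j" using Cons by auto
    then show ?thesis by (intro exI[of _ "Suc i"] exI[of _ "Suc j"]) auto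
  next
    case False
    then obtain j where "j < length xs" "z = x * xs ! j"
      using Cons by (auto simp: in_set_conv_nth)
    then show ?thesis by (intro exI[of _ 0] exI[of _ "Suc j"]) auto
  qed
qed

lemma poly_prod_linear_eq_0_iff:
  "poly (\<Prod>x\<leftarrow>xs. [:-x, 1:]) z = 0 \<longleftrightarrow> z \<in> set xs" for z :: "'b::field"
proof (induction xs)
  case (Cons a xs)
  have "poly (\<Prod>x\<leftarrow>a # xs. [:-x, 1:]) z = (z - a) * poly (\<Prod>x\<leftarrow>xs. [:-x, 1:]) z"
    by (simp add: algebra_simps)
  then show ?case using Cons by simp
qed simp

lemma degree_prod_linear: "degree (\<Prod>x\<leftarrow>xs. [:-x, 1:]) = length xs"
  for xs :: "'b::field list"
proof (induction xs)
  case (Cons a xs)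
  have "(\<Prod>x\<leftarrow>xs. [:-x, 1:]) \<noteq> 0" by (auto simp: prod_list_zero_iff)
  then show ?case using Cons by (simp add: degree_mult_eq del: mult_pCons_left)
qed simp

section \<open>Polynomials over a subfield and symmetric functions of their roots\<close>

definition poly_over :: "'b::field set \<Rightarrow> 'b poly \<Rightarrow> bool" where
  "poly_over K p \<longleftrightarrow> (\<forall>i. coeff p i \<in> K)"

text \<open>A set rather than a type, because the image of the field and its extension by
  \<open>imag\<close> are both considered inside \<open>'a alg_closure\<close>. Zero needs no
  exception since \<open>inverse 0 = 0\<close>.\<close>

definition subfield_of :: "'b::field set \<Rightarrow> bool" where
  "subfield_of K \<longleftrightarrow> 0 \<in> K \<and> 1 \<in> K \<and> (\<forall>x\<in>K. \<forall>y\<in>K. x + y \<in> K \<and> x * y \<in> K) \<and>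
     (\<forall>x\<in>K. - x \<in> K \<and> inverse x \<in> K)"

context
  fixes K :: "'b::field_char_0 set"
  assumes K: "subfield_of K"
begin

lemma subfield_closed:
  "0 \<in> K" "1 \<in> K" "x \<in> K \<Longrightarrow> y \<in> K \<Longrightarrow> x + y \<in> K" "x \<in> K \<Longrightarrow> y \<in> K \<Longrightarrow> x * y \<in> K"
  "x \<in> K \<Longrightarrow> - x \<in> K" "x \<in> K \<Longrightarrow> inverse x \<in> K" "x \<in> K \<Longrightarrow> y \<in> K \<Longrightarrow> x - y \<in> K"
  "x \<in> K \<Longrightarrow> y \<in> K \<Longrightarrow> x / y \<in> K" "of_nat n \<in> K" "x \<in> K \<Longrightarrow> x ^ n \<in> K"
proof -
  show b: "0 \<in> K" "1 \<in> K" "x \<in> K \<Longrightarrow> y \<in> K \<Longrightarrow> x + y \<in> K" "x \<in> K \<Longrightarrow> y \<in> K \<Longrightarrow> x * y \<in> K"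
    "x \<in> K \<Longrightarrow> - x \<in> K" "x \<in> K \<Longrightarrow> inverse x \<in> K" for x y
    using K by (auto simp: subfield_of_def)
  show "x \<in> K \<Longrightarrow> y \<in> K \<Longrightarrow> x - y \<in> K"
    using b(3)[of x "- y"] b(5)[of y] by simp
  show "x \<in> K \<Longrightarrow> y \<in> K \<Longrightarrow> x / y \<in> K"
    using b(4)[of x "inverse y"] b(6)[of y] by (simp add: divide_inverse)
  show "of_nat n \<in> K" by (induction n) (auto intro: b)
  show "x \<in> K \<Longrightarrow> x ^ n \<in> K" by (induction n) (auto intro: b)
qed

lemma subfield_sum: "(\<And>i. i \<in> A \<Longrightarrow> f i \<in> K) \<Longrightarrow> sum f A \<in> K"
  by (induction A rule: infinite_finite_induct) (auto intro: subfield_closed)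

lemma poly_over_closed:
  "poly_over K p \<Longrightarrow> poly_over K q \<Longrightarrow> poly_over K (p + q)"
  "poly_over K p \<Longrightarrow> poly_over K q \<Longrightarrow> poly_over K (p * q)"
  by (auto simp: poly_over_def coeff_mult intro!: subfield_closed subfield_sum)

lemma poly_over_pCons: "poly_over K (pCons a p) \<longleftrightarrow> a \<in> K \<and> poly_over K p"
  unfolding poly_over_def coeff_pCons by (auto split: nat.splits) 

lemma poly_over_0: "poly_over K 0"
  by (simp add: poly_over_def subfield_closed)

lemma poly_over_pcompose:
  "poly_over K p \<Longrightarrow> poly_over K q \<Longrightarrow> poly_over K (pcompose p q)"
  by (induction p) (auto simp: pcompose_pCons poly_over_pCons poly_over_0 intro!: poly_over_closed)

text \<open>The two products have reversed coefficient lists. The left one is the monic polynomial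
  with the given roots, the right one is the form to which Newton's identities apply.\<close>

lemma poly_over_reflect:
  fixes xs :: "'b list"
  shows "poly_over K (\<Prod>x\<leftarrow>xs. [:-x, 1:]) \<longleftrightarrow> poly_over K (\<Prod>x\<leftarrow>xs. [:1, -x:])"
proof -
  let ?P = "\<Prod>x\<leftarrow>xs. [:-x, 1:]"
  have r: "reflect_poly [:-x, 1:] = [:1, -x:]" for x :: 'b
    by (rule poly_eqI) (auto simp: coeff_reflect_poly coeff_pCons split: nat.splits)
  have R: "reflect_poly ?P = (\<Prod>x\<leftarrow>xs. [:1, -x:])"
    by (simp add: reflect_poly_prod_list o_def r)
  have "poly_over K ?P \<longleftrightarrow> poly_over K (reflect_poly ?P)"
  proof
    assume "poly_over K ?P"
    then show "poly_over K (reflect_poly ?P)"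
      by (auto simp: poly_over_def coeff_reflect_poly intro: subfield_closed)
  next
    assume a: "poly_over K (reflect_poly ?P)"
    show "poly_over K ?P" unfolding poly_over_def
    proof
      fix i
      show "coeff ?P i \<in> K"
      proof (cases "i \<le> degree ?P")
        case True
        then have "coeff ?P i = coeff (reflect_poly ?P) (degree ?P - i)"
          by (simp add: coeff_reflect_poly)
        then show ?thesis using a by (simp add: poly_over_def)
      next
        case False
        then show ?thesis by (simp add: coeff_eq_0 subfield_closed)
      qed
    qed
  qed
  then show ?thesis using R by simp
qed

text \<open>Newton's identities can be solved in both directions: for the power sum because
  \<open>coeff F 0 = 1\<close>, for the coefficient by dividing by \<open>Suc k\<close>, which is
  possible in characteristic 0. This takes the place of the fundamental theorem on symmetric
  polynomials.\<close>

lemma poly_over_iff_power_sums: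
  fixes xs :: "'b list"
  shows "poly_over K (\<Prod>x\<leftarrow>xs. [:-x, 1:]) \<longleftrightarrow> (\<forall>k. (\<Sum>x\<leftarrow>xs. x ^ Suc k) \<in> K)"
proof -
  define F where "F = (\<Prod>x\<leftarrow>xs. [:1, -x:])"
  define S where "S = (\<lambda>k. \<Sum>x\<leftarrow>xs. x ^ Suc k)"
  have rec: "coeff F 0 = 1"
    "of_nat (Suc k) * coeff F (Suc k) = - (\<Sum>i\<le>k. coeff F i * S (k - i))" for k
    using fps_power_sums_rec[where xs=xs] unfolding F_def S_def by auto
  have "(\<forall>i. coeff F i \<in> K) \<longleftrightarrow> (\<forall>k. S k \<in> K)"
  proof
    assume a: "\<forall>i. coeff F i \<in> K"
    show "\<forall>k. S k \<in> K"
    proof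
      fix k show "S k \<in> K"
      proof (induction k rule: less_induct)
        case (less k)
        have "(\<Sum>i\<le>k. coeff F i * S (k - i)) = S k + (\<Sum>i\<in>{1..k}. coeff F i * S (k - i))"
          using rec(1) by (subst sum.remove[of _ 0]) (auto intro!: sum.cong)
        then have "S k = - (of_nat (Suc k) * coeff F (Suc k)) - (\<Sum>i\<in>{1..k}. coeff F i * S (k - i))"
          unfolding rec(2) by simp
        also have "\<dots> \<in> K"
          by (intro subfield_closed(3-5,7,9) subfield_sum) (use a less in auto)
        finally show ?case .
      qed
    qed
  next
    assume a: "\<forall>k. S k \<in> K"
    show "\<forall>i. coeff F i \<in> K"
    proof
      fix i show "coeff F i \<in> K"
      proof (induction i rule: less_induct)
        case (less i)
        show ?case
        proof (cases i)
          case 0 then show ?thesis using rec(1) subfield_closed by simp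
        next
          case (Suc k)
          have "coeff F (Suc k) = - (\<Sum>i\<le>k. coeff F i * S (k - i)) / of_nat (Suc k)"
            using rec(2)[of k] by (metis nonzero_mult_div_cancel_left of_nat_neq_0)
          also have "\<dots> \<in> K"
            by (intro subfield_closed(3-5,8,9) subfield_sum) (use a less Suc in auto)
          finally show ?thesis using Suc by simp
        qed
      qed
    qed
  qed
  then show ?thesis unfolding poly_over_reflect F_def[symmetric] by (simp add: poly_over_def S_def)
qed

lemma poly_over_pair_products:
  fixes xs :: "'b list"
  assumes "poly_over K (\<Prod>x\<leftarrow>xs. [:-x, 1:])"
  shows "poly_over K (\<Prod>x\<leftarrow>pair_products xs. [:-x, 1:])"
  unfolding poly_over_iff_power_sums
proof
  fix k
  have S: "(\<Sum>x\<leftarrow>xs. x ^ Suc k) \<in> K" for k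
    using assms by (simp only: poly_over_iff_power_sums)
  have "(\<Sum>x\<leftarrow>pair_products xs. x ^ Suc k)
      = ((\<Sum>x\<leftarrow>xs. x ^ Suc k)\<^sup>2 - (\<Sum>x\<leftarrow>xs. x ^ Suc (2 * k + 1))) / 2"
    using sum_list_pair_products[of "map (\<lambda>z. z ^ Suc k) xs"]
    unfolding pair_products_power
    by (simp add: o_def power_mult[symmetric] field_simps)
       (simp add: power_add power2_eq_square mult_2_right mult_ac)
  also have "\<dots> \<in> K"
    using subfield_closed(9)[of 2] by (intro subfield_closed(7,8,10) S) simp
  finally show "(\<Sum>x\<leftarrow>pair_products xs. x ^ Suc k) \<in> K" .
qed

lemma poly_over_shift_roots:
  fixes xs :: "'b list"
  assumes "poly_over K (\<Prod>x\<leftarrow>xs. [:-x, 1:])" "c \<in> K"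
  shows "poly_over K (\<Prod>x\<leftarrow>map (\<lambda>x. x + c) xs. [:-x, 1:])"
proof -
  have "(\<Prod>x\<leftarrow>map (\<lambda>x. x + c) xs. [:-x, 1:]) = pcompose (\<Prod>x\<leftarrow>xs. [:-x, 1:]) [:-c, 1:]"
    by (induction xs) (auto simp: pcompose_mult pcompose_pCons pcompose_1 simp del: mult_pCons_left)
  moreover have "poly_over K [:-c, 1:]"
    using assms(2) by (auto simp: poly_over_pCons poly_over_0 intro: subfield_closed)
  ultimately show ?thesis
    using assms(1) by (simp add: poly_over_pcompose)
qed

end

section \<open>Real closed fields: the intermediate value theorem\<close>

text \<open>\<open>dummy\<close> carries the type, so that being real closed becomes a predicate of
  a type and can be proved for \<open>term_model\<close>.\<close>

locale real_closed =
  fixes dummy :: "'a::linordered_field itself"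
  assumes square_root: "(0::'a) \<le> x \<Longrightarrow> \<exists>y. y * y = x"
    and odd_root: "odd (degree (p :: 'a poly)) \<Longrightarrow> \<exists>x. poly p x = 0"
begin

section \<open>The extension by a square root of -1 inside the algebraic closure\<close>

lemma imaginary_unit_exists: "\<exists>i :: 'a alg_closure. i * i = -1"
  using nth_root_exists[of 2 "-1 :: 'a alg_closure"] by (auto simp: power2_eq_square)

definition imag :: "'a alg_closure" where "imag = (SOME i. i * i = -1)"

lemma imag: "imag * imag = -1"
  unfolding imag_def using imaginary_unit_exists by (rule someI_ex)

definition cplx :: "'a \<Rightarrow> 'a \<Rightarrow> 'a alg_closure" where
  "cplx a b = to_ac a + to_ac b * imag"

lemma cplx_mult: "cplx a b * cplx c d = cplx (a * c - b * d) (a * d + b * c)"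
proof -
  have "cplx a b * cplx c d = to_ac (a * c) + to_ac (a * d + b * c) * imag + to_ac (b * d) * (imag * imag)"
    by (simp add: cplx_def algebra_simps)
  then show ?thesis unfolding imag by (simp add: cplx_def algebra_simps)
qed

lemma cplx_add: "cplx a b + cplx c d = cplx (a + c) (b + d)"
  by (simp add: cplx_def algebra_simps)

lemma cplx_minus: "- cplx a b = cplx (- a) (- b)"
  by (simp add: cplx_def algebra_simps)

lemma sum_squares_zero: "a * a + b * b = 0 \<longleftrightarrow> a = 0 \<and> b = 0" for a b :: 'a
  by (metis add_nonneg_eq_0_iff mult_eq_0_iff zero_le_square)

lemma imag_not_real: "imag \<noteq> to_ac a"
proof
  assume "imag = to_ac a"
  then have "to_ac (a * a) = to_ac (- 1)" using imag by simp
  then have "a * a = - 1" by (simp only: to_ac_eq_iff)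
  then show False using zero_le_square[of a] by simp
qed

lemma cplx_eq_0: "cplx a b = 0 \<longleftrightarrow> a = 0 \<and> b = 0"
proof
  assume h: "cplx a b = 0"
  have "b = 0"
  proof (rule ccontr)
    assume "b \<noteq> 0"
    then have "imag = to_ac (- a / b)" using h by (simp add: cplx_def field_simps eq_neg_iff_add_eq_0)
    then show False using imag_not_real by blast
  qed
  then show "a = 0 \<and> b = 0" using h by (simp add: cplx_def)
qed (simp add: cplx_def)

definition CC :: "'a alg_closure set" where "CC = {cplx a b | a b. True}"

lemma CC_subfield: "subfield_of CC"
  unfolding subfield_of_def
proof (intro conjI ballI)
  have "0 = cplx 0 0" "1 = cplx 1 0" by (simp_all add: cplx_def)
  then show "0 \<in> CC" "1 \<in> CC" unfolding CC_def by blast+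
next
  fix x y assume "x \<in> CC" "y \<in> CC"
  then show "x + y \<in> CC" "x * y \<in> CC"
    unfolding CC_def using cplx_add cplx_mult by blast+
next
  fix x assume "x \<in> CC"
  then obtain a b where x: "x = cplx a b" by (auto simp: CC_def)
  show "- x \<in> CC" unfolding x cplx_minus by (auto simp: CC_def)
  show "inverse x \<in> CC"
  proof (cases "x = 0")
    case True then show ?thesis using \<open>x \<in> CC\<close> by simp
  next
    case False
    define n where "n = a * a + b * b"
    have n: "n \<noteq> 0" using False unfolding x cplx_eq_0 n_def sum_squares_zero .
    have "x * cplx (a / n) (- b / n) = cplx 1 0"
    proof -
      have "a * (a / n) - b * (- b / n) = 1" "a * (- b / n) + b * (a / n) = 0"
        using n by (simp_all add: n_def flip: add_divide_distrib)
      then show ?thesis unfolding x cplx_mult by simp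
    qed
    then have "inverse x = cplx (a / n) (- b / n)"
      by (intro inverse_unique) (simp add: cplx_def)
    then show ?thesis by (auto simp: CC_def)
  qed
qed

text \<open>With r the modulus of z = a + b i, the real and imaginary parts of a root have the
  squares (r + a) / 2 and (r - a) / 2, which are nonnegative and hence squares. Twice their product
  is b up to sign, and the sign is absorbed in \<open>d\<close>.\<close>

lemma CC_sqrt: assumes "z \<in> CC" shows "\<exists>w\<in>CC. w * w = z"
proof -
  obtain a b where z: "z = cplx a b" using assms by (auto simp: CC_def)
  obtain r0 where r0: "r0 * r0 = a * a + b * b" using square_root[of "a * a + b * b"] by auto
  define r where "r = \<bar>r0\<bar>"
  have r: "r * r = a * a + b * b" "r \<ge> 0" using r0 by (auto simp: r_def)
  have "\<bar>a\<bar> \<le> r"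
  proof (rule power2_le_imp_le)
    show "\<bar>a\<bar>\<^sup>2 \<le> r\<^sup>2" using zero_le_square[of b] by (simp add: power2_eq_square r(1))
  qed (use r in auto)
  then have ge: "(r + a) / 2 \<ge> 0" "(r - a) / 2 \<ge> 0" by auto
  obtain c where c: "c * c = (r + a) / 2" using square_root[OF ge(1)] by auto
  obtain d0 where d0: "d0 * d0 = (r - a) / 2" using square_root[OF ge(2)] by auto
  have "(2 * c * d0) * (2 * c * d0) = 4 * ((c * c) * (d0 * d0))" by (simp add: mult_ac)
  also have "\<dots> = b * b" unfolding c d0 using r by (simp add: field_simps)
  finally have "(2 * c * d0 - b) * (2 * c * d0 + b) = 0" by (simp add: algebra_simps)
  then have "2 * c * d0 = b \<or> 2 * c * d0 = - b" by (auto simp: eq_neg_iff_add_eq_0)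
  then obtain d where d: "d * d = (r - a) / 2" "2 * c * d = b"
    using d0 by (elim disjE) (auto intro: that[of d0] that[of "- d0"])
  have "cplx c d * cplx c d = z"
  proof -
    have "c * c - d * d = a" unfolding c d(1) by (simp add: field_simps)
    moreover have "c * d + d * c = b" using d(2) by simp
    ultimately show ?thesis unfolding cplx_mult z by simp
  qed
  then show ?thesis by (auto simp: CC_def)
qed

text \<open>x is half of x + y plus or minus a square root of the discriminant (x - y)^2, which is a
  polynomial in x + y and x y.\<close>

lemma CC_quadratic:
  assumes "x + y \<in> CC" "x * y \<in> CC"
  shows "x \<in> CC"
proof -
  note cl = subfield_closed[OF CC_subfield]
  have "(x + y) * (x + y) - of_nat 4 * (x * y) \<in> CC" by (intro cl(4,7,9) assms)
  also have "(x + y) * (x + y) - of_nat 4 * (x * y) = (x - y) * (x - y)" by (simp add: algebra_simps)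
  finally obtain w where w: "w \<in> CC" "w * w = (x - y) * (x - y)" using CC_sqrt by blast
  then have "(w - (x - y)) * (w + (x - y)) = 0" by (simp add: algebra_simps)
  then have "w - (x - y) = 0 \<or> w + (x - y) = 0" by (simp only: mult_eq_0_iff)
  then have "w = x - y \<or> w = y - x" by (metis eq_iff_diff_eq_0 eq_neg_iff_add_eq_0 minus_diff_eq)
  then have "x = ((x + y) + w) / of_nat 2 \<or> x = ((x + y) - w) / of_nat 2" by auto
  then show ?thesis using w(1) assms cl(3,7,8,9) by metis
qed

lemma real_subfield: "subfield_of (range (to_ac :: 'a \<Rightarrow> _))"
  unfolding subfield_of_def image_def
  using to_ac_0 to_ac_1 to_ac_add to_ac_mult to_ac_minus to_ac_inverse
  by (auto, metis+)

lemma real_in_CC: "to_ac a \<in> CC"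
proof -
  have "to_ac a = cplx a 0" by (simp add: cplx_def)
  then show ?thesis unfolding CC_def by blast
qed

lemma poly_over_real:
  assumes "poly_over (range (to_ac :: 'a \<Rightarrow> _)) P"
  obtains p :: "'a poly" where "P = map_poly to_ac p"
proof
  show "P = map_poly to_ac (map_poly of_ac P)"
    using assms by (intro poly_eqI) (auto simp: poly_over_def coeff_map_poly to_ac_of_ac)
qed

lemma poly_map_to_ac: "poly (map_poly to_ac p) (to_ac x) = to_ac (poly p x)" for p :: "'a poly"
  by (induction p) (auto simp: map_poly_pCons)

text \<open>Laplace's argument: if \<open>p\<close> has even degree and roots \<open>x\<^sub>i\<close>, then for every
  natural number \<open>c\<close> the polynomial with roots \<open>(x\<^sub>i + c) (x\<^sub>j + c)\<close>, \<open>i < j\<close>, has a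
  degree divisible by a smaller power of 2. Two different \<open>c\<close> yield the same pair \<open>i, j\<close>, whence
  \<open>x\<^sub>i + x\<^sub>j\<close> and \<open>x\<^sub>i x\<^sub>j\<close>.\<close>

lemma root_in_CC:
  fixes p :: "'a poly"
  assumes "degree p = 2 ^ k * m" "odd m"
  shows "\<exists>z\<in>CC. poly (map_poly to_ac p) z = 0"
  using assms
proof (induction k arbitrary: p m)
  case 0
  then obtain x where "poly p x = 0" using odd_root[of p] by auto
  then show ?case using real_in_CC poly_map_to_ac by (metis to_ac_0)
next
  case (Suc k)
  let ?K = "range (to_ac :: 'a \<Rightarrow> _)"
  define n where "n = degree p"
  have n: "n = 2 * (2 ^ k * m)" "m > 0" "n > 0" using Suc.prems by (auto simp: n_def intro: odd_pos)
  have "p \<noteq> 0" using n by (auto simp: n_def)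
  define l where "l = lead_coeff p"
  have l: "l \<noteq> 0" using \<open>p \<noteq> 0\<close> by (simp add: l_def)
  define P where "P = map_poly to_ac (smult (1 / l) p)"
  have dP: "degree P = n" unfolding P_def n_def using l
    by (simp add: degree_map_poly)
  have lP: "lead_coeff P = 1"
    unfolding dP unfolding P_def n_def using l by (simp add: coeff_map_poly l_def)
  have rP: "poly (map_poly to_ac p) z = 0" if "poly P z = 0" for z
  proof -
    have "P = smult (to_ac (1 / l)) (map_poly to_ac p)"
      unfolding P_def by (rule map_poly_smult) auto
    then show ?thesis using that l by simp
  qed
  have "P \<noteq> 0" using lP by auto
  from alg_closed_imp_factorization[OF this] obtain A
    where A: "size A = n" "P = (\<Prod>x\<in>#A. [:-x, 1:])" using lP dP by auto
  obtain xs where xs: "mset xs = A" using ex_mset by blast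
  have P: "P = (\<Prod>x\<leftarrow>xs. [:-x, 1:])" "length xs = n"
    using A xs by (auto simp: prod_mset_prod_list simp flip: mset_map)
  have oP: "poly_over ?K P" by (simp add: poly_over_def P_def coeff_map_poly flip: to_ac_divide)
  have ex: "\<exists>i j. i < n \<and> j < n \<and> (xs ! i + of_nat c) * (xs ! j + of_nat c) \<in> CC \<and> i \<noteq> j" for c :: nat
  proof -
    define ys where "ys = pair_products (map (\<lambda>x. x + of_nat c) xs)"
    define Q where "Q = (\<Prod>x\<leftarrow>ys. [:-x, 1:])"
    have "poly_over ?K Q"
      unfolding Q_def ys_def
      by (intro poly_over_pair_products poly_over_shift_roots real_subfield)
         (use oP P subfield_closed(9)[OF real_subfield] in auto)
    then obtain q where q: "Q = map_poly to_ac q" by (rule poly_over_real)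
    have "2 * length ys + n = n\<^sup>2"
      unfolding ys_def using length_pair_products[of "map (\<lambda>x. x + of_nat c) xs"] P by simp
    then have "2 * length ys = n * (n - 1)" by (simp add: power2_eq_square algebra_simps diff_mult_distrib2)
    then have len: "length ys = 2 ^ k * (m * (n - 1))" using n(1) by simp
    \<comment> \<open>n is even, so the exponent of 2 has dropped from \<open>Suc k\<close> to
      \<open>k\<close>.\<close>
    have "odd (n - 1)" using n by simp
    have "degree Q = length ys" unfolding Q_def by (rule degree_prod_linear)
    then have "degree q = 2 ^ k * (m * (n - 1))"
      using len unfolding q by (simp add: degree_map_poly)
    from Suc.IH[OF this] obtain z where z: "z \<in> CC" "poly Q z = 0"
      using \<open>odd (n - 1)\<close> Suc.prems(2) q by auto
    then have "z \<in> set ys"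
      unfolding Q_def by (simp add: poly_prod_linear_eq_0_iff)
    from set_pair_products[OF this[unfolded ys_def]] obtain i j where "i < j" "j < n"
      "z = (xs ! i + of_nat c) * (xs ! j + of_nat c)" using P(2) by auto
    then show ?thesis using z(1) by (intro exI[of _ i] exI[of _ j]) auto
  qed
  then obtain f g where fg: "\<And>c. f c < n \<and> g c < n \<and>
      (xs ! f c + of_nat c) * (xs ! g c + of_nat c) \<in> CC \<and> f c \<noteq> g c"
    by metis
  \<comment> \<open>Pigeonhole: infinitely many c, but only finitely many pairs of indices.\<close>
  have "(\<lambda>c. (f c, g c)) ` UNIV \<subseteq> {..<n} \<times> {..<n}" using fg by auto
  then have "finite (range (\<lambda>c. (f c, g c)))" by (rule finite_subset) auto
  then have "\<not> inj (\<lambda>c. (f c, g c))" using infinite_UNIV_nat finite_imageD by blast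
  then obtain c d where cd: "c \<noteq> d" "f c = f d" "g c = g d" by (auto simp: inj_on_def)
  define x y where "x = xs ! f c" and "y = xs ! g c"
  note cl = subfield_closed[OF CC_subfield]
  have h: "(x + of_nat c) * (y + of_nat c) \<in> CC" "(x + of_nat d) * (y + of_nat d) \<in> CC"
    using fg[of c] fg[of d] cd by (auto simp: x_def y_def)
  define e :: "'a alg_closure" where "e = of_nat c - of_nat d"
  have e: "e \<in> CC" "e \<noteq> 0" using cd by (auto simp: e_def intro!: cl)
  \<comment> \<open>In the difference of the two products x y cancels; up to natural numbers, (x +
    y) e remains.\<close>
  have "((x + of_nat c) * (y + of_nat c) - (x + of_nat d) * (y + of_nat d)
      - (of_nat c * of_nat c - of_nat d * of_nat d)) / e \<in> CC"
    by (intro cl(8) cl(7)[OF cl(7) cl(7)] h e cl(4) cl(9))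
  also have "((x + of_nat c) * (y + of_nat c) - (x + of_nat d) * (y + of_nat d)
      - (of_nat c * of_nat c - of_nat d * of_nat d)) = (x + y) * e"
    by (simp add: e_def algebra_simps)
  also have "(x + y) * e / e = x + y" using e by simp
  finally have s: "x + y \<in> CC" .
  have "(x + of_nat c) * (y + of_nat c) - of_nat c * (x + y) - of_nat c * of_nat c \<in> CC"
    by (intro cl(7)[OF cl(7)] h s cl(4) cl(9))
  also have "(x + of_nat c) * (y + of_nat c) - of_nat c * (x + y) - of_nat c * of_nat c = x * y"
    by (simp add: algebra_simps)
  finally have "x \<in> CC" using s CC_quadratic by blast
  moreover have "x \<in> set xs" using fg[of c] P by (auto simp: x_def)
  then have "poly P x = 0"
    unfolding P by (simp add: poly_prod_linear_eq_0_iff)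
  ultimately show ?case using rP by blast
qed

text \<open>Take a root a + b i in \<open>CC\<close>. If b is nonzero, the remainder of p modulo (X
  - a)^2 + b^2 is a linear polynomial over the field that vanishes at a + b i; comparing imaginary
  parts first, both its coefficients are 0.\<close>

lemma root_or_quadratic_factor:
  fixes p :: "'a poly"
  assumes "degree p > 0"
  shows "(\<exists>x. poly p x = 0) \<or> (\<exists>a b. b \<noteq> 0 \<and> [:a * a + b * b, - 2 * a, 1:] dvd p)"
proof -
  obtain m where m: "odd m" "degree p = 2 ^ multiplicity 2 (degree p) * m"
    using multiplicity_decompose'[of "degree p" 2] assms by auto
  obtain z where z: "z \<in> CC" "poly (map_poly to_ac p) z = 0" using root_in_CC[OF m(2,1)] by blast
  obtain a b where ab: "z = cplx a b" using z by (auto simp: CC_def)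
  show ?thesis
  proof (cases "b = 0")
    case True
    then have "z = to_ac a" by (simp add: ab cplx_def)
    then have "poly p a = 0" using z(2) poly_map_to_ac[of p a] by (metis to_ac_eq_0_iff)
    then show ?thesis by blast
  next
    case False
    let ?q = "[:a * a + b * b, - 2 * a, 1:]"
    define r where "r = p mod ?q"
    have "degree r < 2"
      using degree_mod_less'[of ?q p] unfolding r_def by (cases "p mod ?q = 0") auto
    define u v where "u = coeff r 0" and "v = coeff r 1"
    have r: "r = [:u, v:]"
    proof (rule poly_eqI)
      fix i show "coeff r i = coeff [:u, v:] i"
        using \<open>degree r < 2\<close> by (cases i rule: nat.exhaust)
          (auto simp: u_def v_def coeff_pCons coeff_eq_0 split: nat.split)
    qed
    have q0: "poly (map_poly to_ac ?q) z = 0"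
    proof -
      have "poly (map_poly to_ac ?q) z = cplx (a * a + b * b) 0 + cplx a b * (cplx (- 2 * a) 0 + cplx a b)"
        by (simp add: map_poly_pCons ab) (simp add: cplx_def)
      also have "\<dots> = 0" unfolding cplx_add cplx_mult by (simp add: cplx_eq_0 algebra_simps)
      finally show ?thesis .
    qed
    have "map_poly to_ac p = map_poly to_ac (?q * (p div ?q) + r)"
      unfolding r_def by (simp only: mult_div_mod_eq)
    also have "\<dots> = map_poly to_ac ?q * map_poly to_ac (p div ?q) + map_poly to_ac r"
      by (intro poly_eqI) (simp only: coeff_map_poly to_ac_0 coeff_add to_ac_add coeff_mult to_ac_sum to_ac_mult)
    finally have "poly (map_poly to_ac r) z = 0" using z(2) q0 by simp
    also have "poly (map_poly to_ac r) z = cplx u 0 + cplx a b * cplx v 0"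
      unfolding r by (simp add: map_poly_pCons ab) (simp add: cplx_def)
    finally have "u + a * v = 0 \<and> b * v = 0" unfolding cplx_add cplx_mult cplx_eq_0 by simp
    then have "r = 0" using False r by auto
    then have "?q dvd p" by (simp add: r_def dvd_eq_mod_eq_0)
    then show ?thesis using False by blast
  qed
qed

text \<open>Split off a factor and induct on the degree. A linear factor with its root outside the
  interval and a factor (X - u)^2 + v^2 do not change sign between a and b, so the sign change
  passes to the cofactor.\<close>

theorem poly_IVT:
  fixes p :: "'a poly"
  assumes "a < b" "poly p a * poly p b < 0"
  shows "\<exists>x. a < x \<and> x < b \<and> poly p x = 0"
  using assms(2)
proof (induction "degree p" arbitrary: p rule: less_induct)
  case less
  have "degree p > 0"
  proof (rule ccontr)
    assume "\<not> degree p > 0"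
    then obtain c where "p = [:c:]" using degree_eq_zeroE by blast
    then show False using less.prems zero_le_square[of c] by simp
  qed
  have "p \<noteq> 0" using \<open>degree p > 0\<close> by auto
  from root_or_quadratic_factor[OF \<open>degree p > 0\<close>] show ?case
  proof (elim disjE exE conjE)
    fix c assume "poly p c = 0"
    then obtain q where q: "p = [:- c, 1:] * q" by (auto simp: poly_eq_0_iff_dvd elim: dvdE)
    have "q \<noteq> 0" using q \<open>p \<noteq> 0\<close> by auto
    then have dq: "degree q < degree p" unfolding q by (subst degree_mult_eq) auto
    have pq: "poly p x = (x - c) * poly q x" for x unfolding q by (simp add: algebra_simps)
    show ?thesis
    proof (cases "a < c \<and> c < b")
      case True then show ?thesis using \<open>poly p c = 0\<close> by blast
    next
      case False
      have "poly p a * poly p b = ((a - c) * (b - c)) * (poly q a * poly q b)"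
        unfolding pq by (simp only: mult_ac)
      moreover have "(a - c) * (b - c) \<ge> 0" using False assms(1)
        by (auto simp: zero_le_mult_iff)
      ultimately have "poly q a * poly q b < 0"
        using less.prems by (metis linorder_not_less mult_nonneg_nonneg)
      from less.hyps[OF dq this] show ?thesis using pq by auto
    qed
  next
    fix u v :: 'a assume v: "v \<noteq> 0" and "[:u * u + v * v, - 2 * u, 1:] dvd p"
    then obtain q where q: "p = [:u * u + v * v, - 2 * u, 1:] * q" by (elim dvdE)
    have "q \<noteq> 0" using q \<open>p \<noteq> 0\<close> by auto
    then have dq: "degree q < degree p" unfolding q by (subst degree_mult_eq) auto
    have pq: "poly p x = ((x - u) * (x - u) + v * v) * poly q x" for x
      unfolding q by (simp add: algebra_simps)
    have pos: "(x - u) * (x - u) + v * v > 0" for x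
      using v by (metis add_nonneg_pos not_real_square_gt_zero zero_le_square mult_eq_0_iff linorder_neqE_linordered_idom not_square_less_zero)
    have "poly p a * poly p b = (((a - u) * (a - u) + v * v) * ((b - u) * (b - u) + v * v)) * (poly q a * poly q b)"
      unfolding pq by (simp only: mult_ac)
    then have "poly q a * poly q b < 0"
      using less.prems mult_pos_pos[OF pos[of a] pos[of b]] by (metis mult_less_0_iff order.asym)
    from less.hyps[OF dq this] show ?thesis using pq by auto
  qed
qed

end

section \<open>Rolle's theorem and sign changes at simple roots\<close>

context real_closed
begin

lemma poly_same_sign:
  fixes p :: "'a poly"
  assumes "\<And>x. a \<le> x \<Longrightarrow> x \<le> b \<Longrightarrow> poly p x \<noteq> 0" "a \<le> b"
  shows "0 < poly p a * poly p b"
proof (rule ccontr)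
  assume "\<not> 0 < poly p a * poly p b"
  moreover have "poly p a * poly p b \<noteq> 0" using assms by auto
  ultimately have *: "poly p a * poly p b < 0" by (meson linorder_neqE_linordered_idom)
  then have "a \<noteq> b" using not_square_less_zero by auto
  then show False using poly_IVT[OF _ *] assms by (metis order.strict_iff_order)
qed

text \<open>No compactness is available, so the argument avoids extrema. Write p = (X - a)^m (X -
  b)^k r with r free of roots on the closed interval. Then p' = (X - a)^(m-1) (X - b)^(k-1) s, where
  s has opposite signs at a and b and the intermediate value theorem applies.\<close>

lemma poly_Rolle_consecutive:
  fixes p :: "'a poly"
  assumes "a < b" "poly p a = 0" "poly p b = 0" "p \<noteq> 0"
    and no: "\<And>x. a < x \<Longrightarrow> x < b \<Longrightarrow> poly p x \<noteq> 0"
  shows "\<exists>x. a < x \<and> x < b \<and> poly (pderiv p) x = 0"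
proof -
  define m n where "m = order a p" and "n = order b p"
  obtain q where q: "p = [:- a, 1:] ^ m * q" "\<not> [:- a, 1:] dvd q"
    using order_decomp[OF \<open>p \<noteq> 0\<close>] unfolding m_def by blast
  have "q \<noteq> 0" using q \<open>p \<noteq> 0\<close> by auto
  have "m > 0" using assms(2,4) by (simp add: m_def order_root)
  obtain r where r: "q = [:- b, 1:] ^ order b q * r" "\<not> [:- b, 1:] dvd r"
    using order_decomp[OF \<open>q \<noteq> 0\<close>] by blast
  define k where "k = order b q"
  have "poly q b = 0" using assms(1,3) q by (auto simp: poly_power)
  then have "k > 0" using \<open>q \<noteq> 0\<close> by (simp add: k_def order_root)
  have ra: "poly r a \<noteq> 0" using q(2) r(1) by (metis poly_eq_0_iff_dvd poly_mult mult_zero_right)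
  have rb: "poly r b \<noteq> 0" using r(2) by (simp add: poly_eq_0_iff_dvd)
  have "poly r x \<noteq> 0" if "a \<le> x" "x \<le> b" for x
  proof (cases "x = a \<or> x = b")
    case True then show ?thesis using ra rb by auto
  next
    case False
    then have "poly p x \<noteq> 0" using that by (intro no) auto
    then show ?thesis using q(1) r(1) by (metis poly_mult mult_zero_right)
  qed
  then have sr: "0 < poly r a * poly r b" using poly_same_sign assms(1) by auto
  obtain m' k' where m': "m = Suc m'" and k': "k = Suc k'"
    using \<open>m > 0\<close> \<open>k > 0\<close> by (metis gr0_implies_Suc)
  define A B where "A = [:- a, 1:]" and "B = [:- b, 1:]"
  have dAB: "pderiv A = 1" "pderiv B = 1" by (simp_all add: A_def B_def pderiv_pCons)
  define s where "s = smult (of_nat m) (B * r) + smult (of_nat k) (A * r) + A * B * pderiv r"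
  have p: "p = A ^ Suc m' * (B ^ Suc k' * r)"
    using q(1) r(1) m' k' by (simp add: A_def B_def k_def)
  have pd: "pderiv p = A ^ m' * (B ^ k' * s)"
    unfolding p pderiv_mult pderiv_power_Suc dAB s_def m' k'
    by (simp add: algebra_simps)
  have eAB: "poly A a = 0" "poly B b = 0" "poly A b = b - a" "poly B a = a - b"
    by (simp_all add: A_def B_def)
  have sab: "poly s a = of_nat m * (a - b) * poly r a" "poly s b = of_nat k * (b - a) * poly r b"
    using eAB by (simp_all add: s_def)
  have "poly s a * poly s b = (of_nat m * of_nat k * ((a - b) * (b - a))) * (poly r a * poly r b)"
    unfolding sab by (simp only: mult_ac)
  moreover have "of_nat m * of_nat k * ((a - b) * (b - a)) < 0"
    using \<open>a < b\<close> \<open>m > 0\<close> \<open>k > 0\<close> by (simp add: mult_less_0_iff zero_less_mult_iff)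
  ultimately have "poly s a * poly s b < 0" using sr by (simp add: mult_neg_pos)
  from poly_IVT[OF \<open>a < b\<close> this] show ?thesis unfolding pd by auto
qed

lemma poly_Rolle:
  fixes p :: "'a poly"
  assumes "a < b" "poly p a = 0" "poly p b = 0"
  shows "\<exists>x. a < x \<and> x < b \<and> poly (pderiv p) x = 0"
proof (cases "p = 0")
  case True
  then show ?thesis using dense[OF \<open>a < b\<close>] by auto
next
  case False
  let ?R = "{x. a < x \<and> poly p x = 0}"
  have f: "finite ?R" using poly_roots_finite[OF False] by (rule rev_finite_subset) auto
  have ne: "b \<in> ?R" using assms by auto
  have M: "Min ?R \<in> ?R" "Min ?R \<le> b" using f ne by (metis Min_in empty_iff, metis Min_le)
  have "\<exists>x. a < x \<and> x < Min ?R \<and> poly (pderiv p) x = 0"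
  proof (rule poly_Rolle_consecutive[OF _ assms(2) _ False])
    fix x assume x: "a < x" "x < Min ?R"
    then show "poly p x \<noteq> 0" using Min_le[OF f, of x] by auto
  qed (use M in auto)
  then show ?thesis using M by force
qed

text \<open>Division by the linear factor at the root leaves a polynomial without roots on the
  interval.\<close>

lemma poly_sign_change:
  fixes p :: "'a poly"
  assumes "a < x" "x < b" "poly p x = 0"
    and d: "\<And>y. a < y \<Longrightarrow> y < b \<Longrightarrow> poly (pderiv p) y \<noteq> 0"
  shows "poly p a * poly p b < 0"
proof -
  obtain g where g: "p = [:- x, 1:] * g" using assms(3) by (auto simp: poly_eq_0_iff_dvd elim: dvdE)
  have pg: "poly p y = (y - x) * poly g y" for y unfolding g by (simp add: algebra_simps)
  have "poly g y \<noteq> 0" if "a \<le> y" "y \<le> b" for y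
  proof
    assume "poly g y = 0"
    then have py: "poly p y = 0" by (simp add: pg)
    consider "y < x" | "y > x" | "y = x" by force
    then show False
    proof cases
      case 1 then show False using poly_Rolle[OF 1 py assms(3)] d that assms by force
    next
      case 2 then show False using poly_Rolle[OF 2 assms(3) py] d that assms by force
    next
      case 3
      \<comment> \<open>A multiple root at x would also be a root of the derivative.\<close>
      have "poly (pderiv p) x = poly g x"
        unfolding g pderiv_mult by (simp add: pderiv_pCons)
      then show False using 3 \<open>poly g y = 0\<close> d assms by auto
    qed
  qed
  then have "0 < poly g a * poly g b" using poly_same_sign assms by (meson order.strict_trans less_imp_le)
  moreover have "poly p a * poly p b = ((a - x) * (b - x)) * (poly g a * poly g b)"
    unfolding pg by (simp only: mult_ac)
  moreover have "(a - x) * (b - x) < 0" using assms by (simp add: mult_less_0_iff)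
  ultimately show ?thesis by (simp add: mult_neg_pos)
qed

end

section \<open>Completeness of natural deduction\<close>

lemma subst_tm_cong: "(\<And>i. i \<in> fv_tm t \<Longrightarrow> \<sigma> i = \<tau> i) \<Longrightarrow> subst_tm \<sigma> t = subst_tm \<tau> t"
  by (induction t) auto

lemma subst_tm_comp: "subst_tm \<sigma> (subst_tm \<tau> t) = subst_tm (\<lambda>i. subst_tm \<sigma> (\<tau> i)) t"
  by (induction t) auto

lemma subst_tm_Var [simp]: "subst_tm Var t = t"
  by (induction t) auto

lemma subst_cong: "(\<And>i. i \<in> fv A \<Longrightarrow> \<sigma> i = \<tau> i) \<Longrightarrow> subst \<sigma> A = subst \<tau> A"
proof (induction A arbitrary: \<sigma> \<tau>)
  case (Forall A)
  have "subst (under \<sigma>) A = subst (under \<tau>) A"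
    by (rule Forall.IH) (auto simp: Forall.prems split: nat.split)
  then show ?case by simp
next
  case (Imp A B)
  then show ?case by (metis UnI1 UnI2 fv.simps(5) subst.simps(5))
qed (auto intro: subst_tm_cong)

lemma under_comp: "subst_tm (under \<sigma>) (under \<tau> i) = under (\<lambda>i. subst_tm \<sigma> (\<tau> i)) i"
  by (cases i) (simp_all add: subst_tm_comp)

lemma subst_comp: "subst \<sigma> (subst \<tau> A) = subst (\<lambda>i. subst_tm \<sigma> (\<tau> i)) A"
proof (induction A arbitrary: \<sigma> \<tau>)
  case (Forall A)
  have "subst (under \<sigma>) (subst (under \<tau>) A) = subst (under (\<lambda>i. subst_tm \<sigma> (\<tau> i))) A"
    unfolding Forall.IH under_comp ..
  then show ?case by simp
qed (simp_all add: subst_tm_comp)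

lemma under_Var: "under Var = Var"
  by (auto split: nat.split)

lemma subst_Var [simp]: "subst Var A = A"
proof (induction A)
  case (Forall A)
  then show ?case unfolding subst.simps under_Var by simp
qed simp_all

lemma subst_sentence: "fv A = {} \<Longrightarrow> subst \<sigma> A = A"
  using subst_cong[of A \<sigma> Var] by simp

lemma subst_inst: "subst \<sigma> (inst t A) = inst (subst_tm \<sigma> t) (subst (under \<sigma>) A)"
  unfolding subst_comp by (rule subst_cong) (simp add: subst_tm_comp split: nat.split)

lemma inst_under: "inst t (subst (under \<sigma>) A) = subst (case_nat t \<sigma>) A"
  unfolding subst_comp by (rule subst_cong) (simp add: subst_tm_comp split: nat.split)

section \<open>Admissible rules of natural deduction\<close>

lemma derivable_weaken:
  "derivable T \<Gamma> A \<Longrightarrow> set \<Gamma> \<subseteq> set \<Delta> \<Longrightarrow> derivable T \<Delta> A"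
proof (induction arbitrary: \<Delta> rule: derivable.induct)
  case (ImpI A \<Gamma> B)
  have "derivable T (A # \<Delta>) B" using ImpI.prems by (intro ImpI.IH) auto
  then show ?case by (rule derivable.ImpI)
next
  case (Contr A \<Gamma>)
  have "derivable T (Neg A # \<Delta>) Fls" using Contr.prems by (intro Contr.IH) auto
  then show ?case by (rule derivable.Contr)
next
  case (AllI \<Gamma> A)
  have "derivable T (map (subst shift) \<Delta>) A" using AllI.prems by (intro AllI.IH) auto
  then show ?case by (rule derivable.AllI)
next
  case (EqE \<Gamma> s t A)
  then show ?case by (intro derivable.EqE[of _ _ s t A]) auto
qed (auto intro: derivable.intros)

lemma derivable_subst:
  assumes "\<And>A. A \<in> T \<Longrightarrow> fv A = {}"
  shows "derivable T \<Gamma> A \<Longrightarrow> derivable T (map (subst \<sigma>) \<Gamma>) (subst \<sigma> A)"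
proof (induction arbitrary: \<sigma> rule: derivable.induct)
  case (Axiom A \<Gamma>)
  then show ?case using assms by (auto simp: subst_sentence intro: derivable.Axiom)
next
  case (AllI \<Gamma> A)
  have "map (subst (under \<sigma>)) (map (subst shift) \<Gamma>) = map (subst shift) (map (subst \<sigma>) \<Gamma>)"
    by (simp add: subst_comp)
  then show ?case using AllI.IH[of "under \<sigma>"] unfolding subst.simps by (metis derivable.AllI)
next
  case (AllE \<Gamma> A t)
  then show ?case unfolding subst_inst by (intro derivable.AllE) simp
next
  case (EqE \<Gamma> s t A)
  show ?case using derivable.EqE[OF EqE.IH[of \<sigma>, unfolded subst_inst subst.simps]]
    unfolding subst_inst .
qed (auto intro: derivable.intros)

text \<open>The eigenvariable rule for a named variable. The substitution \<open>\<sigma>\<close>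
  sends k to the index 0 and shifts the rest: by freshness it agrees with \<open>shift\<close> on
  the context and undoes the instantiation of B by \<open>Var k\<close>.\<close>

lemma derivable_fresh:
  assumes T: "\<And>A. A \<in> T \<Longrightarrow> fv A = {}"
    and d: "derivable T \<Gamma> (inst (Var k) B)"
    and fresh: "\<And>A. A \<in> set \<Gamma> \<Longrightarrow> k \<notin> fv A" "k \<notin> fv (Forall B)"
  shows "derivable T \<Gamma> (Forall B)"
proof (rule derivable.AllI)
  define \<sigma> where "\<sigma> = (\<lambda>i. if i = k then Var 0 else shift i)"
  have "map (subst \<sigma>) \<Gamma> = map (subst shift) \<Gamma>"
    using fresh(1) by (auto intro!: subst_cong simp: \<sigma>_def)
  moreover have "subst \<sigma> (inst (Var k) B) = subst Var B"
    unfolding subst_comp using fresh(2) by (intro subst_cong) (auto simp: \<sigma>_def split: nat.split)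
  ultimately show "derivable T (map (subst shift) \<Gamma>) B"
    using derivable_subst[OF T d, of \<sigma>] by (simp only: subst_Var)
qed

lemma finite_fv_tm: "finite (fv_tm t)"
  by (induction t) auto

lemma finite_fv: "finite (fv A)"
proof (induction A)
  case (Forall A)
  have "{i. Suc i \<in> fv A} = Suc -` fv A" by auto
  then show ?case using Forall by (simp add: finite_vimageI)
qed (auto simp: finite_fv_tm)

section \<open>Henkin's construction along an enumeration of all formulas\<close>

instance tm :: countable by countable_datatype
instance fm :: countable by countable_datatype

text \<open>The theory of a structure all of whose elements are values of terms.\<close>

definition henkin :: "fm set \<Rightarrow> bool" where
  "henkin H \<longleftrightarrow> Fls \<notin> H \<and> (\<forall>A B. Imp A B \<in> H \<longleftrightarrow> (A \<in> H \<longrightarrow> B \<in> H)) \<and>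
     (\<forall>A. Forall A \<in> H \<longleftrightarrow> (\<forall>t. inst t A \<in> H)) \<and> (\<forall>t. Eq t t \<in> H) \<and>
     (\<forall>s t A. Eq s t \<in> H \<longrightarrow> inst s A \<in> H \<longrightarrow> inst t A \<in> H)"

definition fresh_var :: "fm list \<Rightarrow> nat" where
  "fresh_var \<Gamma> = (SOME k. k \<notin> (\<Union>A\<in>set \<Gamma>. fv A))"

lemma fresh_var: "A \<in> set \<Gamma> \<Longrightarrow> fresh_var \<Gamma> \<notin> fv A"
proof -
  have "finite (\<Union>A\<in>set \<Gamma>. fv A)" by (simp add: finite_fv)
  then have "\<exists>k. k \<notin> (\<Union>A\<in>set \<Gamma>. fv A)" using ex_new_if_finite infinite_UNIV_nat by blast
  then have "fresh_var \<Gamma> \<notin> (\<Union>A\<in>set \<Gamma>. fv A)" unfolding fresh_var_def by (rule someI_ex)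
  then show "A \<in> set \<Gamma> \<Longrightarrow> fresh_var \<Gamma> \<notin> fv A" by blast
qed

definition witness :: "fm list \<Rightarrow> fm \<Rightarrow> fm list" where
  "witness \<Gamma> A = (case A of Imp (Forall B) Fls \<Rightarrow> [Neg (inst (Var (fresh_var (A # \<Gamma>))) B)] | _ \<Rightarrow> [])"

lemma witness_cases:
  obtains B where "A = Neg (Forall B)" "witness \<Gamma> A = [Neg (inst (Var (fresh_var (A # \<Gamma>))) B)]"
  | "witness \<Gamma> A = []"
proof (cases "\<exists>B. A = Neg (Forall B)")
  case False
  then have "witness \<Gamma> A = []" unfolding witness_def by (auto split: fm.splits)
  then show ?thesis by (rule that(2))
qed (auto simp: witness_def intro: that(1))

primrec extend :: "fm set \<Rightarrow> fm list \<Rightarrow> nat \<Rightarrow> fm list" where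
  "extend T \<Gamma> 0 = \<Gamma>"
| "extend T \<Gamma> (Suc n) = (let \<Delta> = extend T \<Gamma> n; A = from_nat n in
     if derivable T (A # \<Delta>) Fls then \<Delta> else witness \<Delta> A @ A # \<Delta>)"

text \<open>If refuting the fresh instance of B led to a contradiction, that instance would be
  derivable, hence also \<open>Forall B\<close>, against the consistency of
  \<open>Neg (Forall B)\<close> with the context.\<close>

lemma extend_consistent:
  assumes T: "\<And>A. A \<in> T \<Longrightarrow> fv A = {}" and "\<not> derivable T \<Gamma> Fls"
  shows "\<not> derivable T (extend T \<Gamma> n) Fls"
proof (induction n)
  case 0
  then show ?case using assms(2) by simp
next
  case (Suc n)
  define \<Delta> A where "\<Delta> = extend T \<Gamma> n" and "A = (from_nat n :: fm)"
  show ?case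
  proof (cases "derivable T (A # \<Delta>) Fls")
    case True
    then show ?thesis using Suc by (simp add: Let_def \<Delta>_def A_def)
  next
    case False
    have "\<not> derivable T (witness \<Delta> A @ A # \<Delta>) Fls"
    proof (rule witness_cases[of A \<Delta>])
      fix B assume B: "A = Neg (Forall B)" "witness \<Delta> A = [Neg (inst (Var (fresh_var (A # \<Delta>))) B)]"
      show ?thesis
      proof
        assume "derivable T (witness \<Delta> A @ A # \<Delta>) Fls"
        then have "derivable T (A # \<Delta>) (inst (Var (fresh_var (A # \<Delta>))) B)"
          unfolding B(2) by (auto intro: derivable.Contr)
        moreover have "fresh_var (A # \<Delta>) \<notin> fv (Forall B)"
          using fresh_var[of A "A # \<Delta>"] B(1) by auto
        ultimately have "derivable T (A # \<Delta>) (Forall B)"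
          using derivable_fresh[OF T] fresh_var by blast
        moreover have "derivable T (A # \<Delta>) (Neg (Forall B))"
          using B(1) by (auto intro: derivable.Assum)
        ultimately show False using False derivable.ImpE by blast
      qed
    qed (use False in auto)
    then show ?thesis using False by (simp add: Let_def \<Delta>_def A_def)
  qed
qed

lemma extend_mono: "n \<le> m \<Longrightarrow> set (extend T \<Gamma> n) \<subseteq> set (extend T \<Gamma> m)"
proof (induction m rule: nat_induct_at_least)
  case (Suc m)
  then show ?case by (auto simp: Let_def)
qed auto

theorem henkin_extension:
  assumes T: "\<And>A. A \<in> T \<Longrightarrow> fv A = {}" and "\<not> derivable T \<Gamma> Fls"
  obtains H where "henkin H" "T \<subseteq> H" "set \<Gamma> \<subseteq> H"
proof
  define H where "H = {A. \<exists>n. derivable T (extend T \<Gamma> n) A}"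
  have w: "derivable T (extend T \<Gamma> m) A" if "derivable T (extend T \<Gamma> n) A" "n \<le> m" for n m A
    using derivable_weaken[OF that(1) extend_mono[OF that(2)]] .
  have mp: "B \<in> H" if h: "Imp A B \<in> H" "A \<in> H" for A B
  proof -
    obtain n m where "derivable T (extend T \<Gamma> n) (Imp A B)" "derivable T (extend T \<Gamma> m) A"
      using h unfolding H_def by blast
    then have "derivable T (extend T \<Gamma> (max n m)) B"
      by (meson derivable.ImpE max.cobounded1 max.cobounded2 w)
    then show ?thesis by (auto simp: H_def)
  qed
  have fls: "Fls \<notin> H" using extend_consistent[OF assms] by (simp add: H_def)
  have ext: "set (extend T \<Gamma> n) \<subseteq> H" for n by (auto simp: H_def intro: derivable.Assum)
  \<comment> \<open>A is examined at stage \<open>to_nat A\<close>: there either it is added, or its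
    negation is derivable.\<close>
  have dec: "A \<in> H \<or> Neg A \<in> H" for A
  proof (cases "derivable T (A # extend T \<Gamma> (to_nat A)) Fls")
    case True
    then have "Neg A \<in> H" unfolding H_def using derivable.ImpI by blast
    then show ?thesis ..
  next
    case False
    then have "A \<in> set (extend T \<Gamma> (Suc (to_nat A)))" by (simp add: Let_def)
    then show ?thesis using ext by blast
  qed
  have closed: "B \<in> H" if "derivable T \<Delta> B" "set \<Delta> \<subseteq> H" for \<Delta> B
    using that
  proof (induction \<Delta> arbitrary: B)
    case Nil
    then have "derivable T (extend T \<Gamma> 0) B" using derivable_weaken by fastforce
    then show ?case unfolding H_def by blast
  next
    case (Cons A \<Delta>)
    then have "Imp A B \<in> H" using derivable.ImpI by auto
    then show ?case using Cons.prems mp by auto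
  qed
  show "T \<subseteq> H" by (auto simp: H_def intro: derivable.Axiom)
  show "set \<Gamma> \<subseteq> H" using ext[of 0] by simp
  show "henkin H"
    unfolding henkin_def
  proof (intro conjI allI impI iffI)
    show "Fls \<notin> H" by (rule fls)
  next
    fix A B assume "Imp A B \<in> H" "A \<in> H"
    then show "B \<in> H" by (rule mp)
  next
    fix A B assume h: "A \<in> H \<longrightarrow> B \<in> H"
    consider "B \<in> H" | "Neg A \<in> H" using h dec by blast
    then show "Imp A B \<in> H"
    proof cases
      case 1
      have "derivable T [B] (Imp A B)" by (rule derivable.ImpI, rule derivable.Assum) simp
      then show ?thesis using 1 closed by auto
    next
      case 2
      have "derivable T [Neg B, A, Neg A] Fls"
        by (rule derivable.ImpE[of _ _ A]) (auto intro: derivable.Assum)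
      then have "derivable T [Neg A] (Imp A B)" using derivable.ImpI derivable.Contr by blast
      then show ?thesis using 2 closed by auto
    qed
  next
    fix A t assume "Forall A \<in> H"
    moreover have "derivable T [Forall A] (inst t A)" by (rule derivable.AllE) (auto intro: derivable.Assum)
    ultimately show "inst t A \<in> H" using closed by auto
  next
    fix B assume h: "\<forall>t. inst t B \<in> H"
    show "Forall B \<in> H"
    proof (rule ccontr)
      assume "Forall B \<notin> H"
      define A where "A = Neg (Forall B)"
      have A: "A \<in> H" using \<open>Forall B \<notin> H\<close> dec by (auto simp: A_def)
      \<comment> \<open>A belongs to H and thus is accepted at its own stage, together with its
        witness.\<close>
      have "\<not> derivable T (A # extend T \<Gamma> (to_nat A)) Fls"
      proof
        assume "derivable T (A # extend T \<Gamma> (to_nat A)) Fls"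
        then have "Neg A \<in> H" unfolding H_def using derivable.ImpI by blast
        then show False using A mp fls by blast
      qed
      then have "set (witness (extend T \<Gamma> (to_nat A)) A) \<subseteq> set (extend T \<Gamma> (Suc (to_nat A)))"
        by (auto simp: Let_def)
      then obtain k where "Neg (inst (Var k) B) \<in> H"
        using ext unfolding A_def witness_def by fastforce
      then show False using h mp fls by blast
    qed
  next
    fix t show "Eq t t \<in> H" by (auto simp: H_def intro: derivable.EqI)
  next
    fix s t A assume "Eq s t \<in> H" "inst s A \<in> H"
    moreover have "derivable T [Eq s t, inst s A] (inst t A)"
      by (rule derivable.EqE[of _ _ s]) (auto intro: derivable.Assum)
    ultimately show "inst t A \<in> H" using closed by auto
  qed
qed

section \<open>Semantics and soundness\<close>

primrec tval :: "(nat \<Rightarrow> 'a::{zero,one,plus,uminus,times}) \<Rightarrow> tm \<Rightarrow> 'a" where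
  "tval e (Var i) = e i"
| "tval e Zero = 0"
| "tval e One = 1"
| "tval e (Add s t) = tval e s + tval e t"
| "tval e (Minus t) = - tval e t"
| "tval e (Mult s t) = tval e s * tval e t"

text \<open>Only the operations are required of the type, so that formulas can be evaluated in
  \<open>term_model\<close> before it is known to be an ordered field. The valuation relation
  belongs to no type class and is passed as R.\<close>

primrec sat :: "('a \<Rightarrow> 'a \<Rightarrow> bool) \<Rightarrow> (nat \<Rightarrow> 'a::{zero,one,plus,uminus,times,ord}) \<Rightarrow> fm \<Rightarrow> bool" where
  "sat R e Fls = False"
| "sat R e (Eq s t) = (tval e s = tval e t)"
| "sat R e (Leq s t) = (tval e s \<le> tval e t)"
| "sat R e (Val s t) = R (tval e s) (tval e t)"
| "sat R e (Imp A B) = (sat R e A \<longrightarrow> sat R e B)"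
| "sat R e (Forall A) = (\<forall>x. sat R (case_nat x e) A)"

lemma tval_subst [simp]: "tval e (subst_tm \<sigma> t) = tval (\<lambda>i. tval e (\<sigma> i)) t"
  by (induction t) auto

lemma tval_under: "(\<lambda>i. tval (case_nat x e) (under \<sigma> i)) = case_nat x (\<lambda>i. tval e (\<sigma> i))"
  by (auto split: nat.split)

lemma sat_subst [simp]: "sat R e (subst \<sigma> A) = sat R (\<lambda>i. tval e (\<sigma> i)) A"
  by (induction A arbitrary: e \<sigma>) (simp_all add: tval_under)

lemma tval_cong: "(\<And>i. i \<in> fv_tm t \<Longrightarrow> e i = f i) \<Longrightarrow> tval e t = tval f t"
  by (induction t) auto

lemma sat_cong: "(\<And>i. i \<in> fv A \<Longrightarrow> e i = f i) \<Longrightarrow> sat R e A = sat R f A"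
proof (induction A arbitrary: e f)
  case (Forall A)
  have "sat R (case_nat x e) A = sat R (case_nat x f) A" for x
    by (rule Forall.IH) (auto simp: Forall.prems split: nat.split)
  then show ?case by simp
next
  case (Imp A B)
  then show ?case by (metis UnI1 UnI2 fv.simps(5) sat.simps(5))
next
  case (Eq s t)
  then show ?case using tval_cong[of s e f] tval_cong[of t e f] by simp
next
  case (Leq s t)
  then show ?case using tval_cong[of s e f] tval_cong[of t e f] by simp
next
  case (Val s t)
  then show ?case using tval_cong[of s e f] tval_cong[of t e f] by simp
qed auto

lemma sat_inst: "sat R e (inst t A) = sat R (case_nat (tval e t) e) A"
proof -
  have "(\<lambda>i. tval e (case_nat t Var i)) = case_nat (tval e t) e" by (auto split: nat.split)
  then show ?thesis by simp
qed

lemma soundness: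
  assumes "derivable T \<Gamma> A" "\<And>A e. A \<in> T \<Longrightarrow> sat R e A" "\<And>A. A \<in> set \<Gamma> \<Longrightarrow> sat R e A"
  shows "sat R e A"
  using assms(1,3)
proof (induction arbitrary: e rule: derivable.induct)
  case (AllI \<Gamma> A)
  have "sat R (case_nat x e) A" for x by (rule AllI.IH) (auto simp: AllI.prems)
  then show ?case by simp
next
  case (AllE \<Gamma> A t)
  then show ?case unfolding sat_inst by simp
next
  case (EqE \<Gamma> s t A)
  then show ?case unfolding sat_inst by simp
next
  case (Contr A \<Gamma>)
  show ?case
  proof (rule ccontr)
    assume "\<not> sat R e A"
    then have "sat R e Fls" by (intro Contr.IH) (auto simp: Contr.prems)
    then show False by simp
  qed
next
  case (ImpI A \<Gamma> B)
  have "sat R e B" if "sat R e A" using that ImpI.prems by (intro ImpI.IH) auto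
  then show ?case by simp
qed (use assms(2) in auto)

lemma sat_ordered_field_axioms:
  "A \<in> ordered_field_axioms \<Longrightarrow> sat R (e :: nat \<Rightarrow> 'a::linordered_field) A"
proof -
  have "\<exists>y. x * y = 1" if "x \<noteq> 0" for x :: 'a using that by (metis right_inverse)
  then show "A \<in> ordered_field_axioms \<Longrightarrow> sat R e A"
    unfolding ordered_field_axioms_def Let_def
    by (auto simp: numeral_3_eq_3 numeral_2_eq_2 algebra_simps)
qed

text \<open>The rationals are a model. This is the default case in the choice of
  \<open>refuting_theory\<close>: its quotient is made an instance of
  \<open>linordered_field\<close> whether or not a counterexample exists.\<close>

lemma henkin_ordered_field_exists: "\<exists>H. henkin H \<and> ordered_field_axioms \<subseteq> H"
proof -
  have "\<not> derivable ordered_field_axioms [] Fls"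
    using soundness[of ordered_field_axioms "[]" Fls "(=)" "\<lambda>_. 0 :: rat"] sat_ordered_field_axioms
    by auto
  moreover have "fv A = {}" if "A \<in> ordered_field_axioms" for A
    using that unfolding ordered_field_axioms_def Let_def
    by (auto simp: numeral_3_eq_3 numeral_2_eq_2)
  ultimately show ?thesis using henkin_extension by metis
qed

section \<open>Sign changes and roots\<close>

context real_closed
begin

lemma poly_sgn_const:
  fixes q :: "'a poly"
  assumes "\<And>z. a < z \<Longrightarrow> z < b \<Longrightarrow> poly q z \<noteq> 0" "a < x" "x < b" "a < y" "y < b"
  shows "sgn (poly q x) = sgn (poly q y)"
proof -
  have "0 < poly q x * poly q y" if "a < x" "x \<le> y" "y < b" for x y
    by (rule poly_same_sign) (use assms(1) that in auto)
  then have "0 < poly q x * poly q y"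
    using assms by (metis linorder_linear mult.commute)
  then show ?thesis by (auto simp: zero_less_mult_iff)
qed

definition const_cells :: "'a poly set \<Rightarrow> ('a \<Rightarrow> bool) \<Rightarrow> bool" where
  "const_cells Q S \<longleftrightarrow> (\<forall>x y. (\<forall>q\<in>Q. sgn (poly q x) = sgn (poly q y)) \<longrightarrow> S x = S y)"

text \<open>The zero polynomial is exempt, here and in \<open>roots_of\<close>: it vanishes
  everywhere, but its sign never changes.\<close>

definition free_of_roots :: "'a poly set \<Rightarrow> 'a \<Rightarrow> 'a \<Rightarrow> bool" where
  "free_of_roots Q a b \<longleftrightarrow> (\<forall>q\<in>Q. q = 0 \<or> (\<forall>z. poly q z = 0 \<longrightarrow> \<not> (a < z \<and> z < b)))"

lemma const_cellsD:
  assumes "const_cells Q S" "free_of_roots Q a b" "a < x" "x < b" "a < y" "y < b"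
  shows "S x = S y"
proof -
  have "sgn (poly q x) = sgn (poly q y)" if "q \<in> Q" for q
  proof (cases "q = 0")
    case False
    then show ?thesis using assms(2) that
      by (intro poly_sgn_const[OF _ assms(3-6)]) (auto simp: free_of_roots_def)
  qed simp
  then show ?thesis using assms(1) by (auto simp: const_cells_def)
qed

definition roots_of :: "'a poly set \<Rightarrow> 'a set" where
  "roots_of Q = {x. \<exists>q\<in>Q. q \<noteq> 0 \<and> poly q x = 0}"

lemma finite_roots_of: "finite Q \<Longrightarrow> finite (roots_of Q)"
proof -
  assume "finite Q"
  have "roots_of Q = (\<Union>q\<in>Q - {0}. {x. poly q x = 0})" by (auto simp: roots_of_def)
  then show ?thesis using \<open>finite Q\<close> poly_roots_finite by auto
qed

lemma free_of_roots_iff: "free_of_roots Q a b \<longleftrightarrow> (\<forall>z\<in>roots_of Q. \<not> (a < z \<and> z < b))"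
  by (auto simp: free_of_roots_def roots_of_def)

text \<open>Makes the midpoint a sample point of the cell that is determined by its two
  ends.\<close>

lemma free_of_roots_midpoint:
  assumes "const_cells Q S" "free_of_roots Q a b" "a < x" "x < b"
  shows "S ((a + b) / 2) = S x"
  using assms by (intro const_cellsD[OF assms(1,2)]) auto

lemma adjacent_roots:
  assumes f: "finite Q" and x: "x \<notin> roots_of Q"
    and l: "l \<in> roots_of Q" "l < x" and u: "u \<in> roots_of Q" "x < u"
  obtains a b where "a \<in> roots_of Q" "b \<in> roots_of Q" "a < x" "x < b" "free_of_roots Q a b"
proof
  let ?A = "{z \<in> roots_of Q. z < x}" and ?B = "{z \<in> roots_of Q. x < z}"
  have fin: "finite ?A" "finite ?B" using finite_roots_of[OF f] by auto
  have "?A \<noteq> {}" "?B \<noteq> {}" using l u by auto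
  then have M: "Max ?A \<in> ?A" "Min ?B \<in> ?B" using fin Max_in Min_in by blast+
  then show "Max ?A \<in> roots_of Q" "Min ?B \<in> roots_of Q" "Max ?A < x" "x < Min ?B" by auto
  show "free_of_roots Q (Max ?A) (Min ?B)"
    unfolding free_of_roots_iff
  proof (intro ballI notI)
    fix z assume z: "z \<in> roots_of Q" "Max ?A < z \<and> z < Min ?B"
    then consider "z < x" | "x < z" using x by force
    then show False
    proof cases
      case 1 then have "z \<le> Max ?A" using z fin by (intro Max_ge) auto
      then show False using z by auto
    next
      case 2 then have "Min ?B \<le> z" using z fin by (intro Min_le) auto
      then show False using z by auto
    qed
  qed
qed

text \<open>By \<open>d\<close>, a root of p inside a cell forces a change of sign between its ends.
  By \<open>L\<close>, no root of p lies in an unbounded cell, so cells with two ends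
  suffice.\<close>

lemma root_cases:
  fixes p :: "'a poly"
  assumes f: "finite Q" and S: "const_cells Q S" and d: "pderiv p \<in> Q" "pderiv p \<noteq> 0"
    and L: "\<And>x. poly p x = 0 \<Longrightarrow> (\<exists>l\<in>roots_of Q. l < x) \<and> (\<exists>u\<in>roots_of Q. x < u)"
  shows "(\<exists>x. poly p x = 0 \<and> S x) \<longleftrightarrow>
     (\<exists>x\<in>roots_of Q. poly p x = 0 \<and> S x) \<or>
     (\<exists>a\<in>roots_of Q. \<exists>b\<in>roots_of Q. a < b \<and> poly p a * poly p b < 0 \<and> free_of_roots Q a b \<and> S ((a + b) / 2))"
    (is "?L \<longleftrightarrow> ?R1 \<or> ?R2")
proof
  assume ?L
  then obtain x where x: "poly p x = 0" "S x" by auto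
  show "?R1 \<or> ?R2"
  proof (cases "x \<in> roots_of Q")
    case False
    obtain l u where "l \<in> roots_of Q" "l < x" "u \<in> roots_of Q" "x < u" using L[OF x(1)] by auto
    from adjacent_roots[OF f False this] obtain a b where
      ab: "a \<in> roots_of Q" "b \<in> roots_of Q" "a < x" "x < b" "free_of_roots Q a b" .
    have "poly p a * poly p b < 0"
      using ab(5) d by (intro poly_sign_change[OF ab(3,4) x(1)]) (auto simp: free_of_roots_def)
    moreover have "S ((a + b) / 2)" using free_of_roots_midpoint[OF S ab(5,3,4)] x by simp
    ultimately have ?R2 using ab by (intro bexI[of _ a] bexI[of _ b]) auto
    then show ?thesis ..
  qed (use x in auto)
next
  assume "?R1 \<or> ?R2"
  then show ?L
  proof
    assume ?R2
    then obtain a b where ab: "a < b" "poly p a * poly p b < 0" "free_of_roots Q a b" "S ((a + b) / 2)"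
      by auto
    obtain x where x: "a < x" "x < b" "poly p x = 0" using poly_IVT[OF ab(1,2)] by auto
    then show ?L using free_of_roots_midpoint[OF S ab(3) x(1,2)] ab(4) by auto
  qed auto
qed

text \<open>Every cell contains a sample: the bounded ones their midpoint, the unbounded ones a
  point at distance 1 from an extreme root, and 0 serves if there are no roots.\<close>

lemma sample_cases:
  assumes f: "finite Q" and S: "const_cells Q S"
  shows "(\<exists>x. S x) \<longleftrightarrow> S 0 \<or> (\<exists>a\<in>roots_of Q. S a \<or> S (a - 1) \<or> S (a + 1)) \<or>
     (\<exists>a\<in>roots_of Q. \<exists>b\<in>roots_of Q. S ((a + b) / 2))" (is "?L \<longleftrightarrow> ?R")
proof
  assume ?L
  then obtain x where x: "S x" by auto
  note fr = finite_roots_of[OF f]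
  consider "x \<in> roots_of Q" | "\<And>z. z \<in> roots_of Q \<Longrightarrow> x < z" | "\<And>z. z \<in> roots_of Q \<Longrightarrow> z < x"
    | l u where "x \<notin> roots_of Q" "l \<in> roots_of Q" "l < x" "u \<in> roots_of Q" "x < u"
    by (metis linorder_neqE_linordered_idom)
  then show ?R
  proof cases
    case 2
    \<comment> \<open>The default 1 makes the sample m - 1 equal to 0 if there are no roots.\<close>
    define m where "m = (if roots_of Q = {} then 1 else Min (roots_of Q))"
    have "free_of_roots Q (min x (m - 1) - 1) m"
      using fr by (auto simp: free_of_roots_iff m_def)
    moreover have "x < m \<or> roots_of Q = {}" using 2 fr Min_in by (auto simp: m_def)
    ultimately have "S x = S (m - 1)"
    proof (cases "roots_of Q = {}")
      case True
      then have "free_of_roots Q (min x (m - 1) - 1) (max x (m - 1) + 1)" by (auto simp: free_of_roots_iff)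
      then show ?thesis by (rule const_cellsD[OF S]) auto
    next
      case False
      then show ?thesis
        using \<open>free_of_roots _ _ _\<close> \<open>x < m \<or> _\<close>
        by (intro const_cellsD[OF S, of "min x (m - 1) - 1" m]) auto
    qed
    then show ?thesis using x fr Min_in by (auto simp: m_def split: if_splits)
  next
    case 3
    \<comment> \<open>The default -1 makes the sample m + 1 equal to 0 if there are no
      roots.\<close>
    define m where "m = (if roots_of Q = {} then - 1 else Max (roots_of Q))"
    have "free_of_roots Q m (max x (m + 1) + 1)"
      using fr by (auto simp: free_of_roots_iff m_def)
    moreover have "m < x \<or> roots_of Q = {}" using 3 fr Max_in by (auto simp: m_def)
    ultimately have "S x = S (m + 1)"
    proof (cases "roots_of Q = {}")
      case True
      then have "free_of_roots Q (min x (m + 1) - 1) (max x (m + 1) + 1)" by (auto simp: free_of_roots_iff)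
      then show ?thesis by (rule const_cellsD[OF S]) auto
    next
      case False
      then show ?thesis
        using \<open>free_of_roots _ _ _\<close> \<open>m < x \<or> _\<close>
        by (intro const_cellsD[OF S, of m "max x (m + 1) + 1"]) auto
    qed
    then show ?thesis using x fr Max_in by (auto simp: m_def split: if_splits)
  next
    case 4
    from adjacent_roots[OF f this] obtain a b where
      "a \<in> roots_of Q" "b \<in> roots_of Q" "a < x" "x < b" "free_of_roots Q a b" .
    then show ?thesis using free_of_roots_midpoint[OF S, of a b x] x by auto
  qed (use x in auto)
qed auto

end

text \<open>The exponent should be \<open>length cs - 1\<close>; both sides are multiplied by the
  absolute value of x to avoid the subtraction.\<close>

lemma Poly_abs_bound:
  fixes x :: "'a::linordered_field"
  assumes "\<bar>x\<bar> \<ge> 1"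
  shows "\<bar>poly (Poly cs) x\<bar> * \<bar>x\<bar> \<le> (\<Sum>c\<leftarrow>cs. \<bar>c\<bar>) * \<bar>x\<bar> ^ length cs"
proof (induction cs)
  case (Cons a cs)
  define s where "s = (\<Sum>c\<leftarrow>cs. \<bar>c\<bar>)"
  have "\<bar>poly (Poly (a # cs)) x\<bar> * \<bar>x\<bar> \<le> (\<bar>a\<bar> + \<bar>x\<bar> * \<bar>poly (Poly cs) x\<bar>) * \<bar>x\<bar>"
    by (intro mult_right_mono) (auto simp: abs_mult intro: order.trans[OF abs_triangle_ineq])
  also have "\<dots> = \<bar>a\<bar> * \<bar>x\<bar> + \<bar>x\<bar> * (\<bar>poly (Poly cs) x\<bar> * \<bar>x\<bar>)" by (simp add: algebra_simps)
  also have "\<dots> \<le> \<bar>a\<bar> * \<bar>x\<bar> ^ Suc (length cs) + \<bar>x\<bar> * (s * \<bar>x\<bar> ^ length cs)"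
    using Cons assms self_le_power[OF assms, of "Suc (length cs)"]
    by (intro add_mono mult_left_mono) (auto simp: s_def)
  finally show ?case by (simp add: s_def algebra_simps)
qed simp

text \<open>Cauchy's bound on roots, with the leading coefficient c multiplied out because the
  language has no division.\<close>

lemma root_bound:
  fixes x :: "'a::linordered_field"
  assumes "poly (Poly (p @ [c])) x = 0"
  shows "\<bar>c * x\<bar> \<le> (\<Sum>a\<leftarrow>p @ [c]. \<bar>a\<bar>)"
proof (cases "\<bar>x\<bar> \<le> 1")
  case True
  have "\<bar>c * x\<bar> \<le> \<bar>c\<bar> * 1" unfolding abs_mult by (intro mult_left_mono True) auto
  moreover have "(\<Sum>a\<leftarrow>p. \<bar>a\<bar>) \<ge> 0" by (intro sum_list_nonneg) auto
  ultimately show ?thesis by simp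
next
  case False
  define n where "n = length p"
  have "poly (Poly p) x + c * x ^ n = 0"
    using assms by (simp add: Poly_append poly_monom n_def mult.commute)
  then have "c * x ^ n = - poly (Poly p) x" by (simp add: eq_neg_iff_add_eq_0 add.commute)
  then have "\<bar>c\<bar> * \<bar>x\<bar> ^ n = \<bar>poly (Poly p) x\<bar>" by (metis abs_minus abs_mult power_abs)
  have "(\<bar>c\<bar> * \<bar>x\<bar>) * \<bar>x\<bar> ^ n = (\<bar>c\<bar> * \<bar>x\<bar> ^ n) * \<bar>x\<bar>" by (simp only: mult_ac)
  also have "\<dots> \<le> (\<Sum>a\<leftarrow>p. \<bar>a\<bar>) * \<bar>x\<bar> ^ n"
    unfolding \<open>\<bar>c\<bar> * \<bar>x\<bar> ^ n = _\<close> using Poly_abs_bound[of x p] False by (simp add: n_def)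
  finally have "(\<bar>c\<bar> * \<bar>x\<bar>) * \<bar>x\<bar> ^ n \<le> (\<Sum>a\<leftarrow>p. \<bar>a\<bar>) * \<bar>x\<bar> ^ n" .
  then have "\<bar>c\<bar> * \<bar>x\<bar> \<le> (\<Sum>a\<leftarrow>p. \<bar>a\<bar>)" using False by (simp add: mult_le_cancel_right)
  then show ?thesis by (simp add: abs_mult)
qed

section \<open>Quantifier elimination for real closed fields\<close>

abbreviation "Tru \<equiv> Neg Fls"

definition Conjs :: "fm list \<Rightarrow> fm" where "Conjs As = foldr (\<lambda>A B. Conj A B) As Tru"
definition Disjs :: "fm list \<Rightarrow> fm" where "Disjs As = foldr (\<lambda>A B. Disj A B) As Fls"

lemma sat_Conjs [simp]: "sat R e (Conjs As) \<longleftrightarrow> (\<forall>A\<in>set As. sat R e A)"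
  by (induction As) (auto simp: Conjs_def)

lemma sat_Disjs [simp]: "sat R e (Disjs As) \<longleftrightarrow> (\<exists>A\<in>set As. sat R e A)"
  by (induction As) (auto simp: Disjs_def)

primrec ordered_ring_fm :: "fm \<Rightarrow> bool" where
  "ordered_ring_fm Fls = True"
| "ordered_ring_fm (Eq s t) = True"
| "ordered_ring_fm (Leq s t) = True"
| "ordered_ring_fm (Val s t) = False"
| "ordered_ring_fm (Imp A B) = (ordered_ring_fm A \<and> ordered_ring_fm B)"
| "ordered_ring_fm (Forall A) = False"

lemma ordered_ring_fm_Conjs [simp]: "ordered_ring_fm (Conjs As) \<longleftrightarrow> (\<forall>A\<in>set As. ordered_ring_fm A)"
  by (induction As) (auto simp: Conjs_def)

lemma ordered_ring_fm_Disjs [simp]: "ordered_ring_fm (Disjs As) \<longleftrightarrow> (\<forall>A\<in>set As. ordered_ring_fm A)"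
  by (induction As) (auto simp: Disjs_def)

lemma ordered_ring_fm_subst [simp]: "ordered_ring_fm A \<Longrightarrow> ordered_ring_fm (subst \<sigma> A)"
  by (induction A) auto

lemma qfree_Conjs [simp]: "qfree (Conjs As) \<longleftrightarrow> (\<forall>A\<in>set As. qfree A)"
  by (induction As) (auto simp: Conjs_def)

lemma qfree_Disjs [simp]: "qfree (Disjs As) \<longleftrightarrow> (\<forall>A\<in>set As. qfree A)"
  by (induction As) (auto simp: Disjs_def)

lemma qfree_subst [simp]: "qfree A \<Longrightarrow> qfree (subst \<sigma> A)"
  by (induction A) auto

lemma ordered_ring_fm_qfree: "ordered_ring_fm A \<Longrightarrow> qfree A"
  by (induction A) auto

text \<open>A list of terms stands for the univariate polynomial with these coefficients, the constant
  one first.\<close>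

definition lpoly :: "(nat \<Rightarrow> 'a::linordered_field) \<Rightarrow> tm list \<Rightarrow> 'a poly" where
  "lpoly e cs = Poly (map (tval e) cs)"

lemma lpoly_simps [simp]: "lpoly e [] = 0" "lpoly e (c # cs) = pCons (tval e c) (lpoly e cs)"
  by (simp_all add: lpoly_def)

lemma lpoly_subst [simp]: "lpoly e (map (subst_tm \<sigma>) cs) = lpoly (\<lambda>i. tval e (\<sigma> i)) cs"
  by (simp add: lpoly_def o_def)

primrec horner :: "tm list \<Rightarrow> tm" where
  "horner [] = Zero"
| "horner (c # cs) = Add (subst_tm shift c) (Mult (Var 0) (horner cs))"

lemma tval_horner [simp]: "tval (case_nat x e) (horner cs) = poly (lpoly e cs) x"
  by (induction cs) auto

fun ladd :: "tm list \<Rightarrow> tm list \<Rightarrow> tm list" where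
  "ladd [] ys = ys"
| "ladd xs [] = xs"
| "ladd (x # xs) (y # ys) = Add x y # ladd xs ys"

lemma lpoly_ladd [simp]: "lpoly e (ladd xs ys) = lpoly e xs + lpoly e ys"
  by (induction xs ys rule: ladd.induct) auto

lemma length_ladd [simp]: "length (ladd xs ys) = max (length xs) (length ys)"
  by (induction xs ys rule: ladd.induct) auto

primrec lmult :: "tm list \<Rightarrow> tm list \<Rightarrow> tm list" where
  "lmult [] ys = []"
| "lmult (x # xs) ys = ladd (map (Mult x) ys) (Zero # lmult xs ys)"

lemma lpoly_map_Mult: "lpoly e (map (Mult x) ys) = smult (tval e x) (lpoly e ys)"
  by (induction ys) auto

lemma lpoly_lmult [simp]: "lpoly e (lmult xs ys) = lpoly e xs * lpoly e ys"
  by (induction xs) (auto simp: lpoly_map_Mult)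

primrec coefs :: "tm \<Rightarrow> tm list" where
  "coefs (Var i) = (case i of 0 \<Rightarrow> [Zero, One] | Suc j \<Rightarrow> [Var j])"
| "coefs Zero = []"
| "coefs One = [One]"
| "coefs (Add s t) = ladd (coefs s) (coefs t)"
| "coefs (Minus t) = map Minus (coefs t)"
| "coefs (Mult s t) = lmult (coefs s) (coefs t)"

lemma lpoly_map_Minus [simp]: "lpoly e (map Minus ys) = - lpoly e ys"
  by (induction ys) auto

lemma poly_coefs: "poly (lpoly e (coefs t)) x = tval (case_nat x e) t"
  by (induction t) (auto split: nat.split)

text \<open>For p = a + X q one has p' = q + X q', so no multiples of coefficients by exponents have
  to be written as terms. The separate clause for one coefficient makes the length drop by exactly
  1.\<close>

fun lderiv :: "tm list \<Rightarrow> tm list" where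
  "lderiv [] = []"
| "lderiv [a] = []"
| "lderiv (a # b # q) = ladd (b # q) (Zero # lderiv (b # q))"

lemma lpoly_lderiv [simp]: "lpoly e (lderiv p) = pderiv (lpoly e p)"
  by (induction p rule: lderiv.induct) (auto simp: pderiv_pCons)

lemma length_lderiv [simp]: "length (lderiv p) = length p - 1"
  by (induction p rule: lderiv.induct) auto

primrec atoms :: "fm \<Rightarrow> tm list list" where
  "atoms Fls = []"
| "atoms (Eq s t) = [coefs (Add t (Minus s))]"
| "atoms (Leq s t) = [coefs (Add t (Minus s))]"
| "atoms (Val s t) = []"
| "atoms (Imp A B) = atoms A @ atoms B"
| "atoms (Forall A) = []"

primrec map_atoms :: "(tm list \<Rightarrow> tm list) \<Rightarrow> fm \<Rightarrow> fm" where
  "map_atoms f Fls = Fls"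
| "map_atoms f (Eq s t) = Eq Zero (horner (f (coefs (Add t (Minus s)))))"
| "map_atoms f (Leq s t) = Leq Zero (horner (f (coefs (Add t (Minus s)))))"
| "map_atoms f (Val s t) = Val s t"
| "map_atoms f (Imp A B) = Imp (map_atoms f A) (map_atoms f B)"
| "map_atoms f (Forall A) = Forall A"

lemma ordered_ring_fm_map_atoms [simp]: "ordered_ring_fm (map_atoms f A) = ordered_ring_fm A"
  by (induction A) auto

text \<open>Used in two ways: with f = g it shows that truth is constant on cells, with x = y it
  compares a formula with its reduction.\<close>

lemma sat_map_atoms_cong:
  assumes "ordered_ring_fm A"
    "\<And>q. q \<in> set (atoms A) \<Longrightarrow> sgn (poly (lpoly e (f q)) x) = sgn (poly (lpoly e (g q)) y)"
  shows "sat R (case_nat x e) (map_atoms f A) = sat R (case_nat y e) (map_atoms g A)"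
  using assms
proof (induction A)
  case (Eq s t)
  then show ?case by (simp del: coefs.simps) (metis sgn_0 sgn_0_0)
next
  case (Leq s t)
  have *: "(0 \<le> a) = (0 \<le> b)" if "sgn a = sgn b" for a b :: 'a
    using that by (metis sgn_0_0 sgn_1_neg sgn_neg linorder_not_less)
  show ?case using Leq by (simp del: coefs.simps) (metis *)
qed auto

lemma sat_map_atoms_id:
  "ordered_ring_fm A \<Longrightarrow> sat R (case_nat x e) (map_atoms (\<lambda>q. q) A) = sat R (case_nat x e) A"
  for e :: "nat \<Rightarrow> 'a::linordered_field"
  by (induction A) (auto simp: poly_coefs simp del: coefs.simps)

text \<open>The dividend is multiplied by an even power of the leading coefficient \<open>c\<close> of the divisor
  \<open>p @ [c]\<close>, so that the signs at the roots of the divisor are preserved.\<close>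

primrec lrem :: "tm \<Rightarrow> tm list \<Rightarrow> tm list \<Rightarrow> tm list" where
  "lrem c p [] = replicate (length p) Zero"
| "lrem c p (a # q) = (let s = Mult (pow_tm c (2 * length q)) a # lrem c p q in
     map2 (\<lambda>u v. Add (Mult (Mult c c) u) (Minus (Mult (Mult c (last s)) v))) (butlast s) p)"

lemma tval_pow_tm [simp]: "tval e (pow_tm t k) = tval e t ^ k" for e :: "nat \<Rightarrow> 'a::linordered_field"
  by (induction k) auto

lemma length_lrem [simp]: "length (lrem c p q) = length p"
  by (induction q) (auto simp: Let_def)

lemma lpoly_append: "poly (lpoly e (xs @ ys)) x = poly (lpoly e xs) x + x ^ length xs * poly (lpoly e ys) x"
  by (induction xs) (auto simp: algebra_simps)

lemma lpoly_map2:
  "length xs = length ys \<Longrightarrow> poly (lpoly e (map2 (\<lambda>u v. Add (Mult a u) (Minus (Mult b v))) xs ys)) x =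
     tval e a * poly (lpoly e xs) x - tval e b * poly (lpoly e ys) x"
proof (induction xs ys rule: list_induct2)
  case (Cons x xs y ys)
  show ?case by (simp add: Cons.IH) (simp add: algebra_simps)
qed simp

text \<open>One step multiplies s by \<open>c * c\<close> and subtracts \<open>c * last s\<close>
  times \<open>p @ [c]\<close>, which vanishes at x. The top coefficients cancel, leaving a
  combination of \<open>butlast s\<close> and p.\<close>

lemma poly_lrem:
  fixes e :: "nat \<Rightarrow> 'a::linordered_field"
  assumes "poly (lpoly e (p @ [c])) x = 0"
  shows "poly (lpoly e (lrem c p q)) x = tval e c ^ (2 * length q) * poly (lpoly e q) x"
proof (induction q)
  case Nil
  have "lpoly e (replicate n Zero) = 0" for n by (induction n) auto
  then show ?case by simp
next
  case (Cons a q)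
  define s where "s = Mult (pow_tm c (2 * length q)) a # lrem c p q"
  define C where "C = tval e c"
  have s: "butlast s @ [last s] = s" "length (butlast s) = length p"
    unfolding length_butlast by (rule append_butlast_last_id) (simp_all add: s_def)
  have ps: "poly (lpoly e s) x = C ^ (2 * length q) * (a' + x * poly (lpoly e q) x)"
    if "a' = tval e a" for a'
    using that by (simp add: s_def Cons C_def algebra_simps)
  have bs: "poly (lpoly e (butlast s)) x = poly (lpoly e s) x - x ^ length p * tval e (last s)"
    using lpoly_append[of e "butlast s" "[last s]" x] s by simp
  have pp: "poly (lpoly e p) x = - (x ^ length p * C)"
    using assms by (simp add: lpoly_append C_def eq_neg_iff_add_eq_0)
  have "poly (lpoly e (lrem c p (a # q))) x =
      tval e (Mult c c) * poly (lpoly e (butlast s)) x - tval e (Mult c (last s)) * poly (lpoly e p) x"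
    unfolding lrem.simps Let_def s_def[symmetric] by (rule lpoly_map2) (rule s(2))
  also have "\<dots> = C * C * poly (lpoly e s) x"
    unfolding bs pp by (simp add: C_def algebra_simps)
  finally show ?case by (simp add: ps C_def algebra_simps)
qed

lemma sgn_poly_lrem:
  fixes e :: "nat \<Rightarrow> 'a::linordered_field"
  assumes "poly (lpoly e (p @ [c])) x = 0" "tval e c \<noteq> 0"
  shows "sgn (poly (lpoly e (lrem c p q)) x) = sgn (poly (lpoly e q) x)"
proof -
  have "0 < tval e c ^ (2 * length q)" using assms(2) by (simp add: zero_less_power_eq)
  then have "sgn (tval e c ^ (2 * length q)) = 1" by (rule sgn_pos)
  then show ?thesis unfolding poly_lrem[OF assms(1)] sgn_mult by (simp only: mult_1)
qed

text \<open>Terms have no absolute value; 1 + a^2 dominates it, and the final \<open>One\<close>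
  makes the bound strict.\<close>

definition bound_tm :: "tm list \<Rightarrow> tm" where
  "bound_tm p = foldr (\<lambda>a s. Add (Add One (Mult a a)) s) p One"

lemma bound_tm: "(\<Sum>a\<leftarrow>p. \<bar>tval e a\<bar>) < tval e (bound_tm p)" for e :: "nat \<Rightarrow> 'a::linordered_field"
proof (induction p)
  case (Cons a p)
  have "\<bar>y\<bar> \<le> 1 + y * y" for y :: 'a
  proof (cases "\<bar>y\<bar> \<le> 1")
    case True then show ?thesis by (simp add: add_increasing2)
  next
    case False
    then have "\<bar>y\<bar> * 1 \<le> \<bar>y\<bar> * \<bar>y\<bar>" by (intro mult_left_mono) auto
    then show ?thesis by simp
  qed
  then have "\<bar>tval e a\<bar> \<le> 1 + tval e a * tval e a" .
  from add_le_less_mono[OF this Cons] show ?case by (simp add: bound_tm_def)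
qed (simp add: bound_tm_def)

text \<open>Halving is not a term operation, so the midpoint of the variables 0 and 1 is introduced
  as the root of a linear polynomial. Hence E has to handle lists of length 2.\<close>

definition midpoint_fm :: "(tm list \<Rightarrow> fm \<Rightarrow> fm) \<Rightarrow> fm \<Rightarrow> fm" where
  "midpoint_fm E A = E [Minus (Add (Var 0) (Var 1)), Add One One]
     (subst (case_nat (Var 0) (\<lambda>i. Var (i + 3))) A)"

text \<open>\<open>E q B\<close> says that the polynomial \<open>q\<close> of degree less than \<open>length p\<close> is nonzero and has a
  root satisfying \<open>B\<close>. A root of \<open>p @ [c]\<close> either is a root of some nonzero member of \<open>Q\<close> or lies
  between two adjacent ones. In the second case \<open>p @ [c]\<close> is strictly monotone there, since \<open>Q\<close>
  contains its derivative, so it is characterized by a change of sign. The linear members of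
  \<open>Q\<close> enclose all roots. If \<open>length p = 1\<close>, the reduced formula \<open>A'\<close> does not depend on the root.\<close>

definition root_step :: "(tm list \<Rightarrow> fm \<Rightarrow> fm) \<Rightarrow> tm \<Rightarrow> tm list \<Rightarrow> fm \<Rightarrow> fm" where
  "root_step E c p A = (let
     P = horner (p @ [c]);
     A' = map_atoms (lrem c p) A;
     Q = map (lrem c p) (atoms A) @
       [lderiv (p @ [c]), [bound_tm (p @ [c]), c], [Minus (bound_tm (p @ [c])), c]];
     S = \<lambda>q1 q2. E q1 (E (map (subst_tm shift) q2) (Conjs (
       [Neg (Leq (Var 0) (Var 1)),
        Neg (Leq Zero (Mult (subst_tm (case_nat (Var 0) (\<lambda>i. Var (i + 2))) P)
                            (subst_tm (case_nat (Var 1) (\<lambda>i. Var (i + 2))) P))),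
        midpoint_fm E A'] @
        map (\<lambda>q. Neg (E (map (subst_tm (\<lambda>i. Var (i + 2))) q)
          (Conj (Neg (Leq (Var 0) (Var 2))) (Neg (Leq (Var 1) (Var 0)))))) Q)))
   in if length p = 1 then inst Zero A'
      else Disj (Disjs (map (\<lambda>q. E q (Conj (Eq Zero P) A')) Q))
                (Disjs (concat (map (\<lambda>q1. map (S q1) Q) Q))))"

text \<open>Meant for lists of length at most \<open>Suc d\<close>, that is, formal degree at most
  d. The base case is \<open>Fls\<close> because a nonzero constant has no root and the zero
  polynomial is excluded.\<close>

primrec root_fm :: "nat \<Rightarrow> tm list \<Rightarrow> fm \<Rightarrow> fm" where
  "root_fm 0 p A = Fls"
| "root_fm (Suc d) p A = (if length p \<le> Suc d then root_fm d p A
     else Disj (Conj (Eq (last p) Zero) (root_fm d (butlast p) A))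
               (Conj (Neg (Eq (last p) Zero)) (root_step (root_fm d) (last p) (butlast p) A)))"

text \<open>The disjuncts are the samples of \<open>sample_cases\<close>. The \<open>Suc\<close> in
  d keeps the linear polynomial of \<open>midpoint_fm\<close> within range even if A has no
  atoms.\<close>

definition qe_fm :: "fm \<Rightarrow> fm" where
  "qe_fm A = (let Q = atoms A; d = Suc (foldr (\<lambda>q. max (length q)) Q 0); E = root_fm d;
     S = (\<lambda>s. subst (case_nat s shift) A) in
     Disj (inst Zero A) (Disj
       (Disjs (map (\<lambda>q. E q (Disjs [A, S (Add (Var 0) (Minus One)), S (Add (Var 0) One)])) Q))
       (Disjs (concat (map (\<lambda>q1. map (\<lambda>q2. E q1 (E (map (subst_tm shift) q2) (midpoint_fm E A))) Q) Q)))))"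

lemma ordered_ring_fm_root_step:
  assumes "\<And>q B. ordered_ring_fm B \<Longrightarrow> ordered_ring_fm (E q B)" "ordered_ring_fm A"
  shows "ordered_ring_fm (root_step E c p A)"
  using assms(2) by (auto simp: root_step_def Let_def midpoint_fm_def intro!: assms(1))

lemma ordered_ring_fm_root_fm: "ordered_ring_fm A \<Longrightarrow> ordered_ring_fm (root_fm d p A)"
  by (induction d arbitrary: p A) (auto intro: ordered_ring_fm_root_step)

lemma ordered_ring_fm_qe_fm: "ordered_ring_fm A \<Longrightarrow> ordered_ring_fm (qe_fm A)"
  by (auto simp: qe_fm_def Let_def midpoint_fm_def intro!: ordered_ring_fm_root_fm
      simp del: root_fm.simps)

section \<open>Correctness of the elimination for real closed fields\<close>

context real_closed
begin

definition root_spec :: "nat \<Rightarrow> (tm list \<Rightarrow> fm \<Rightarrow> fm) \<Rightarrow> ('a \<Rightarrow> 'a \<Rightarrow> bool) \<Rightarrow> bool" where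
  "root_spec d E R \<longleftrightarrow> (\<forall>q B e. ordered_ring_fm B \<longrightarrow> length q \<le> d \<longrightarrow>
     (ordered_ring_fm (E q B) \<and>
     (sat R e (E q B) \<longleftrightarrow> lpoly e q \<noteq> 0 \<and> (\<exists>x. poly (lpoly e q) x = 0 \<and> sat R (case_nat x e) B))))"

lemma root_specD:
  assumes "root_spec d E R" "ordered_ring_fm B" "length q \<le> d"
  shows "ordered_ring_fm (E q B)"
    "sat R e (E q B) \<longleftrightarrow> lpoly e q \<noteq> 0 \<and> (\<exists>x. poly (lpoly e q) x = 0 \<and> sat R (case_nat x e) B)"
  using assms unfolding root_spec_def by blast+

lemma sat_midpoint_fm:
  assumes "root_spec d E R" "ordered_ring_fm A" "d \<ge> 2"
  shows "sat R (case_nat b (case_nat a e)) (midpoint_fm E A) \<longleftrightarrow> sat R (case_nat ((a + b) / 2) e) A"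
    "ordered_ring_fm (midpoint_fm E A)"
proof -
  have 1: "(x * 2 = a + b) = (x = (a + b) / 2)" for x :: 'a
    by (auto simp: field_simps)
  have ex: "(\<exists>x. x * 2 = a + b \<and> Y x) = Y ((a + b) / 2)" for Y
    unfolding 1 by blast
  have 2: "(\<lambda>i. tval (case_nat x (case_nat b (case_nat a e))) (case i of 0 \<Rightarrow> Var 0 | Suc i \<Rightarrow> Var (i + 3)))
      = case_nat x e" for x
    by (auto split: nat.split simp: numeral_3_eq_3)
  show "sat R (case_nat b (case_nat a e)) (midpoint_fm E A) \<longleftrightarrow> sat R (case_nat ((a + b) / 2) e) A"
    unfolding midpoint_fm_def using assms
    by (subst root_specD(2)[OF assms(1)]) (simp_all add: 2 algebra_simps ex)
  show "ordered_ring_fm (midpoint_fm E A)"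
    unfolding midpoint_fm_def using assms by (intro root_specD(1)[OF assms(1)]) auto
qed


lemma const_cells_map_atoms:
  fixes e :: "nat \<Rightarrow> 'a"
  assumes "ordered_ring_fm A" "(\<lambda>q. lpoly e (f q)) ` set (atoms A) \<subseteq> Q"
  shows "const_cells Q (\<lambda>x. sat R (case_nat x e) (map_atoms f A))"
  unfolding const_cells_def
proof (intro allI impI)
  fix x y assume "\<forall>q\<in>Q. sgn (poly q x) = sgn (poly q y)"
  then show "sat R (case_nat x e) (map_atoms f A) = sat R (case_nat y e) (map_atoms f A)"
    using assms(2) by (intro sat_map_atoms_cong[OF assms(1)]) blast
qed

lemma case_nat_two: "(\<lambda>i. tval (case_nat b (case_nat a e)) (case i of 0 \<Rightarrow> Var 0 | Suc i \<Rightarrow> Var (i + 2))) = case_nat b e"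
  "(\<lambda>i. tval (case_nat b (case_nat a e)) (case i of 0 \<Rightarrow> Var 1 | Suc i \<Rightarrow> Var (i + 2))) = case_nat a e"
  by (auto split: nat.split)

lemma sat_root_step:
  fixes e :: "nat \<Rightarrow> 'a"
  assumes E: "root_spec (length p) E R" and A: "ordered_ring_fm A"
    and c: "tval e c \<noteq> 0" and len: "length p \<ge> 1"
  shows "sat R e (root_step E c p A) \<longleftrightarrow> (\<exists>x. poly (lpoly e (p @ [c])) x = 0 \<and> sat R (case_nat x e) A)"
proof -
  define P where "P = lpoly e (p @ [c])"
  define A' where "A' = map_atoms (lrem c p) A"
  have A': "ordered_ring_fm A'" using A by (simp add: A'_def)
  have red: "sat R (case_nat x e) A' \<longleftrightarrow> sat R (case_nat x e) A" if "poly P x = 0" for x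
  proof -
    have "sat R (case_nat x e) A' = sat R (case_nat x e) (map_atoms (\<lambda>q. q) A)"
      unfolding A'_def using that c
      by (intro sat_map_atoms_cong[OF A] sgn_poly_lrem) (auto simp: P_def)
    then show ?thesis using sat_map_atoms_id[OF A] by metis
  qed
  have goal: "(\<exists>x. poly P x = 0 \<and> sat R (case_nat x e) A) \<longleftrightarrow> (\<exists>x. poly P x = 0 \<and> sat R (case_nat x e) A')"
    using red by blast
  show ?thesis
  proof (cases "length p = 1")
    case True
    then obtain a where a: "p = [a]" by (auto simp: length_Suc_conv)
    have cst: "sat R (case_nat x e) A' = sat R (case_nat y e) A'" for x y
      unfolding A'_def
    proof (rule sat_map_atoms_cong[OF A])
      fix q
      have "length (lrem c p q) = 1" using True by simp
      then obtain b where "lrem c p q = [b]" by (auto simp: length_Suc_conv simp del: length_lrem)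
      then show "sgn (poly (lpoly e (lrem c p q)) x) = sgn (poly (lpoly e (lrem c p q)) y)" by simp
    qed
    have "poly P (- tval e a / tval e c) = 0" using c by (simp add: P_def a)
    then have "(\<exists>x. poly P x = 0 \<and> sat R (case_nat x e) A') \<longleftrightarrow> sat R (case_nat 0 e) A'"
      using cst by blast
    moreover have "sat R e (root_step E c p A) \<longleftrightarrow> sat R (case_nat 0 e) A'"
      using True unfolding root_step_def Let_def A'_def[symmetric] by (simp only: simp_thms if_True sat_inst tval.simps)
    ultimately show ?thesis using goal by (simp add: P_def)
  next
    case False
    \<comment> \<open>The enclosing linear polynomials and the midpoint need E for length 2. This is
      why a linear divisor is treated separately.\<close>
    then have len2: "length p \<ge> 2" using len by auto
    define M where "M = bound_tm (p @ [c])"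
    define Q where "Q = map (lrem c p) (atoms A) @ [lderiv (p @ [c]), [M, c], [Minus M, c]]"
    define QS where "QS = lpoly e ` set Q"
    define S where "S = (\<lambda>x. sat R (case_nat x e) A')"
    have Qlen: "length q \<le> length p" if "q \<in> set Q" for q
      using that len2 by (auto simp: Q_def)
    have S: "const_cells QS S"
      unfolding S_def A'_def by (rule const_cells_map_atoms[OF A]) (auto simp: QS_def Q_def)
    have "P \<noteq> 0" "degree P = length p"
    proof -
      have cf: "coeff (lpoly e (xs @ [c])) (length xs) = tval e c" for xs
        by (induction xs) auto
      have "coeff (lpoly e (xs @ [c])) i = 0" if "i > length xs" for i xs
        using that by (induction xs arbitrary: i) (auto simp: coeff_pCons split: nat.split)
      then have "degree P \<le> length p" unfolding P_def by (intro degree_le) auto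
      moreover have "length p \<le> degree P" using cf c by (intro le_degree) (simp add: P_def)
      ultimately show "degree P = length p" by simp
      then show "P \<noteq> 0" using len by auto
    qed
    then have dP: "pderiv P \<noteq> 0" using len by (auto simp: pderiv_eq_0_iff)
    have L: "(\<exists>l\<in>roots_of QS. l < x) \<and> (\<exists>u\<in>roots_of QS. x < u)" if "poly P x = 0" for x
    proof -
      define m where "m = tval e M"
      have "\<bar>tval e c * x\<bar> \<le> (\<Sum>a\<leftarrow>p @ [c]. \<bar>tval e a\<bar>)"
        using root_bound[of "map (tval e) p" "tval e c" x] that by (simp add: P_def lpoly_def o_def)
      also have "\<dots> < m" unfolding m_def M_def by (rule bound_tm)
      finally have "\<bar>x\<bar> < m / \<bar>tval e c\<bar>" using c by (simp add: abs_mult field_simps)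
      then have b: "- (m / \<bar>tval e c\<bar>) < x" "x < m / \<bar>tval e c\<bar>" by (auto simp: abs_less_iff)
      have r: "m / tval e c \<in> roots_of QS" "- (m / tval e c) \<in> roots_of QS"
        unfolding roots_of_def QS_def Q_def using c by (auto simp: m_def)
      show ?thesis
      \<comment> \<open>The sign of c decides which of the two bounds is the lower one.\<close>
      proof (cases "tval e c > 0")
        case True then show ?thesis using r b by auto
      next
        case False
        then have "m / tval e c < x" "x < - (m / tval e c)" using b by auto
        then show ?thesis using r by blast
      qed
    qed
    have "(\<exists>x. poly P x = 0 \<and> S x) \<longleftrightarrow>
     (\<exists>x\<in>roots_of QS. poly P x = 0 \<and> S x) \<or>
     (\<exists>a\<in>roots_of QS. \<exists>b\<in>roots_of QS. a < b \<and> poly P a * poly P b < 0 \<and> free_of_roots QS a b \<and> S ((a + b) / 2))"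
      by (rule root_cases[OF _ S _ dP L]) (auto simp: QS_def Q_def P_def)
    also have "\<dots> \<longleftrightarrow> sat R e (root_step E c p A)"
    proof -
      define H where "H = horner (p @ [c])"
      define N where "N = (\<lambda>q. Neg (E (map (subst_tm (\<lambda>i. Var (i + 2))) q)
          (Conj (Neg (Leq (Var 0) (Var 2))) (Neg (Leq (Var 1) (Var 0))))))"
      define Hb Ha where "Hb = subst_tm (case_nat (Var 0) (\<lambda>i. Var (i + 2))) H"
        and "Ha = subst_tm (case_nat (Var 1) (\<lambda>i. Var (i + 2))) H"
      define C where "C = Conjs ([Neg (Leq (Var 0) (Var 1)), Neg (Leq Zero (Mult Hb Ha)),
        midpoint_fm E A'] @ map N Q)"
      note spec = root_specD[OF E]
      have N: "ordered_ring_fm (N q)"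
        "sat R (case_nat b (case_nat a e)) (N q) \<longleftrightarrow>
          lpoly e q = 0 \<or> (\<forall>z. poly (lpoly e q) z = 0 \<longrightarrow> \<not> (a < z \<and> z < b))" if "q \<in> set Q" for q a b
        using Qlen[OF that] unfolding N_def by (auto simp: spec not_le numeral_2_eq_2) 
      have C: "ordered_ring_fm C"
        using N A' unfolding C_def
        by (auto simp: sat_midpoint_fm[OF E A' len2])
      have satC: "sat R (case_nat b (case_nat a e)) C \<longleftrightarrow>
          a < b \<and> poly P a * poly P b < 0 \<and> free_of_roots QS a b \<and> S ((a + b) / 2)" for a b
      proof -
        have H: "tval (case_nat b (case_nat a e)) Hb = poly P b"
          "tval (case_nat b (case_nat a e)) Ha = poly P a"
          unfolding Hb_def Ha_def tval_subst case_nat_two unfolding H_def P_def by simp_all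
        have "sat R (case_nat b (case_nat a e)) C \<longleftrightarrow> a < b \<and> poly P b * poly P a < 0 \<and>
            S ((a + b) / 2) \<and> (\<forall>q\<in>set Q. sat R (case_nat b (case_nat a e)) (N q))"
          unfolding C_def sat_Conjs set_append set_map list.set S_def
          by (simp add: sat_midpoint_fm[OF E A' len2] H not_le)
        then show ?thesis
          using N(2) by (auto simp: free_of_roots_def QS_def mult.commute)
      qed
      have E2: "ordered_ring_fm (E (map (subst_tm shift) q2) C)"
        "sat R (case_nat a e) (E (map (subst_tm shift) q2) C) \<longleftrightarrow> lpoly e q2 \<noteq> 0 \<and>
         (\<exists>b. poly (lpoly e q2) b = 0 \<and> sat R (case_nat b (case_nat a e)) C)" if "q2 \<in> set Q" for q2 a
        using Qlen[OF that] C by (simp_all add: spec)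
      have E1: "sat R e (E q1 (E (map (subst_tm shift) q2) C)) \<longleftrightarrow>
        (lpoly e q1 \<noteq> 0 \<and> (\<exists>a. poly (lpoly e q1) a = 0 \<and> lpoly e q2 \<noteq> 0 \<and>
          (\<exists>b. poly (lpoly e q2) b = 0 \<and> sat R (case_nat b (case_nat a e)) C)))"
        if "q1 \<in> set Q" "q2 \<in> set Q" for q1 q2
        using Qlen[OF that(1)] E2[OF that(2)] by (simp add: spec)
      have "sat R e (root_step E c p A) \<longleftrightarrow>
        (\<exists>q\<in>set Q. sat R e (E q (Conj (Eq Zero H) A'))) \<or>
        (\<exists>q1\<in>set Q. \<exists>q2\<in>set Q. sat R e (E q1 (E (map (subst_tm shift) q2) C)))"
        using False unfolding root_step_def Let_def A'_def[symmetric] M_def[symmetric] Q_def[symmetric]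
          H_def[symmetric] Hb_def[symmetric] Ha_def[symmetric] N_def[symmetric] C_def[symmetric] by auto
      moreover have "sat R e (E q (Conj (Eq Zero H) A')) \<longleftrightarrow>
        lpoly e q \<noteq> 0 \<and> (\<exists>x. poly (lpoly e q) x = 0 \<and> poly P x = 0 \<and> S x)" if "q \<in> set Q" for q
        using Qlen[OF that] A' by (simp add: spec) (auto simp: S_def H_def P_def)
      moreover have "(\<exists>q1\<in>set Q. \<exists>q2\<in>set Q. sat R e (E q1 (E (map (subst_tm shift) q2) C))) \<longleftrightarrow>
        (\<exists>a\<in>roots_of QS. \<exists>b\<in>roots_of QS. sat R (case_nat b (case_nat a e)) C)"
        unfolding roots_of_def QS_def using E1 by auto
      ultimately show ?thesis unfolding satC roots_of_def QS_def by auto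
    qed
    finally show ?thesis using goal by (simp add: S_def P_def)
  qed
qed

theorem root_spec_root_fm: "root_spec (Suc d) (root_fm d) R"
proof (induction d)
  case 0
  show ?case
    unfolding root_spec_def
  proof (intro allI impI conjI)
    fix q :: "tm list" and B and e :: "nat \<Rightarrow> 'a" assume "length q \<le> Suc 0"
    then consider "q = []" | a where "q = [a]" by (cases q) auto
    then show "sat R e (root_fm 0 q B) \<longleftrightarrow> lpoly e q \<noteq> 0 \<and> (\<exists>x. poly (lpoly e q) x = 0 \<and> sat R (case_nat x e) B)"
      by cases auto
  qed simp
next
  case (Suc d)
  show ?case
    unfolding root_spec_def
  proof (intro allI impI conjI)
    fix p :: "tm list" and B and e :: "nat \<Rightarrow> 'a" assume B: "ordered_ring_fm B" and len: "length p \<le> Suc (Suc d)"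
    show "ordered_ring_fm (root_fm (Suc d) p B)" using B by (rule ordered_ring_fm_root_fm)
    show "sat R e (root_fm (Suc d) p B) \<longleftrightarrow> lpoly e p \<noteq> 0 \<and> (\<exists>x. poly (lpoly e p) x = 0 \<and> sat R (case_nat x e) B)"
    proof (cases "length p \<le> Suc d")
      case True
      then show ?thesis using root_specD(2)[OF Suc B] by simp
    next
      case False
      then have lp: "length p = Suc (Suc d)" "p \<noteq> []" using len by auto
      define c q where "c = last p" and "q = butlast p"
      have p: "p = q @ [c]" and lq: "length q = Suc d" using lp by (simp_all add: c_def q_def)
      have unf: "sat R e (root_fm (Suc d) p B) \<longleftrightarrow>
        (tval e c = 0 \<and> sat R e (root_fm d q B)) \<or> (tval e c \<noteq> 0 \<and> sat R e (root_step (root_fm d) c q B))"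
        using False by (simp add: c_def q_def) blast
      show ?thesis
      proof (cases "tval e c = 0")
        case True
        have "lpoly e p = lpoly e q" unfolding p using True
          by (induction q) auto
        then show ?thesis using unf True root_specD(2)[OF Suc B, of q e] lq by simp
      next
        case False
        have nz: "lpoly e p \<noteq> 0"
        proof -
          have "coeff (lpoly e (xs @ [c])) (length xs) = tval e c" for xs
            by (induction xs) auto
          then show ?thesis using False p by (metis coeff_0)
        qed
        show ?thesis using unf False nz sat_root_step[OF _ B False, of q] Suc lq p by simp
      qed
    qed
  qed
qed

theorem sat_qe_fm:
  fixes e :: "nat \<Rightarrow> 'a"
  assumes A: "ordered_ring_fm A"
  shows "sat R e (qe_fm A) \<longleftrightarrow> (\<exists>x. sat R (case_nat x e) A)"
proof -
  define Q where "Q = atoms A"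
  define d where "d = Suc (foldr (\<lambda>q. max (length q)) Q 0)"
  define E where "E = root_fm d"
  define QS where "QS = lpoly e ` set Q"
  define S where "S = (\<lambda>s. subst (case_nat s shift) A)"
  have mx: "length q \<le> foldr (\<lambda>q. max (length q)) Q 0" if "q \<in> set Q" for q and Q :: "tm list list"
    using that by (induction Q) auto
  have Qlen: "length q \<le> Suc d" if "q \<in> set Q" for q
    using mx[OF that] by (simp add: d_def)
  have d2: "Suc d \<ge> 2" by (simp add: d_def)
  have E: "root_spec (Suc d) E R" unfolding E_def by (rule root_spec_root_fm)
  note spec = root_specD[OF E]
  have cc: "const_cells QS (\<lambda>x. sat R (case_nat x e) A)"
    using const_cells_map_atoms[OF A, of e "\<lambda>q. q" QS R] sat_map_atoms_id[OF A, of R _ e]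
    by (simp add: QS_def Q_def)
  have sS: "sat R (case_nat x e) (S s) = sat R (case_nat (tval (case_nat x e) s) e) A" for s x
  proof -
    have "(\<lambda>i. tval (case_nat x e) (case i of 0 \<Rightarrow> s | Suc i \<Rightarrow> shift i)) = case_nat (tval (case_nat x e) s) e"
      by (auto split: nat.split)
    then show ?thesis by (simp add: S_def)
  qed
  define B where "B = Disjs [A, S (Add (Var 0) (Minus One)), S (Add (Var 0) One)]"
  have B: "ordered_ring_fm B" using A by (simp add: B_def S_def)
  have satB: "sat R (case_nat x e) B \<longleftrightarrow> sat R (case_nat x e) A \<or> sat R (case_nat (x - 1) e) A \<or>
      sat R (case_nat (x + 1) e) A" for x
    by (simp add: B_def sS)
  note mid = sat_midpoint_fm[OF E A d2]
  have E1: "sat R e (E q B) \<longleftrightarrow> lpoly e q \<noteq> 0 \<and> (\<exists>x. poly (lpoly e q) x = 0 \<and> sat R (case_nat x e) B)"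
    if "q \<in> set Q" for q
    using Qlen[OF that] B by (simp add: spec)
  have E2: "sat R e (E q1 (E (map (subst_tm shift) q2) (midpoint_fm E A))) \<longleftrightarrow>
      lpoly e q1 \<noteq> 0 \<and> (\<exists>a. poly (lpoly e q1) a = 0 \<and> lpoly e q2 \<noteq> 0 \<and>
       (\<exists>b. poly (lpoly e q2) b = 0 \<and> sat R (case_nat ((a + b) / 2) e) A))"
    if "q1 \<in> set Q" "q2 \<in> set Q" for q1 q2
    using Qlen[OF that(1)] Qlen[OF that(2)] by (simp add: spec mid)
  have "sat R e (qe_fm A) \<longleftrightarrow> sat R (case_nat 0 e) A \<or> (\<exists>q\<in>set Q. sat R e (E q B)) \<or>
      (\<exists>q1\<in>set Q. \<exists>q2\<in>set Q. sat R e (E q1 (E (map (subst_tm shift) q2) (midpoint_fm E A))))"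
    unfolding qe_fm_def Let_def Q_def[symmetric] d_def[symmetric] E_def[symmetric] S_def[symmetric]
      B_def[symmetric] by (simp add: sat_inst del: sat_subst) blast
  also have "\<dots> \<longleftrightarrow> sat R (case_nat 0 e) A \<or> (\<exists>a\<in>roots_of QS. sat R (case_nat a e) B) \<or>
      (\<exists>a\<in>roots_of QS. \<exists>b\<in>roots_of QS. sat R (case_nat ((a + b) / 2) e) A)"
  proof -
    have "(\<exists>q\<in>set Q. sat R e (E q B)) \<longleftrightarrow> (\<exists>a\<in>roots_of QS. sat R (case_nat a e) B)"
      unfolding roots_of_def QS_def using E1 by auto
    moreover have "(\<exists>q1\<in>set Q. \<exists>q2\<in>set Q. sat R e (E q1 (E (map (subst_tm shift) q2) (midpoint_fm E A)))) \<longleftrightarrow>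
      (\<exists>a\<in>roots_of QS. \<exists>b\<in>roots_of QS. sat R (case_nat ((a + b) / 2) e) A)"
      unfolding roots_of_def QS_def using E2 by auto
    ultimately show ?thesis by simp
  qed
  also have "\<dots> \<longleftrightarrow> (\<exists>x. sat R (case_nat x e) A)"
    unfolding satB by (rule sample_cases[OF _ cc, symmetric]) (simp add: QS_def)
  finally show ?thesis .
qed

end

section \<open>Elimination of the valuation\<close>

locale real_closed_valued = real_closed dummy for dummy :: "'a::linordered_field itself" +
  fixes V :: "'a set"
  assumes V_1: "1 \<in> V"
    and V_minus: "x \<in> V \<Longrightarrow> - x \<in> V"
    and V_add: "x \<in> V \<Longrightarrow> y \<in> V \<Longrightarrow> x + y \<in> V"
    and V_mult: "x \<in> V \<Longrightarrow> y \<in> V \<Longrightarrow> x * y \<in> V"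
    and V_inverse: "x * y = 1 \<Longrightarrow> x \<in> V \<or> y \<in> V"
    and V_proper: "\<exists>x. x \<notin> V"
    and V_convex: "0 \<le> x \<Longrightarrow> 0 \<le> y \<Longrightarrow> x + y \<in> V \<Longrightarrow> x \<in> V"
begin

section \<open>The valuation preorder and convexity of V\<close>

definition vle :: "'a \<Rightarrow> 'a \<Rightarrow> bool" where
  "vle x y \<longleftrightarrow> x = 0 \<and> y = 0 \<or> x \<noteq> 0 \<and> y / x \<in> V"

lemma V_0: "0 \<in> V"
  using V_add[OF V_1 V_minus[OF V_1]] by simp

lemma V_abs [simp]: "\<bar>x\<bar> \<in> V \<longleftrightarrow> x \<in> V"
  using V_minus[of x] V_minus[of "- x"] by (auto simp: abs_if)

lemma V_bounded: "\<bar>x\<bar> \<le> \<bar>y\<bar> \<Longrightarrow> y \<in> V \<Longrightarrow> x \<in> V"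
  using V_convex[of "\<bar>x\<bar>" "\<bar>y\<bar> - \<bar>x\<bar>"] by simp

lemma V_less: "y \<in> V \<Longrightarrow> c \<notin> V \<Longrightarrow> \<bar>y\<bar> < \<bar>c\<bar>"
  using V_bounded linorder_not_less by blast

lemma V_of_nat: "of_nat n \<in> V"
  by (induction n) (auto intro: V_0 V_1 V_add)

lemma V_power: "x \<in> V \<Longrightarrow> x ^ k \<in> V"
  by (induction k) (auto intro: V_1 V_mult)

text \<open>By convexity: the absolute value of x is bounded by 1 or by x^2.\<close>

lemma V_square: "x * x \<in> V \<longleftrightarrow> x \<in> V"
proof
  assume h: "x * x \<in> V"
  show "x \<in> V"
  proof (cases "\<bar>x\<bar> \<le> 1")
    case True
    then show ?thesis using V_bounded[of x 1] V_1 by simp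
  next
    case False
    then have "\<bar>x\<bar> * 1 \<le> \<bar>x\<bar> * \<bar>x\<bar>" by (intro mult_left_mono) auto
    then show ?thesis using V_bounded[OF _ h] by (simp add: abs_mult)
  qed
qed (rule V_mult)

lemma not_V_divide: "c \<notin> V \<Longrightarrow> d \<in> V \<Longrightarrow> d \<noteq> 0 \<Longrightarrow> c / d \<notin> V"
  using V_mult[of "c / d" d] by auto

lemma vle_total: "vle x y \<or> vle y x"
proof (cases "x = 0 \<or> y = 0")
  case False
  then show ?thesis using V_inverse[of "x / y" "y / x"] by (auto simp: vle_def)
qed (auto simp: vle_def V_0)

lemma vle_trans: "vle x y \<Longrightarrow> vle y z \<Longrightarrow> vle x z"
  using V_mult[of "y / x" "z / y"] by (auto simp: vle_def V_0)

lemma vle_0: "vle x 0" "vle 0 x \<longleftrightarrow> x = 0"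
  by (auto simp: vle_def V_0)

section \<open>The two sides of the cut defined by V, as filters\<close>

definition below_cut :: "'a filter" where
  "below_cut = (INF u\<in>V. principal {x\<in>V. u \<le> x})"

definition above_cut :: "'a filter" where
  "above_cut = (INF w\<in>{w. w \<notin> V \<and> 0 < w}. principal {x. x \<notin> V \<and> 0 < x \<and> x \<le> w})"

lemma eventually_below_cut:
  "eventually P below_cut \<longleftrightarrow> (\<exists>u\<in>V. \<forall>x\<in>V. u \<le> x \<longrightarrow> P x)"
proof -
  have "eventually P below_cut \<longleftrightarrow> (\<exists>u\<in>V. eventually P (principal {x\<in>V. u \<le> x}))"
    unfolding below_cut_def
  proof (rule eventually_INF_base)
    show "\<exists>x\<in>V. principal {y\<in>V. x \<le> y} \<le> inf (principal {y\<in>V. a \<le> y}) (principal {y\<in>V. b \<le> y})"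
      if "a \<in> V" "b \<in> V" for a b
      using that by (intro bexI[of _ "max a b"]) (auto simp: max_def)
  qed (use V_0 in auto)
  then show ?thesis by (auto simp: eventually_principal)
qed

lemma positive_outside: "\<exists>w. w \<notin> V \<and> 0 < w"
proof -
  obtain x where "x \<notin> V" using V_proper by auto
  then show ?thesis using V_0 by (intro exI[of _ "\<bar>x\<bar>"]) auto
qed

lemma eventually_above_cut:
  "eventually P above_cut \<longleftrightarrow> (\<exists>w. w \<notin> V \<and> 0 < w \<and> (\<forall>x. x \<notin> V \<longrightarrow> 0 < x \<longrightarrow> x \<le> w \<longrightarrow> P x))"
proof -
  let ?W = "{w. w \<notin> V \<and> 0 < w}"
  have "eventually P above_cut \<longleftrightarrow> (\<exists>w\<in>?W. eventually P (principal {x. x \<notin> V \<and> 0 < x \<and> x \<le> w}))"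
    unfolding above_cut_def
  proof (rule eventually_INF_base)
    show "\<exists>x\<in>?W. principal {y. y \<notin> V \<and> 0 < y \<and> y \<le> x} \<le>
        inf (principal {y. y \<notin> V \<and> 0 < y \<and> y \<le> a}) (principal {y. y \<notin> V \<and> 0 < y \<and> y \<le> b})"
      if "a \<in> ?W" "b \<in> ?W" for a b
      using that by (intro bexI[of _ "min a b"]) (auto simp: min_def)
  qed (use positive_outside in auto)
  then show ?thesis by (auto simp: eventually_principal)
qed

text \<open>What the two sides share: x exceeds every given element of V, while every power of x
  stays below every given element outside V, in absolute value.\<close>

definition at_cut :: "'a filter \<Rightarrow> bool" where
  "at_cut F \<longleftrightarrow> (\<forall>c\<in>V. \<forall>\<^sub>F x in F. \<bar>c\<bar> \<le> x) \<and> (\<forall>c k. c \<notin> V \<longrightarrow> (\<forall>\<^sub>F x in F. x ^ k \<le> \<bar>c\<bar>))"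

lemma at_cut_below: "at_cut below_cut"
  unfolding at_cut_def eventually_below_cut
proof (intro conjI ballI allI impI)
  fix c :: 'a assume "c \<in> V"
  then show "\<exists>u\<in>V. \<forall>x\<in>V. u \<le> x \<longrightarrow> \<bar>c\<bar> \<le> x" by (intro bexI[of _ "\<bar>c\<bar>"]) auto
next
  fix c :: 'a and k assume "c \<notin> V"
  then have "x ^ k \<le> \<bar>c\<bar>" if "x \<in> V" for x
    using V_less[OF V_power[OF that]] by (meson abs_ge_self less_imp_le order_le_less_trans)
  then show "\<exists>u\<in>V. \<forall>x\<in>V. u \<le> x \<longrightarrow> x ^ k \<le> \<bar>c\<bar>" using V_0 by blast
qed

text \<open>Square roots can be iterated and stay outside V by \<open>V_square\<close>. The root w
  of order 2^k obtained in this way is at least 1, and k \<le> 2^k.\<close>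

lemma root_outside:
  assumes "c \<notin> V"
  shows "\<exists>w. w \<notin> V \<and> 0 < w \<and> w ^ k \<le> \<bar>c\<bar>"
proof -
  have "\<exists>w. w \<notin> V \<and> 0 < w \<and> w ^ (2 ^ j) = \<bar>c\<bar>" for j
  proof (induction j)
    case 0
    then show ?case using assms V_0 by (intro exI[of _ "\<bar>c\<bar>"]) auto
  next
    case (Suc j)
    then obtain w where w: "w \<notin> V" "0 < w" "w ^ (2 ^ j) = \<bar>c\<bar>" by auto
    obtain z where z: "z * z = w" using square_root[of w] w by auto
    have "\<bar>z\<bar> \<notin> V" using V_square[of z] z w by auto
    moreover have "\<bar>z\<bar> ^ (2 ^ Suc j) = \<bar>c\<bar>"
      using w(3) z by (simp add: power_mult power2_eq_square)
    moreover have "z \<noteq> 0" using z w by auto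
    ultimately show ?case by (intro exI[of _ "\<bar>z\<bar>"]) auto
  qed
  then obtain w where w: "w \<notin> V" "0 < w" "w ^ (2 ^ k) = \<bar>c\<bar>" by blast
  have "1 \<le> w" using V_less[OF V_1 w(1)] w(2) by simp
  then have "w ^ k \<le> w ^ (2 ^ k)" by (intro power_increasing) (auto intro: less_imp_le)
  then show ?thesis using w by auto
qed

lemma at_cut_above: "at_cut above_cut"
  unfolding at_cut_def eventually_above_cut
proof (intro conjI ballI allI impI)
  fix c :: 'a assume "c \<in> V"
  then have "\<bar>c\<bar> \<le> x" if "x \<notin> V" "0 < x" for x using V_less[of c x] that by simp
  then show "\<exists>w. w \<notin> V \<and> 0 < w \<and> (\<forall>x. x \<notin> V \<longrightarrow> 0 < x \<longrightarrow> x \<le> w \<longrightarrow> \<bar>c\<bar> \<le> x)"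
    using positive_outside by blast
next
  fix c :: 'a and k assume "c \<notin> V"
  then obtain w where "w \<notin> V" "0 < w" "w ^ k \<le> \<bar>c\<bar>" using root_outside by blast
  then show "\<exists>w. w \<notin> V \<and> 0 < w \<and> (\<forall>x. x \<notin> V \<longrightarrow> 0 < x \<longrightarrow> x \<le> w \<longrightarrow> x ^ k \<le> \<bar>c\<bar>)"
    by (meson less_imp_le order.trans power_mono)
qed

text \<open>The valuation of the coefficient is minimal, and j is the last such index: x outgrows
  quotients in V, so between coefficients of equal valuation the higher power wins. A coefficient of
  larger valuation loses even with a higher power.\<close>

definition dominant :: "'a list \<Rightarrow> nat \<Rightarrow> bool" where
  "dominant cs j \<longleftrightarrow> j < length cs \<and> cs ! j \<noteq> 0 \<and> (\<forall>l<j. vle (cs ! j) (cs ! l)) \<and>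
     (\<forall>l<length cs. j < l \<longrightarrow> \<not> vle (cs ! l) (cs ! j))"

lemma dominant_exists: "(\<exists>c\<in>set cs. c \<noteq> 0) \<Longrightarrow> \<exists>j. dominant cs j"
proof (induction cs)
  case (Cons c cs)
  show ?case
  proof (cases "\<exists>c\<in>set cs. c \<noteq> 0")
    case True
    then obtain j where j: "dominant cs j" using Cons by blast
    show ?thesis
    proof (cases "vle (cs ! j) c")
      case True
      then have "dominant (c # cs) (Suc j)"
        using j by (auto simp: dominant_def nth_Cons split: nat.split)
      then show ?thesis ..
    next
      case False
      have "\<not> vle (cs ! l) c" if "l < length cs" for l
        using j False that vle_trans vle_total unfolding dominant_def
        by (metis linorder_less_linear)
      moreover have "c \<noteq> 0" using False vle_0 by auto
      ultimately have "dominant (c # cs) 0"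
        by (auto simp: dominant_def nth_Cons split: nat.split)
      then show ?thesis ..
    qed
  next
    case False
    then have "cs ! l = 0" if "l < length cs" for l using that nth_mem by blast
    moreover have "c \<noteq> 0" using False Cons.prems by auto
    ultimately have "\<not> vle (cs ! l) c" if "l < length cs" for l using that by (simp add: vle_0)
    then have "dominant (c # cs) 0"
      using Cons.prems False by (auto simp: dominant_def nth_Cons vle_0 split: nat.split)
    then show ?thesis ..
  qed
qed simp

lemma dominant_unique: "dominant cs j \<Longrightarrow> dominant cs k \<Longrightarrow> j = k"
  unfolding dominant_def by (metis linorder_less_linear)

lemma poly_Poly_sum: "poly (Poly cs) x = (\<Sum>l<length cs. cs ! l * x ^ l)" for x :: 'a
  by (induction cs) (simp_all add: sum.lessThan_Suc_shift sum_distrib_left mult_ac del: sum.lessThan_Suc)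

text \<open>For l < j the quotient of coefficient l by coefficient j is in V, so one factor x
  absorbs it together with N. For l > j the inverse quotient is outside V, also after division by N,
  and exceeds x^(l - j).\<close>

lemma eventually_dominant:
  assumes F: "at_cut F" and j: "dominant cs j"
  shows "\<forall>\<^sub>F x in F. 1 \<le> x \<and> 2 * \<bar>poly (Poly cs) x - cs ! j * x ^ j\<bar> \<le> \<bar>cs ! j\<bar> * x ^ j"
proof -
  define n where "n = length cs"
  \<comment> \<open>With each of the fewer than n other terms at most 1 / (2 n) of the dominant one,
    their sum is at most half of it.\<close>
  define N where "N = (of_nat (2 * n) :: 'a)"
  have n: "n > 0" "N > 0" using j by (auto simp: dominant_def n_def N_def)
  have NV: "N \<in> V" unfolding N_def by (rule V_of_nat)
  have one: "\<forall>\<^sub>F x in F. 1 \<le> x" using F V_1 unfolding at_cut_def by force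
  have cj: "cs ! j \<noteq> 0" using j by (simp add: dominant_def)
  have "\<forall>\<^sub>F x in F. N * (\<bar>cs ! l\<bar> * x ^ l) \<le> \<bar>cs ! j\<bar> * x ^ j" if l: "l < n" "l \<noteq> j" for l
  proof (cases "l < j")
    case True
    then have "cs ! l / cs ! j \<in> V" using j cj by (auto simp: dominant_def vle_def)
    then have "N * (cs ! l / cs ! j) \<in> V" using NV V_mult by blast
    then have "\<forall>\<^sub>F x in F. \<bar>N * (cs ! l / cs ! j)\<bar> \<le> x" using F by (auto simp: at_cut_def)
    with one show ?thesis
    proof eventually_elim
      case (elim x)
      have "N * \<bar>cs ! l\<bar> \<le> \<bar>cs ! j\<bar> * x" using elim cj n by (simp add: abs_mult field_simps)
      also have "\<dots> \<le> \<bar>cs ! j\<bar> * x ^ (j - l)"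
        using elim True by (intro mult_left_mono self_le_power) auto
      finally have "N * \<bar>cs ! l\<bar> * x ^ l \<le> \<bar>cs ! j\<bar> * x ^ (j - l) * x ^ l"
        using elim by (intro mult_right_mono) auto
      also have "\<dots> = \<bar>cs ! j\<bar> * x ^ j" using True by (simp add: mult.assoc flip: power_add)
      finally show ?case by (simp add: mult.assoc)
    qed
  next
    case False
    then have jl: "j < l" using l by auto
    show ?thesis
    proof (cases "cs ! l = 0")
      case True
      show ?thesis using one by eventually_elim (simp add: True)
    next
      case nz: False
      have "\<not> vle (cs ! l) (cs ! j)" using j jl l by (auto simp: dominant_def n_def)
      then have "cs ! j / cs ! l \<notin> V" using nz by (auto simp: vle_def)
      then have "cs ! j / cs ! l / N \<notin> V" by (rule not_V_divide[OF _ NV]) (use n in auto)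
      then have "\<forall>\<^sub>F x in F. x ^ (l - j) \<le> \<bar>cs ! j / cs ! l / N\<bar>" using F unfolding at_cut_def by blast
      with one show ?thesis
      proof eventually_elim
        case (elim x)
        have "N * \<bar>cs ! l\<bar> * x ^ (l - j) \<le> \<bar>cs ! j\<bar>" using elim nz n by (simp add: abs_mult field_simps)
        then have "N * \<bar>cs ! l\<bar> * x ^ (l - j) * x ^ j \<le> \<bar>cs ! j\<bar> * x ^ j"
          using elim by (intro mult_right_mono) auto
        moreover have "x ^ (l - j) * x ^ j = x ^ l" using jl by (simp flip: power_add)
        ultimately show ?case by (simp add: mult.assoc)
      qed
    qed
  qed
  then have "\<forall>\<^sub>F x in F. \<forall>l\<in>{..<n} - {j}. N * (\<bar>cs ! l\<bar> * x ^ l) \<le> \<bar>cs ! j\<bar> * x ^ j"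
    by (intro eventually_ball_finite) auto
  with one show ?thesis
  proof eventually_elim
    case (elim x)
    define B where "B = \<bar>cs ! j\<bar> * x ^ j"
    have B: "B \<ge> 0" using elim by (simp add: B_def)
    have "poly (Poly cs) x - cs ! j * x ^ j = (\<Sum>l\<in>{..<n} - {j}. cs ! l * x ^ l)"
      unfolding poly_Poly_sum n_def[symmetric] using j
      by (subst sum.remove[of _ j]) (auto simp: dominant_def n_def)
    then have "\<bar>poly (Poly cs) x - cs ! j * x ^ j\<bar> \<le> (\<Sum>l\<in>{..<n} - {j}. \<bar>cs ! l * x ^ l\<bar>)"
      by (simp add: sum_abs)
    also have "\<dots> \<le> (\<Sum>l\<in>{..<n} - {j}. B / N)"
    proof (rule sum_mono)
      fix l assume "l \<in> {..<n} - {j}"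
      then have "N * (\<bar>cs ! l\<bar> * x ^ l) \<le> B" using elim by (simp add: B_def)
      then show "\<bar>cs ! l * x ^ l\<bar> \<le> B / N" using n elim by (simp add: abs_mult field_simps)
    qed
    also have "\<dots> \<le> of_nat n * (B / N)"
      using B n by (simp only: sum_constant) (intro mult_right_mono, auto intro: card_mono[of "{..<n}", simplified])
    also have "\<dots> = B / 2" using n by (simp add: N_def)
    finally show ?case using elim by (simp add: B_def)
  qed
qed

lemma dominant_sgn:
  fixes c P y :: 'a
  assumes "2 * \<bar>P - c * y\<bar> \<le> \<bar>c\<bar> * y" "c \<noteq> 0" "y > 0"
  shows "P \<noteq> 0" "0 \<le> P \<longleftrightarrow> 0 \<le> c" "\<bar>P\<bar> \<le> 2 * (\<bar>c\<bar> * y)" "\<bar>c\<bar> * y \<le> 2 * \<bar>P\<bar>"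
proof -
  have ab: "\<bar>c * y\<bar> = \<bar>c\<bar> * y" "\<bar>c\<bar> * y > 0" using assms by (auto simp: abs_mult)
  show l: "\<bar>c\<bar> * y \<le> 2 * \<bar>P\<bar>"
    using assms(1) ab abs_triangle_ineq4[of P "P - c * y"] by simp
  show "\<bar>P\<bar> \<le> 2 * (\<bar>c\<bar> * y)"
    using assms(1) ab abs_triangle_ineq[of "P - c * y" "c * y"] by simp
  show "P \<noteq> 0" using l ab by auto
  show "0 \<le> P \<longleftrightarrow> 0 \<le> c"
  proof (cases "0 \<le> c")
    case True
    then have "c * y > 0" using assms by simp
    then show ?thesis using True assms(1) by (simp add: abs_if split: if_splits)
  next
    case False
    then have "c * y < 0" using assms by (simp add: mult_less_0_iff)
    then show ?thesis using False assms(1) by (simp add: abs_if split: if_splits)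
  qed
qed

text \<open>P and c are bounded by each other up to the factors 2 and 2 y, which lie in V.\<close>

lemma dominant_vle:
  assumes "2 * \<bar>P - c * y\<bar> \<le> \<bar>c\<bar> * y" "c \<noteq> 0" "1 \<le> y" "y \<in> V"
  shows "vle P c" "vle c P"
proof -
  note d = dominant_sgn[OF assms(1,2)]
  have y: "y > 0" using assms by simp
  have "\<bar>c\<bar> * 1 \<le> \<bar>c\<bar> * y" using assms by (intro mult_left_mono) auto
  then have a: "\<bar>c / P\<bar> \<le> \<bar>of_nat 2\<bar>" using d[OF y] by (simp add: divide_le_eq)
  show "vle P c" using d(1)[OF y] V_bounded[OF a V_of_nat] by (simp add: vle_def)
  have b: "\<bar>P / c\<bar> \<le> \<bar>of_nat 2 * y\<bar>" using d[OF y] assms y by (simp add: divide_le_eq abs_mult mult_ac)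
  show "vle c P" using assms(2) V_bounded[OF b V_mult[OF V_of_nat assms(4)]] by (simp add: vle_def)
qed

end

definition zero_fm :: "tm list \<Rightarrow> fm" where
  "zero_fm cs = Conjs (map (\<lambda>c. Eq c Zero) cs)"

definition dominant_fm :: "tm list \<Rightarrow> nat \<Rightarrow> fm" where
  "dominant_fm cs j = Conjs (Neg (Eq (cs ! j) Zero) # map (\<lambda>l. Val (cs ! j) (cs ! l)) [0..<j] @
     map (\<lambda>l. Neg (Val (cs ! l) (cs ! j))) [Suc j..<length cs])"

text \<open>Elimination of a variable which is at the cut determined by the valuation ring: the sign
  and the valuation of a polynomial are those of its dominant monomial.\<close>

primrec at_cut_fm :: "fm \<Rightarrow> fm" where
  "at_cut_fm Fls = Fls"
| "at_cut_fm (Eq s t) = zero_fm (coefs (Add t (Minus s)))"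
| "at_cut_fm (Leq s t) = (let cs = coefs (Add t (Minus s)) in
     Disj (zero_fm cs) (Disjs (map (\<lambda>j. Conj (dominant_fm cs j) (Leq Zero (cs ! j))) [0..<length cs])))"
| "at_cut_fm (Val s t) = (let cs = coefs s; ds = coefs t in
     Disj (zero_fm ds) (Disjs (concat (map (\<lambda>j. map (\<lambda>k.
       Conj (dominant_fm cs j) (Conj (dominant_fm ds k) (Val (cs ! j) (ds ! k)))) [0..<length ds]) [0..<length cs]))))"
| "at_cut_fm (Imp A B) = Imp (at_cut_fm A) (at_cut_fm B)"
| "at_cut_fm (Forall A) = Fls"

lemma qfree_at_cut_fm: "qfree (at_cut_fm A)"
  by (induction A) (auto simp: Let_def zero_fm_def dominant_fm_def)

context real_closed_valued
begin

lemma sat_zero_fm: "sat vle e (zero_fm cs) \<longleftrightarrow> lpoly e cs = 0"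
  by (induction cs) (auto simp: zero_fm_def)

lemma sat_zero_fm': "sat vle e (zero_fm cs) \<longleftrightarrow> (\<forall>c\<in>set (map (tval e) cs). c = 0)"
  by (auto simp: zero_fm_def)

lemma sat_dominant_fm:
  "j < length cs \<Longrightarrow> sat vle e (dominant_fm cs j) \<longleftrightarrow> dominant (map (tval e) cs) j"
  by (auto simp: dominant_fm_def dominant_def ball_Un)

lemma dominant_fm_exists:
  assumes "\<not> sat vle e (zero_fm cs)"
  obtains j where "dominant (map (tval e) cs) j" "\<And>k. dominant (map (tval e) cs) k \<longleftrightarrow> k = j"
    "j < length cs" "tval e (cs ! j) \<noteq> 0"
proof -
  obtain j where j: "dominant (map (tval e) cs) j"
    using assms dominant_exists[of "map (tval e) cs"] unfolding sat_zero_fm' by blast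
  show ?thesis
  proof (rule that[OF j])
    show "dominant (map (tval e) cs) k \<longleftrightarrow> k = j" for k using dominant_unique[OF _ j] j by blast
    show "j < length cs" using j by (simp add: dominant_def)
    then show "tval e (cs ! j) \<noteq> 0" using j by (simp add: dominant_def)
  qed
qed

lemma eventually_dominant_lpoly:
  assumes F: "at_cut F" and j: "dominant (map (tval e) cs) j"
  shows "\<forall>\<^sub>F x in F. 1 \<le> x ^ j \<and>
    2 * \<bar>poly (lpoly e cs) x - tval e (cs ! j) * x ^ j\<bar> \<le> \<bar>tval e (cs ! j)\<bar> * x ^ j"
proof -
  have "map (tval e) cs ! j = tval e (cs ! j)" using j by (simp add: dominant_def)
  then show ?thesis using eventually_dominant[OF F j] unfolding lpoly_def
    by (auto elim!: eventually_mono intro: one_le_power)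
qed

text \<open>For x outside V only signs are controlled, since there the valuation of c x^j varies
  with x. Hence assumption \<open>v\<close>.\<close>

lemma eventually_at_cut_fm:
  assumes F: "at_cut F" and "qfree A" and v: "ordered_ring_fm A \<or> (\<forall>\<^sub>F x in F. x \<in> V)"
  shows "\<forall>\<^sub>F x in F. sat vle (case_nat x e) A \<longleftrightarrow> sat vle e (at_cut_fm A)"
  using assms(2,3)
proof (induction A)
  case (Eq s t)
  define cs where "cs = coefs (Add t (Minus s))"
  have r: "sat vle (case_nat x e) (Eq s t) \<longleftrightarrow> poly (lpoly e cs) x = 0" for x
    unfolding cs_def poly_coefs by auto
  show ?case
  proof (cases "sat vle e (zero_fm cs)")
    case True
    then show ?thesis unfolding r by (simp add: sat_zero_fm cs_def del: coefs.simps)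
  next
    case False
    then obtain j where j: "dominant (map (tval e) cs) j" "tval e (cs ! j) \<noteq> 0"
      by (rule dominant_fm_exists) blast
    from eventually_dominant_lpoly[OF F j(1)] show ?thesis
    proof eventually_elim
      case (elim x)
      have "poly (lpoly e cs) x \<noteq> 0"
        using dominant_sgn(1)[OF _ j(2), of _ "x ^ j"] elim by auto
      then show ?case unfolding r using False by (simp add: cs_def del: coefs.simps)
    qed
  qed
next
  case (Leq s t)
  define cs where "cs = coefs (Add t (Minus s))"
  have r: "sat vle (case_nat x e) (Leq s t) \<longleftrightarrow> 0 \<le> poly (lpoly e cs) x" for x
    unfolding cs_def poly_coefs by auto
  show ?case
  proof (cases "sat vle e (zero_fm cs)")
    case True
    then have "sat vle e (at_cut_fm (Leq s t))" by (simp add: Let_def cs_def del: coefs.simps)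
    then show ?thesis unfolding r using True by (simp add: sat_zero_fm)
  next
    case False
    then obtain j where j: "dominant (map (tval e) cs) j" "\<And>k. dominant (map (tval e) cs) k \<longleftrightarrow> k = j"
      "j < length cs" "tval e (cs ! j) \<noteq> 0" by (rule dominant_fm_exists) blast
    have g: "sat vle e (at_cut_fm (Leq s t)) \<longleftrightarrow> 0 \<le> tval e (cs ! j)"
      using False j by (auto simp: Let_def sat_dominant_fm simp flip: cs_def simp del: coefs.simps)
    from eventually_dominant_lpoly[OF F j(1)] show ?thesis
    proof eventually_elim
      case (elim x)
      have "0 \<le> poly (lpoly e cs) x \<longleftrightarrow> 0 \<le> tval e (cs ! j)"
        using dominant_sgn(2)[OF _ j(4), of _ "x ^ j"] elim by auto
      then show ?case unfolding r g .
    qed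
  qed
next
  case (Val s t)
  then have inV: "\<forall>\<^sub>F x in F. x \<in> V" by simp
  define cs ds where "cs = coefs s" and "ds = coefs t"
  have r: "sat vle (case_nat x e) (Val s t) \<longleftrightarrow> vle (poly (lpoly e cs) x) (poly (lpoly e ds) x)" for x
    unfolding cs_def ds_def poly_coefs by auto
  show ?case
  proof (cases "sat vle e (zero_fm ds)")
    case True
    then have "sat vle e (at_cut_fm (Val s t))" by (simp add: Let_def ds_def)
    then show ?thesis unfolding r using True by (simp add: sat_zero_fm vle_0)
  next
    case False
    then obtain k where k: "dominant (map (tval e) ds) k" "\<And>l. dominant (map (tval e) ds) l \<longleftrightarrow> l = k"
      "k < length ds" "tval e (ds ! k) \<noteq> 0" by (rule dominant_fm_exists) blast
    show ?thesis
    proof (cases "sat vle e (zero_fm cs)")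
      case True
      then have "\<not> dominant (map (tval e) cs) j" for j
        unfolding sat_zero_fm' by (auto simp: dominant_def)
      then have g: "\<not> sat vle e (at_cut_fm (Val s t))"
        using False by (auto simp: Let_def sat_dominant_fm simp flip: cs_def ds_def)
      from eventually_dominant_lpoly[OF F k(1)] show ?thesis
      proof eventually_elim
        case (elim x)
        have "poly (lpoly e ds) x \<noteq> 0"
          using dominant_sgn(1)[OF _ k(4), of _ "x ^ k"] elim by auto
        then show ?case unfolding r using g True by (simp add: sat_zero_fm vle_0)
      qed
    next
      case nz: False
      then obtain j where j: "dominant (map (tval e) cs) j" "\<And>l. dominant (map (tval e) cs) l \<longleftrightarrow> l = j"
        "j < length cs" "tval e (cs ! j) \<noteq> 0" by (rule dominant_fm_exists) blast
      have g: "sat vle e (at_cut_fm (Val s t)) \<longleftrightarrow> vle (tval e (cs ! j)) (tval e (ds ! k))"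
        using False j k by (auto simp: Let_def sat_dominant_fm simp flip: cs_def ds_def)
      from eventually_dominant_lpoly[OF F j(1)] eventually_dominant_lpoly[OF F k(1)] inV show ?thesis
      proof eventually_elim
        case (elim x)
        have "vle (poly (lpoly e cs) x) (tval e (cs ! j))" "vle (tval e (cs ! j)) (poly (lpoly e cs) x)"
          using dominant_vle[OF _ j(4), of _ "x ^ j"] elim V_power by auto
        moreover have "vle (poly (lpoly e ds) x) (tval e (ds ! k))" "vle (tval e (ds ! k)) (poly (lpoly e ds) x)"
          using dominant_vle[OF _ k(4), of _ "x ^ k"] elim V_power by auto
        ultimately show ?case unfolding r g using vle_trans by blast
      qed
    qed
  qed
next
  case (Imp A B)
  have "\<forall>\<^sub>F x in F. sat vle (case_nat x e) A \<longleftrightarrow> sat vle e (at_cut_fm A)"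
    "\<forall>\<^sub>F x in F. sat vle (case_nat x e) B \<longleftrightarrow> sat vle e (at_cut_fm B)"
    using Imp by auto
  then show ?case by eventually_elim simp
qed auto

end

text \<open>\<open>Val s t\<close> is approximated by \<open>t\<^sup>2 \<le> u s\<^sup>2\<close> from below and by \<open>t\<^sup>2 \<le> w s\<^sup>2\<close>
  from above, where \<open>u\<close> (variable 2) is in the valuation ring and \<open>w\<close> (variable 1) is positive
  and outside.\<close>

primrec approx_fm :: "bool \<Rightarrow> fm \<Rightarrow> fm" where
  "approx_fm b Fls = Fls"
| "approx_fm b (Eq s t) = subst (case_nat (Var 0) (\<lambda>i. Var (i + 3))) (Eq s t)"
| "approx_fm b (Leq s t) = subst (case_nat (Var 0) (\<lambda>i. Var (i + 3))) (Leq s t)"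
| "approx_fm b (Val s t) = (let \<tau> = subst_tm (case_nat (Var 0) (\<lambda>i. Var (i + 3))) in
     Leq (Mult (\<tau> t) (\<tau> t)) (Mult (Var (if b then 2 else 1)) (Mult (\<tau> s) (\<tau> s))))"
| "approx_fm b (Imp A B) = Imp (approx_fm (\<not> b) A) (approx_fm b B)"
| "approx_fm b (Forall A) = Fls"

lemma ordered_ring_fm_approx: "ordered_ring_fm (approx_fm b A)"
  by (induction A arbitrary: b) (auto simp: Let_def)

text \<open>After \<open>qe_fm\<close> the variable 0 is w and the variable 1 is u. The inner
  \<open>at_cut_fm\<close> acts on a formula without valuation, as required for w; the outer one
  meets valuations, but u is in V.\<close>

definition vqe_fm :: "fm \<Rightarrow> fm" where
  "vqe_fm A = at_cut_fm (at_cut_fm (qe_fm (approx_fm True A)))"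

lemma qfree_vqe_fm: "qfree (vqe_fm A)"
  by (simp add: vqe_fm_def qfree_at_cut_fm)

context real_closed_valued
begin

lemma case_nat_three:
  "(\<lambda>i. tval (case_nat x (case_nat w (case_nat u e))) (case i of 0 \<Rightarrow> Var 0 | Suc i \<Rightarrow> Var (i + 3))) = case_nat x e"
  by (auto split: nat.split simp: numeral_3_eq_3)

lemma sat_approx_Val:
  "sat R (case_nat x (case_nat w (case_nat u e))) (approx_fm b (Val s t)) \<longleftrightarrow>
     tval (case_nat x e) t * tval (case_nat x e) t \<le>
     (if b then u else w) * (tval (case_nat x e) s * tval (case_nat x e) s)"
  by (simp add: Let_def case_nat_three numeral_2_eq_2)

lemma vle_square: "s \<noteq> 0 \<Longrightarrow> vle s t \<longleftrightarrow> (t * t) / (s * s) \<in> V"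
  using V_square[of "t / s"] by (simp add: vle_def)

text \<open>The flag is the polarity: \<open>True\<close> strengthens the formula,
  \<open>False\<close> weakens it, and an implication swaps them on its left. It holds for every
  admissible u and w, so x may depend on them.\<close>

lemma sat_approx_sound:
  assumes "qfree A" "u \<in> V" "w \<notin> V" "0 < w"
  shows "(sat vle (case_nat x (case_nat w (case_nat u e))) (approx_fm True A) \<longrightarrow> sat vle (case_nat x e) A) \<and>
    (sat vle (case_nat x e) A \<longrightarrow> sat vle (case_nat x (case_nat w (case_nat u e))) (approx_fm False A))"
  using assms(1)
proof (induction A)
  case (Val s t)
  define S T where "S = tval (case_nat x e) s" and "T = tval (case_nat x e) t"
  have 1: "vle S T" if h: "T * T \<le> u * (S * S)"
  proof (cases "S = 0")
    case True
    then have "T = 0" using h zero_le_square[of T] by (simp add: order.antisym)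
    then show ?thesis by (simp add: vle_0)
  next
    case False
    then have "S * S > 0" by (auto simp: zero_less_mult_iff linorder_neq_iff)
    then have q: "T * T / (S * S) \<le> u" using h by (simp add: divide_le_eq)
    moreover have q0: "0 \<le> T * T / (S * S)" by simp
    ultimately have "\<bar>T * T / (S * S)\<bar> \<le> \<bar>u\<bar>" by linarith
    then show ?thesis unfolding vle_square[OF False] using V_bounded assms(2) by blast
  qed
  have 2: "T * T \<le> w * (S * S)" if h: "vle S T"
  proof (cases "S = 0")
    case True
    then show ?thesis using h by (simp add: vle_0)
  next
    case False
    then have s: "S * S > 0" by (auto simp: zero_less_mult_iff linorder_neq_iff)
    have "\<bar>T * T / (S * S)\<bar> < \<bar>w\<bar>"
      using h V_less[OF _ assms(3)] unfolding vle_square[OF False] by blast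
    then have "T * T / (S * S) < w" using assms(4) by linarith
    then show ?thesis using s by (simp add: divide_less_eq)
  qed
  show ?case unfolding sat_approx_Val using 1 2 by (simp add: S_def T_def)
qed (auto simp: case_nat_three)

text \<open>Exactness is only claimed for fixed x: how close u and w must be to the cut depends on
  x.\<close>

lemma eventually_approx:
  assumes "qfree A"
  shows "\<forall>\<^sub>F u in below_cut. \<forall>\<^sub>F w in above_cut.
    sat vle (case_nat x (case_nat w (case_nat u e))) (approx_fm b A) \<longleftrightarrow> sat vle (case_nat x e) A"
  using assms
proof (induction A arbitrary: b)
  case (Val s t)
  define S T where "S = tval (case_nat x e) s" and "T = tval (case_nat x e) t"
  have U: "\<forall>\<^sub>F u in below_cut. u \<in> V" unfolding eventually_below_cut using V_0 by blast
  have W: "\<forall>\<^sub>F w in above_cut. w \<notin> V \<and> 0 < w" unfolding eventually_above_cut using positive_outside by blast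
  have 1: "\<forall>\<^sub>F u in below_cut. vle S T \<longrightarrow> T * T \<le> u * (S * S)"
  proof (cases "S = 0 \<or> \<not> vle S T")
    case True
    then show ?thesis by (auto simp: vle_0)
  next
    case False
    then have s: "S * S > 0" by (auto simp: zero_less_mult_iff linorder_neq_iff)
    have "T * T / (S * S) \<in> V" using False vle_square by blast
    then have "\<forall>\<^sub>F u in below_cut. \<bar>T * T / (S * S)\<bar> \<le> u" using at_cut_below unfolding at_cut_def by blast
    then show ?thesis
    proof eventually_elim
      case (elim u)
      then have "T * T / (S * S) \<le> u" by linarith
      then show ?case using s by (simp add: divide_le_eq)
    qed
  qed
  have 2: "\<forall>\<^sub>F w in above_cut. T * T \<le> w * (S * S) \<longrightarrow> vle S T"
  proof (cases "S = 0 \<or> vle S T")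
    case True
    have "T = 0" if "T * T \<le> 0" using that zero_le_square[of T] by (simp add: order.antisym)
    then have "T * T \<le> w * (S * S) \<longrightarrow> vle S T" for w using True by (cases "S = 0") (simp_all add: vle_0)
    then show ?thesis by simp
  next
    case False
    then have s: "S * S > 0" by (auto simp: zero_less_mult_iff linorder_neq_iff)
    have "T * T / (S * S) \<notin> V" using False vle_square by blast
    \<comment> \<open>Halving turns the bound on w into a strict inequality.\<close>
    then have nv: "T * T / (S * S) / of_nat 2 \<notin> V" by (rule not_V_divide[OF _ V_of_nat]) simp
    then have "\<forall>\<^sub>F w in above_cut. w ^ 1 \<le> \<bar>T * T / (S * S) / of_nat 2\<bar>"
      using at_cut_above unfolding at_cut_def by blast
    then show ?thesis
    proof eventually_elim
      case (elim w)
      have half: "y < q" if "0 \<le> q" "q \<noteq> 0" "y ^ 1 \<le> \<bar>q / of_nat 2\<bar>" for q y :: 'a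
        using that by simp
      have "T * T / (S * S) \<noteq> 0" using nv V_0 by auto
      then have "w < T * T / (S * S)" using elim by (intro half) auto
      then show ?case using s by (simp add: less_divide_eq)
    qed
  qed
  from 1 U show ?case
  proof eventually_elim
    case (elim u)
    from 2 W show ?case
    proof eventually_elim
      case (elim w)
      have sd: "(sat vle (case_nat x (case_nat w (case_nat u e))) (approx_fm True (Val s t)) \<longrightarrow> sat vle (case_nat x e) (Val s t)) \<and>
       (sat vle (case_nat x e) (Val s t) \<longrightarrow> sat vle (case_nat x (case_nat w (case_nat u e))) (approx_fm False (Val s t)))"
        using elim \<open>u \<in> V\<close> by (intro sat_approx_sound) auto
      have "T * T \<le> u * (S * S) \<longleftrightarrow> vle S T" "T * T \<le> w * (S * S) \<longleftrightarrow> vle S T"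
        using sd[unfolded sat_approx_Val sat.simps if_True if_False, folded S_def T_def] elim(1)
          \<open>vle S T \<longrightarrow> T * T \<le> u * (S * S)\<close>
        by blast+
      then have "T * T \<le> (if b then u else w) * (S * S) \<longleftrightarrow> vle S T"
        by (cases b) (simp_all only: if_True if_False)
      then show ?case unfolding sat_approx_Val sat.simps S_def T_def .
    qed
  qed
next
  case (Imp A B)
  then have "\<forall>\<^sub>F u in below_cut. \<forall>\<^sub>F w in above_cut.
    sat vle (case_nat x (case_nat w (case_nat u e))) (approx_fm (\<not> b) A) \<longleftrightarrow> sat vle (case_nat x e) A"
    "\<forall>\<^sub>F u in below_cut. \<forall>\<^sub>F w in above_cut.
    sat vle (case_nat x (case_nat w (case_nat u e))) (approx_fm b B) \<longleftrightarrow> sat vle (case_nat x e) B"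
    by auto
  then show ?case
  proof eventually_elim
    case (elim u)
    then show ?case by eventually_elim simp
  qed
qed (auto simp: case_nat_three)

text \<open>\<open>vqe_fm A\<close> no longer mentions u and w, and the filters are proper. From
  left to right, one pair u, w with a witness suffices by soundness; from right to left, a given x
  satisfies the approximation near the cut.\<close>

theorem sat_vqe_fm:
  assumes A: "qfree A"
  shows "sat vle e (vqe_fm A) \<longleftrightarrow> (\<exists>x. sat vle (case_nat x e) A)"
proof -
  define D where "D = qe_fm (approx_fm True A)"
  have D: "ordered_ring_fm D" unfolding D_def by (intro ordered_ring_fm_qe_fm ordered_ring_fm_approx)
  have satD: "sat vle (case_nat w (case_nat u e)) D \<longleftrightarrow>
      (\<exists>x. sat vle (case_nat x (case_nat w (case_nat u e))) (approx_fm True A))" for u w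
    unfolding D_def by (rule sat_qe_fm[OF ordered_ring_fm_approx])
  have U: "\<forall>\<^sub>F u in below_cut. u \<in> V" unfolding eventually_below_cut using V_0 by blast
  have W: "\<forall>\<^sub>F w in above_cut. w \<notin> V \<and> 0 < w" unfolding eventually_above_cut using positive_outside by blast
  have nb: "below_cut \<noteq> bot" "above_cut \<noteq> bot"
    unfolding trivial_limit_def eventually_below_cut eventually_above_cut by auto
  have 1: "\<forall>\<^sub>F w in above_cut. sat vle (case_nat w (case_nat u e)) D \<longleftrightarrow> sat vle (case_nat u e) (at_cut_fm D)" for u
    using eventually_at_cut_fm[OF at_cut_above ordered_ring_fm_qfree[OF D]] D by blast
  have 2: "\<forall>\<^sub>F u in below_cut. sat vle (case_nat u e) (at_cut_fm D) \<longleftrightarrow> sat vle e (vqe_fm A)"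
    unfolding vqe_fm_def D_def[symmetric]
    using eventually_at_cut_fm[OF at_cut_below qfree_at_cut_fm] U by blast
  show ?thesis
  proof
    assume h: "sat vle e (vqe_fm A)"
    from 2 U have "\<forall>\<^sub>F u in below_cut. u \<in> V \<and> sat vle (case_nat u e) (at_cut_fm D)"
      by eventually_elim (use h in auto)
    then obtain u where u: "u \<in> V" "sat vle (case_nat u e) (at_cut_fm D)"
      using eventually_happens'[OF nb(1)] by blast
    from 1[of u] W have "\<forall>\<^sub>F w in above_cut. w \<notin> V \<and> 0 < w \<and> sat vle (case_nat w (case_nat u e)) D"
      by eventually_elim (use u in auto)
    then obtain w where w: "w \<notin> V" "0 < w" "sat vle (case_nat w (case_nat u e)) D"
      using eventually_happens'[OF nb(2)] by blast
    then show "\<exists>x. sat vle (case_nat x e) A"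
      using satD sat_approx_sound[OF A u(1) w(1,2)] by blast
  next
    assume "\<exists>x. sat vle (case_nat x e) A"
    then obtain x where x: "sat vle (case_nat x e) A" ..
    from 2 eventually_approx[OF A, of x e True] have "\<forall>\<^sub>F u in below_cut. sat vle e (vqe_fm A)"
    proof eventually_elim
      case (elim u)
      from 1[of u] elim(2) have "\<forall>\<^sub>F w in above_cut. sat vle e (vqe_fm A)"
      proof eventually_elim
        case (elim w)
        then show ?case using x satD \<open>sat vle (case_nat u e) (at_cut_fm D) = sat vle e (vqe_fm A)\<close> by blast
      qed
      then show ?case using eventually_happens'[OF nb(2)] by blast
    qed
    then show "sat vle e (vqe_fm A)" using eventually_happens'[OF nb(1)] by blast
  qed
qed

end

section \<open>A countable model refuting an unprovable instance\<close>

text \<open>The formula after elimination may contain irrelevant parameters; these are replaced by 0.\<close>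

definition elim_fm :: "nat \<Rightarrow> nat \<Rightarrow> fm \<Rightarrow> fm" where
  "elim_fm m n A = subst (\<lambda>i. if i < m then Var i else Zero) ((vqe_fm ^^ n) A)"

definition elim_claims :: "fm set" where
  "elim_claims = {Iff (Exs n A) (elim_fm m n A) | m n A. qfree A \<and> fv A \<subseteq> {..<n + m}}"

lemma qfree_vqe_fm_funpow: "qfree A \<Longrightarrow> qfree ((vqe_fm ^^ n) A)"
  by (cases n) (simp_all add: qfree_vqe_fm)

lemma fv_tm_subst: "fv_tm (subst_tm \<sigma> t) = (\<Union>i\<in>fv_tm t. fv_tm (\<sigma> i))"
  by (induction t) auto

lemma fv_subst: "qfree A \<Longrightarrow> fv (subst \<sigma> A) = (\<Union>i\<in>fv A. fv_tm (\<sigma> i))"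
  by (induction A) (auto simp: fv_tm_subst)

lemma qfree_elim_fm: "qfree A \<Longrightarrow> qfree (elim_fm m n A)"
  by (simp add: elim_fm_def qfree_vqe_fm_funpow)

lemma fv_elim_fm: "qfree A \<Longrightarrow> fv (elim_fm m n A) \<subseteq> {..<m}"
  by (auto simp: elim_fm_def fv_subst qfree_vqe_fm_funpow split: if_splits)

lemma fv_Exs: "fv (Exs n A) = {i. i + n \<in> fv A}"
  by (induction n arbitrary: A) auto

lemma fv_Alls: "fv (Alls n A) = {i. i + n \<in> fv A}"
  by (induction n arbitrary: A) auto

context real_closed_valued
begin

lemma sat_Exs: "qfree A \<Longrightarrow> sat vle e (Exs n A) \<longleftrightarrow> sat vle e ((vqe_fm ^^ n) A)"
proof (induction n arbitrary: e)
  case (Suc n)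
  then show ?case by (simp add: sat_vqe_fm qfree_vqe_fm_funpow)
qed simp

lemma sat_elim_claims:
  assumes "B \<in> elim_claims"
  shows "sat vle e B"
proof -
  obtain m n A where B: "B = Iff (Exs n A) (elim_fm m n A)" and A: "qfree A" "fv A \<subseteq> {..<n + m}"
    using assms by (auto simp: elim_claims_def)
  \<comment> \<open>\<open>Exs n A\<close> has no parameter from m on, so replacing those by 0 does
    not affect it.\<close>
  define f where "f = (\<lambda>i. tval e (if i < m then Var i else Zero))"
  have "sat vle e (elim_fm m n A) \<longleftrightarrow> sat vle f (Exs n A)"
    using A by (simp add: elim_fm_def sat_Exs f_def)
  also have "\<dots> \<longleftrightarrow> sat vle e (Exs n A)"
    using A by (intro sat_cong) (auto simp: fv_Exs f_def)
  finally show ?thesis by (auto simp: B)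
qed

end

text \<open>In order to apply the results about type classes, a model has to be a type, which cannot
  depend on a formula. So we fix a single theory, which refutes some instance of quantifier
  elimination if there is any underivable one.\<close>

definition refuting_theory :: "fm set" where
  "refuting_theory = (SOME H. henkin H \<and> ordered_field_axioms \<subseteq> H \<and>
     ((\<exists>H'. henkin H' \<and> RCVF \<subseteq> H' \<and> \<not> elim_claims \<subseteq> H') \<longrightarrow> RCVF \<subseteq> H \<and> \<not> elim_claims \<subseteq> H))"

lemma refuting_theory:
  "henkin refuting_theory" "ordered_field_axioms \<subseteq> refuting_theory"
  "\<exists>H. henkin H \<and> RCVF \<subseteq> H \<and> \<not> elim_claims \<subseteq> H \<Longrightarrow> RCVF \<subseteq> refuting_theory \<and> \<not> elim_claims \<subseteq> refuting_theory"
proof -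
  have "\<exists>H. henkin H \<and> ordered_field_axioms \<subseteq> H \<and>
     ((\<exists>H'. henkin H' \<and> RCVF \<subseteq> H' \<and> \<not> elim_claims \<subseteq> H') \<longrightarrow> RCVF \<subseteq> H \<and> \<not> elim_claims \<subseteq> H)"
  proof (cases "\<exists>H'. henkin H' \<and> RCVF \<subseteq> H' \<and> \<not> elim_claims \<subseteq> H'")
    case True
    then obtain H' where "henkin H'" "RCVF \<subseteq> H'" "\<not> elim_claims \<subseteq> H'" by blast
    moreover have "ordered_field_axioms \<subseteq> RCVF" by (auto simp: RCVF_def)
    ultimately show ?thesis by blast
  next
    case False
    then show ?thesis using henkin_ordered_field_exists by blast
  qed
  from someI_ex[OF this, folded refuting_theory_def]
  show "henkin refuting_theory" "ordered_field_axioms \<subseteq> refuting_theory"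
    "\<exists>H. henkin H \<and> RCVF \<subseteq> H \<and> \<not> elim_claims \<subseteq> H \<Longrightarrow> RCVF \<subseteq> refuting_theory \<and> \<not> elim_claims \<subseteq> refuting_theory"
    by blast+
qed

section \<open>The term model of the chosen theory\<close>

lemma refuting_theory_Eq: "Eq t t \<in> refuting_theory" "Eq s t \<in> refuting_theory \<Longrightarrow> inst s A \<in> refuting_theory \<Longrightarrow> inst t A \<in> refuting_theory"
  using refuting_theory(1) unfolding henkin_def by blast+

lemma refuting_theory_connectives: "Fls \<notin> refuting_theory" "Imp A B \<in> refuting_theory \<longleftrightarrow> (A \<in> refuting_theory \<longrightarrow> B \<in> refuting_theory)"
  "Forall A \<in> refuting_theory \<longleftrightarrow> (\<forall>t. inst t A \<in> refuting_theory)"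
  using refuting_theory(1) unfolding henkin_def by blast+

lemma inst_shift [simp]: "subst_tm (case_nat t Var) (subst_tm shift s) = s"
  by (simp add: subst_tm_comp)

lemma refuting_theory_sym: "Eq s t \<in> refuting_theory \<Longrightarrow> Eq t s \<in> refuting_theory"
  using refuting_theory_Eq(2)[of s t "Eq (Var 0) (subst_tm shift s)"] refuting_theory_Eq(1) by simp

lemma refuting_theory_trans: "Eq s t \<in> refuting_theory \<Longrightarrow> Eq t u \<in> refuting_theory \<Longrightarrow> Eq s u \<in> refuting_theory"
  using refuting_theory_Eq(2)[of t u "Eq (subst_tm shift s) (Var 0)"] by simp

lemma refuting_theory_cong:
  assumes "Eq s s' \<in> refuting_theory" "Eq t t' \<in> refuting_theory"
  shows "Eq (Add s t) (Add s' t') \<in> refuting_theory" "Eq (Mult s t) (Mult s' t') \<in> refuting_theory"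
    "Eq (Minus s) (Minus s') \<in> refuting_theory" "Leq s t \<in> refuting_theory \<Longrightarrow> Leq s' t' \<in> refuting_theory"
    "Val s t \<in> refuting_theory \<Longrightarrow> Val s' t' \<in> refuting_theory"
proof -
  show "Eq (Add s t) (Add s' t') \<in> refuting_theory"
    using refuting_theory_trans refuting_theory_Eq(1)
      refuting_theory_Eq(2)[OF assms(1), of "Eq (Add (subst_tm shift s) (subst_tm shift t)) (Add (Var 0) (subst_tm shift t))"]
      refuting_theory_Eq(2)[OF assms(2), of "Eq (Add (subst_tm shift s') (subst_tm shift t)) (Add (subst_tm shift s') (Var 0))"]
    by simp
  show "Eq (Mult s t) (Mult s' t') \<in> refuting_theory"
    using refuting_theory_trans refuting_theory_Eq(1)
      refuting_theory_Eq(2)[OF assms(1), of "Eq (Mult (subst_tm shift s) (subst_tm shift t)) (Mult (Var 0) (subst_tm shift t))"]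
      refuting_theory_Eq(2)[OF assms(2), of "Eq (Mult (subst_tm shift s') (subst_tm shift t)) (Mult (subst_tm shift s') (Var 0))"]
    by simp
  show "Eq (Minus s) (Minus s') \<in> refuting_theory"
    using refuting_theory_Eq(1) refuting_theory_Eq(2)[OF assms(1), of "Eq (Minus (subst_tm shift s)) (Minus (Var 0))"]
    by simp
  show "Leq s t \<in> refuting_theory \<Longrightarrow> Leq s' t' \<in> refuting_theory"
    using refuting_theory_Eq(2)[OF assms(1), of "Leq (Var 0) (subst_tm shift t)"]
      refuting_theory_Eq(2)[OF assms(2), of "Leq (subst_tm shift s') (Var 0)"] by simp
  show "Val s t \<in> refuting_theory \<Longrightarrow> Val s' t' \<in> refuting_theory"
    using refuting_theory_Eq(2)[OF assms(1), of "Val (Var 0) (subst_tm shift t)"]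
      refuting_theory_Eq(2)[OF assms(2), of "Val (subst_tm shift s') (Var 0)"] by simp
qed

quotient_type term_model = tm / "\<lambda>s t. Eq s t \<in> refuting_theory"
  morphisms representative denotation
  by (intro equivpI reflpI sympI transpI) (auto intro: refuting_theory_Eq refuting_theory_sym refuting_theory_trans)

instantiation term_model :: "{zero, one, plus, uminus, times, ord}"
begin

lift_definition zero_term_model :: term_model is Zero .
lift_definition one_term_model :: term_model is One .
lift_definition plus_term_model :: "term_model \<Rightarrow> term_model \<Rightarrow> term_model" is Add
  by (rule refuting_theory_cong)
lift_definition times_term_model :: "term_model \<Rightarrow> term_model \<Rightarrow> term_model" is Mult
  by (rule refuting_theory_cong)
lift_definition uminus_term_model :: "term_model \<Rightarrow> term_model" is Minus
  by (rule refuting_theory_cong)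
lift_definition less_eq_term_model :: "term_model \<Rightarrow> term_model \<Rightarrow> bool" is "\<lambda>s t. Leq s t \<in> refuting_theory"
  by (meson refuting_theory_cong refuting_theory_sym)
definition less_term_model :: "term_model \<Rightarrow> term_model \<Rightarrow> bool" where
  "less_term_model x y \<longleftrightarrow> x \<le> y \<and> \<not> y \<le> x"

instance ..

end

lift_definition val_term_model :: "term_model \<Rightarrow> term_model \<Rightarrow> bool" is "\<lambda>s t. Val s t \<in> refuting_theory"
  by (meson refuting_theory_cong refuting_theory_sym)

lemma tval_term_model: "tval (\<lambda>i. denotation (\<sigma> i)) t = denotation (subst_tm \<sigma> t)"
  by (induction t) (auto simp: zero_term_model_def one_term_model_def plus_term_model.abs_eq
    times_term_model.abs_eq uminus_term_model.abs_eq)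

lemma denotation_surj: "\<exists>t. x = denotation t"
  by (metis Quotient3_abs_rep Quotient3_term_model)

text \<open>The truth lemma. Every element is a denotation, so the quantifier case is the Henkin
  property of \<open>Forall\<close>.\<close>

lemma sat_term_model:
  "sat val_term_model (\<lambda>i. denotation (\<sigma> i)) A \<longleftrightarrow> subst \<sigma> A \<in> refuting_theory"
proof (induction A arbitrary: \<sigma>)
  case (Forall A)
  have "case_nat (denotation t) (\<lambda>i. denotation (\<sigma> i)) = (\<lambda>i. denotation (case_nat t \<sigma> i))" for t
    by (auto split: nat.split)
  then have "sat val_term_model (case_nat (denotation t) (\<lambda>i. denotation (\<sigma> i))) A \<longleftrightarrow>
      inst t (subst (under \<sigma>) A) \<in> refuting_theory" for t
    using Forall.IH unfolding inst_under by simp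
  then show ?case using denotation_surj unfolding sat.simps subst.simps refuting_theory_connectives by metis
qed (simp_all add: tval_term_model refuting_theory_connectives term_model.abs_eq_iff
  less_eq_term_model.abs_eq val_term_model.abs_eq)

lemma sat_term_model_sentence:
  assumes "A \<in> refuting_theory" "fv A = {}"
  shows "sat val_term_model e A"
proof -
  have "e = (\<lambda>i. denotation (SOME t. e i = denotation t))"
    using someI_ex[OF denotation_surj] by blast
  then show ?thesis using sat_term_model assms by (metis subst_sentence)
qed

section \<open>The axioms evaluated in the term model\<close>

lemma fv_ordered_field_axioms: "A \<in> ordered_field_axioms \<Longrightarrow> fv A = {}"
  unfolding ordered_field_axioms_def Let_def by (auto simp: numeral_3_eq_3 numeral_2_eq_2)

lemma fv_pow_tm: "fv_tm (pow_tm t k) \<subseteq> fv_tm t"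
  by (induction k) auto

lemma fv_poly_tm: "fv_tm (poly_tm k) \<subseteq> {..k}"
  using fv_pow_tm[of "Var 0"] by (induction k) fastforce+

lemma fv_RCVF: "A \<in> RCVF \<Longrightarrow> fv A = {}"
proof -
  have "fv (Alls (2 * n + 2) (Imp (Neg (Eq (Var (2 * n + 1)) Zero)) (Exists (Eq (poly_tm (2 * n + 2)) Zero)))) = {}" for n
    unfolding fv_Alls using fv_poly_tm[of "2 * n + 2"] by (auto simp del: poly_tm.simps)
  then have "A \<in> real_closed_axioms \<Longrightarrow> fv A = {}"
    unfolding real_closed_axioms_def by auto
  moreover have "A \<in> valuation_axioms \<Longrightarrow> fv A = {}"
    unfolding valuation_axioms_def Let_def by (auto simp: numeral_2_eq_2)
  ultimately show "A \<in> RCVF \<Longrightarrow> fv A = {}"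
    using fv_ordered_field_axioms by (auto simp: RCVF_def)
qed

lemma sat_term_model_ordered_field: "\<forall>A\<in>ordered_field_axioms. sat val_term_model (\<lambda>_. 0) A"
  using refuting_theory(2) sat_term_model_sentence fv_ordered_field_axioms by blast

text \<open>The quantifiers come in the order z, y, x because the outermost \<open>Forall\<close> of
  \<open>Alls\<close> binds the largest index.\<close>

lemma term_model_axioms:
  "\<forall>z y x. x + y + z = x + (y + z :: term_model)" "\<forall>y x. x + y = y + (x :: term_model)"
  "\<forall>x. x + 0 = (x :: term_model)" "\<forall>x. x + - x = (0 :: term_model)"
  "\<forall>z y x. x * y * z = x * (y * z :: term_model)" "\<forall>y x. x * y = y * (x :: term_model)"
  "\<forall>x. x * 1 = (x :: term_model)" "\<forall>z y x. x * (y + z) = x * y + x * (z :: term_model)"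
  "(0 :: term_model) \<noteq> 1" "\<forall>x :: term_model. x \<noteq> 0 \<longrightarrow> (\<exists>y. x * y = 1)"
  "\<forall>x :: term_model. x \<le> x" "\<forall>y x :: term_model. x \<le> y \<longrightarrow> y \<le> x \<longrightarrow> x = y"
  "\<forall>z y x :: term_model. x \<le> y \<longrightarrow> y \<le> z \<longrightarrow> x \<le> z"
  "\<forall>y x :: term_model. \<not> x \<le> y \<longrightarrow> y \<le> x"
  "\<forall>z y x :: term_model. x \<le> y \<longrightarrow> x + z \<le> y + z"
  "\<forall>y x :: term_model. 0 \<le> x \<longrightarrow> 0 \<le> y \<longrightarrow> 0 \<le> x * y"
  by (insert sat_term_model_ordered_field[unfolded ordered_field_axioms_def Let_def, simplified,
      simplified numeral_3_eq_3 numeral_2_eq_2, simplified], (elim conjE, assumption)+)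

lemmas term_model_rules = term_model_axioms[rule_format]

instantiation term_model :: linordered_field
begin

definition minus_term_model :: "term_model \<Rightarrow> term_model \<Rightarrow> term_model" where
  "minus_term_model x y = x + - y"
definition inverse_term_model :: "term_model \<Rightarrow> term_model" where
  "inverse_term_model x = (if x = 0 then 0 else (SOME y. x * y = 1))"
definition divide_term_model :: "term_model \<Rightarrow> term_model \<Rightarrow> term_model" where
  "divide_term_model x y = x * inverse y"
definition abs_term_model :: "term_model \<Rightarrow> term_model" where
  "abs_term_model x = (if x < 0 then - x else x)"
definition sgn_term_model :: "term_model \<Rightarrow> term_model" where
  "sgn_term_model x = (if x = 0 then 0 else if 0 < x then 1 else - 1)"

instance
proof
  fix a b c :: term_model
  note r = term_model_rules
  show "a + b + c = a + (b + c)" by (rule r)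
  show "a + b = b + a" by (rule r(2))
  have add_0: "0 + x = x" for x :: term_model using r(2)[of x 0] r(3)[of x] by simp
  have neg: "- x + x = 0" for x :: term_model using r(2)[of x "- x"] r(4)[of x] by simp
  have canc: "x + y = 0 \<Longrightarrow> y = - x" for x y :: term_model
    by (metis add_0 r(1) neg r(3))
  have mult_0: "x * 0 = 0" for x :: term_model
    using r(8)[of x 0 0] r(3)[of 0] canc by (metis r(1) r(3) neg add_0)
  show "a * 0 = 0" by (rule mult_0)
  show "0 * a = 0" using mult_0[of a] r(6)[of 0 a] by simp
  show "a + b - a = b" unfolding minus_term_model_def by (metis r(1) r(2) r(3) r(4))
  have "(b + c) + (- b + - c) = 0" by (metis r(1) r(2) r(3) r(4))
  then have "- b + - c = - (b + c)" by (rule canc)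
  then show "a - b - c = a - (b + c)" unfolding minus_term_model_def using r(1) by simp
  show "0 + a = a" by (rule add_0)
  show "- a + a = 0" by (rule neg)
  show "a - b = a + - b" by (rule minus_term_model_def)
  show "a * b * c = a * (b * c)" by (rule r)
  show comm: "a * b = b * a" by (rule r(6))
  show "1 * a = a" using r(6)[of a 1] r(7)[of a] by simp
  show "(a + b) * c = a * c + b * c"
    using r(8)[of c a b] r(6)[of "a + b" c] r(6)[of c a] r(6)[of c b] by simp
  show "(0 :: term_model) \<noteq> 1" by (rule r(9))
  show "a \<noteq> 0 \<Longrightarrow> inverse a * a = 1"
    using someI_ex[OF r(10)[of a]] r(6)[of a "inverse a"] by (simp add: inverse_term_model_def)
  show "a div b = a * inverse b" by (rule divide_term_model_def)
  show "inverse (0 :: term_model) = 0" by (simp add: inverse_term_model_def)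
  show "(a < b) = (a \<le> b \<and> \<not> b \<le> a)" by (rule less_term_model_def)
  show "a \<le> a" by (rule r)
  show "a \<le> b \<Longrightarrow> b \<le> c \<Longrightarrow> a \<le> c" by (rule r(13))
  show antisym: "a \<le> b \<Longrightarrow> b \<le> a \<Longrightarrow> a = b" by (rule r(12))
  show "a \<le> b \<or> b \<le> a" using r(14)[of a b] by blast
  have add_mono: "z + x \<le> z + y" if "x \<le> y" for x y z :: term_model
    using r(15)[OF that, of z] r(2)[of z] by simp
  show "a \<le> b \<Longrightarrow> c + a \<le> c + b" by (rule add_mono)
  show "\<bar>a\<bar> = (if a < 0 then - a else a)" by (rule abs_term_model_def)
  show "sgn a = (if a = 0 then 0 else if 0 < a then 1 else - 1)" by (rule sgn_term_model_def)
  show "a < b \<Longrightarrow> 0 < c \<Longrightarrow> c * a < c * b"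
  proof -
    assume h: "a < b" "0 < c"
    have mult_neg: "x * - y = - (x * y)" for x y :: term_model
      using canc[of "x * y" "x * - y"] r(8)[of x y "- y"] r(4)[of y] mult_0 by simp
    have "0 \<le> b + - a" using r(15)[of a b "- a"] h r(4)[of a] by (simp add: less_term_model_def)
    moreover have "0 \<le> c" using h by (simp add: less_term_model_def)
    ultimately have "0 \<le> c * (b + - a)" using r(16) by blast
    then have "0 \<le> c * b + - (c * a)" by (simp only: r(8) mult_neg)
    then have "0 + c * a \<le> c * b + - (c * a) + c * a" by (rule r(15))
    then have le: "c * a \<le> c * b" by (simp only: add_0 r(1) neg r(3))
    have "c * a \<noteq> c * b"
    proof
      assume e: "c * a = c * b"
      have "c \<noteq> 0" using h by (auto simp: less_term_model_def)
      then obtain d where d: "c * d = 1" using r(10) by blast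
      have "d * (c * a) = d * (c * b)" using e by simp
      then have "a = b" using d by (metis r(5) r(6) r(7))
      then show False using h by (simp add: less_term_model_def)
    qed
    then show "c * a < c * b" using le r(12) by (auto simp: less_term_model_def)
  qed
qed

end

lemma sat_Alls: "sat R e (Alls k A) \<Longrightarrow> sat R (\<lambda>i. if i < k then f i else e (i - k)) A"
proof (induction k arbitrary: e)
  case (Suc k)
  then have "sat R (case_nat (f k) e) (Alls k A)" by simp
  from Suc.IH[OF this]
  show ?case
  proof (rule back_subst[of "\<lambda>e. sat R e A"])
    show "(\<lambda>i. if i < k then f i else case_nat (f k) e (i - k)) =
      (\<lambda>i. if i < Suc k then f i else e (i - Suc k))"
      by (rule ext) (auto simp: less_Suc_eq not_less diff_Suc split: nat.split)
  qed
qed simp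

lemma tval_poly_tm: "tval (case_nat x e) (poly_tm k) = (\<Sum>i<k. e i * x ^ i)"
  for e :: "nat \<Rightarrow> 'a::linordered_field"
  by (induction k) auto

context
  assumes RCVF: "RCVF \<subseteq> refuting_theory"
begin

lemma sat_RCVF: "A \<in> RCVF \<Longrightarrow> sat val_term_model e A"
  using RCVF fv_RCVF sat_term_model_sentence by blast

lemma real_closed_term_model: "real_closed TYPE(term_model)"
proof
  fix x :: term_model assume "0 \<le> x"
  have "sat val_term_model (\<lambda>_. 0) (Alls 1 (Imp (Leq Zero (Var 0)) (Exists (Eq (Mult (Var 0) (Var 0)) (Var 1)))))"
    by (rule sat_RCVF) (simp add: RCVF_def real_closed_axioms_def)
  then show "\<exists>y. y * y = x" using \<open>0 \<le> x\<close> by simp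
next
  fix p :: "term_model poly" assume "odd (degree p)"
  then obtain n where n: "degree p = 2 * n + 1" by (elim oddE)
  have "Alls (2 * n + 2) (Imp (Neg (Eq (Var (2 * n + 1)) Zero)) (Exists (Eq (poly_tm (2 * n + 2)) Zero))) \<in> RCVF"
    unfolding RCVF_def real_closed_axioms_def by blast
  then have "sat val_term_model (\<lambda>_. 0) (Alls (2 * n + 2)
      (Imp (Neg (Eq (Var (2 * n + 1)) Zero)) (Exists (Eq (poly_tm (2 * n + 2)) Zero))))"
    by (rule sat_RCVF)
  \<comment> \<open>The generic coefficients are specialized to those of p; the one of index 2 n + 1
    is its nonzero leading coefficient.\<close>
  from sat_Alls[OF this, of "coeff p"]
  obtain x where x: "tval (case_nat x (\<lambda>i. if i < 2 * n + 2 then coeff p i else 0)) (poly_tm (2 * n + 2)) = 0"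
    using n by (auto simp del: poly_tm.simps) (metis degree_0 leading_coeff_0_iff nat.simps(3))
  have "poly p x = (\<Sum>i\<le>degree p. coeff p i * x ^ i)" by (rule poly_altdef)
  also have "\<dots> = (\<Sum>i<2 * n + 2. coeff p i * x ^ i)"
    unfolding n by (rule sum.cong) auto
  also have "\<dots> = 0" using x unfolding tval_poly_tm by simp
  finally show "\<exists>x. poly p x = 0" ..
qed

lemma sat_term_model_valuation: "\<forall>A\<in>valuation_axioms. sat val_term_model (\<lambda>_. 0) A"
  using sat_RCVF by (auto simp: RCVF_def)

lemma term_model_valuation:
  "val_term_model 1 1"
  "\<forall>x. val_term_model 1 x \<longrightarrow> val_term_model 1 (- x)"
  "\<forall>y x. val_term_model 1 x \<longrightarrow> val_term_model 1 y \<longrightarrow> val_term_model 1 (x + y)"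
  "\<forall>y x. val_term_model 1 x \<longrightarrow> val_term_model 1 y \<longrightarrow> val_term_model 1 (x * y)"
  "\<forall>y x. x * y = 1 \<longrightarrow> \<not> val_term_model 1 x \<longrightarrow> val_term_model 1 y"
  "\<exists>x. \<not> val_term_model 1 x"
  "\<forall>y x. 0 \<le> x \<longrightarrow> 0 \<le> y \<longrightarrow> val_term_model 1 (x + y) \<longrightarrow> val_term_model 1 x"
  "val_term_model x y \<longleftrightarrow> x = 0 \<and> y = 0 \<or> x \<noteq> 0 \<and> (\<exists>q. q * x = y \<and> val_term_model 1 q)"
  by (insert sat_term_model_valuation[unfolded valuation_axioms_def Let_def, simplified,
      simplified numeral_3_eq_3 numeral_2_eq_2, simplified], (elim conjE, assumption)+) (elim conjE, metis)

lemma elim_claims_refuting_theory: "elim_claims \<subseteq> refuting_theory"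
proof
  fix B assume B: "B \<in> elim_claims"
  note v = term_model_valuation(1-7)[rule_format]
  interpret real_closed_valued "TYPE(term_model)" "{x. val_term_model 1 x}"
  proof (intro real_closed_valued.intro real_closed_valued_axioms.intro real_closed_term_model;
      unfold mem_Collect_eq)
    show "val_term_model 1 x \<or> val_term_model 1 y" if "x * y = 1" for x y using v(5) that by blast
  qed (fact v)+
  have "vle = val_term_model"
  proof (intro ext)
    fix x y
    have "(\<exists>q. q * x = y \<and> val_term_model 1 q) \<longleftrightarrow> val_term_model 1 (y / x)" if "x \<noteq> 0"
      using that by (metis nonzero_mult_div_cancel_right nonzero_eq_divide_eq)
    then show "vle x y = val_term_model x y"
      using term_model_valuation(8)[of x y] by (auto simp only: vle_def mem_Collect_eq)
  qed
  \<comment> \<open>When every variable denotes itself, truth in the model is membership in the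
    theory.\<close>
  then have "sat val_term_model (\<lambda>i. denotation (Var i)) B" using sat_elim_claims[OF B] by simp
  then show "B \<in> refuting_theory" unfolding sat_term_model by simp
qed

end

theorem theorem3p2p1:
  fixes \<Phi> :: fm and m n :: nat
  assumes "qfree \<Phi>" and "fv \<Phi> \<subseteq> {..<n + m}"
  shows "\<exists>\<Psi>. qfree \<Psi> \<and> fv \<Psi> \<subseteq> {..<m} \<and> RCVF \<turnstile> Iff (Exs n \<Phi>) \<Psi>"
proof (intro exI conjI)
  let ?B = "Iff (Exs n \<Phi>) (elim_fm m n \<Phi>)"
  show "qfree (elim_fm m n \<Phi>)" using assms(1) by (rule qfree_elim_fm)
  show "fv (elim_fm m n \<Phi>) \<subseteq> {..<m}" using assms(1) by (rule fv_elim_fm)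
  show "RCVF \<turnstile> ?B"
  proof (rule ccontr)
    assume "\<not> RCVF \<turnstile> ?B"
    then have "\<not> derivable RCVF [Neg ?B] Fls" using derivable.Contr by blast
    then obtain H where H: "henkin H" "RCVF \<subseteq> H" "set [Neg ?B] \<subseteq> H"
      using henkin_extension[OF fv_RCVF] by metis
    then have "Neg ?B \<in> H" by simp
    then have "?B \<notin> H" using H(1) unfolding henkin_def by blast
    moreover have "?B \<in> elim_claims" unfolding elim_claims_def using assms by blast
    \<comment> \<open>H omits the claim \<open>?B\<close>, so the chosen theory also omits some
      claim, not necessarily the same one.\<close>
    ultimately have "RCVF \<subseteq> refuting_theory \<and> \<not> elim_claims \<subseteq> refuting_theory"
      using H refuting_theory(3) by blast
    then show False using elim_claims_refuting_theory by blast
  qed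
qed

end
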